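(* Over $\mathsf{ACA}_0^\omega$, each of the following items implies the next one: (i) $\mathsf{QF\text{-}AC}^{0,1}$. (ii) For every sequence $(S_n)_{n\in\mathbb{N}}$ of subsets of $[0,1]$ such that each $S_n$ is enumerable and non-empty, there is a sequence of reals $(x_n)_n$ with $x_n\in\overline{S_n}$ for all $n$. (iii) For every sequence $(S_n)_{n\in\mathbb{N}}$ of subsets of $[0,1]$ such that each $S_n$ is enumerable and $\overline{S_n}$ has positive measure, there is $(x_n)_n$ with $x_n\in\overline{S_n}$ for all $n$. (iv) $\mathsf{cocode}_1$: every strongly countable set $A\subseteq[0,1]$ can be enumerated.
   Context: Framework: Kohlenbach's higher-order reverse mathematics with base theory $\mathsf{RCA}_0^\omega$. $\mathsf{ACA}_0^\omega$ is $\mathsf{RCA}_0^\omega$ plus $(\exists^2)$: there is $E:\mathbb{N}^\mathbb{N}\to\{0,1\}$ with $(\forall f)[(\exists n)(f(n)=0)\leftrightarrow E(f)=0]$. $\mathsf{QF\text{-}AC}^{0,1}$: for any $Y$ with $(\forall n)(\exists f\in\mathbb{N}^\mathbb{N})(Y(f,n)=0)$ there is $(f_n)_n$ with $(\forall n)(Y(f_n,n)=0)$. Subsets of $\mathbb{R}$ are given by characteristic functions. A set $S$ is enumerable if there is a sequence of reals containing all elements of $S$. "$x\in\overline{S}$" abbreviates: there is a sequence $(y_m)_m$ containing all elements of $S$ such that $(\forall k)(\exists m)(|x-y_m|<2^{-k}\wedge y_m\in S)$ (the enumeration is left implicit); "$\overline{S}$ has positive measure" refers to Lebesgue measure of this closure.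 $A\subseteq[0,1]$ is strongly countable if there is $Y:[0,1]\to\mathbb{N}$ injective on $A$ with $(\forall n)(\exists x\in A)(Y(x)=n)$. *)

theory Defs
  imports Main
begin

section \<open>The language of finite types\<close>

text \<open>
  Terms are built by application from variables and constants; there is no abstraction, so that
  variables (de Bruijn indices) are bound by the quantifiers of formulas only. The only prime
  formulas are equations and inequalities of type \<open>N\<close> and falsity.
\<close>

datatype ty = N | Arr ty ty  (infixr "\<rightarrow>" 60)

abbreviation ty1 :: ty where "ty1 \<equiv> N \<rightarrow> N"
abbreviation ty2 :: ty where "ty2 \<equiv> ty1 \<rightarrow> N"

datatype const = Zero | One | Plus | Times | PiC ty ty | SigmaC ty ty ty | Rec

datatype tm = Bv nat | Cst const | App tm tm

datatype fm = Fls | Eq tm tm | Less tm tm | Imp fm fm | All ty fm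

primrec const_ty :: "const \<Rightarrow> ty" where
  "const_ty Zero = N"
| "const_ty One = N"
| "const_ty Plus = N \<rightarrow> N \<rightarrow> N"
| "const_ty Times = N \<rightarrow> N \<rightarrow> N"
| "const_ty (PiC \<rho> \<tau>) = \<rho> \<rightarrow> \<tau> \<rightarrow> \<rho>"
| "const_ty (SigmaC \<rho> \<sigma> \<tau>) = (\<rho> \<rightarrow> \<sigma> \<rightarrow> \<tau>) \<rightarrow> (\<rho> \<rightarrow> \<sigma>) \<rightarrow> \<rho> \<rightarrow> \<tau>"
| "const_ty Rec = (N \<rightarrow> N \<rightarrow> N) \<rightarrow> N \<rightarrow> N \<rightarrow> N"

text \<open>A typing context lists the types of the variables \<open>Bv 0\<close>, \<open>Bv 1\<close>, and so on.\<close>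

primrec tm_ty :: "ty list \<Rightarrow> tm \<Rightarrow> ty option" where
  "tm_ty ts (Bv n) = (if n < length ts then Some (ts ! n) else None)"
| "tm_ty ts (Cst c) = Some (const_ty c)"
| "tm_ty ts (App s t) =
    (case tm_ty ts s of
       Some (\<rho> \<rightarrow> \<tau>) \<Rightarrow> if tm_ty ts t = Some \<rho> then Some \<tau> else None
     | _ \<Rightarrow> None)"

primrec wff :: "ty list \<Rightarrow> fm \<Rightarrow> bool" where
  "wff ts Fls \<longleftrightarrow> True"
| "wff ts (Eq s t) \<longleftrightarrow> tm_ty ts s = Some N \<and> tm_ty ts t = Some N"
| "wff ts (Less s t) \<longleftrightarrow> tm_ty ts s = Some N \<and> tm_ty ts t = Some N"
| "wff ts (Imp \<phi> \<psi>) \<longleftrightarrow> wff ts \<phi> \<and> wff ts \<psi>"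
| "wff ts (All \<rho> \<phi>) \<longleftrightarrow> wff (\<rho> # ts) \<phi>"

primrec quantifier_free :: "fm \<Rightarrow> bool" where
  "quantifier_free Fls \<longleftrightarrow> True"
| "quantifier_free (Eq s t) \<longleftrightarrow> True"
| "quantifier_free (Less s t) \<longleftrightarrow> True"
| "quantifier_free (Imp \<phi> \<psi>) \<longleftrightarrow> quantifier_free \<phi> \<and> quantifier_free \<psi>"
| "quantifier_free (All \<rho> \<phi>) \<longleftrightarrow> False"

primrec subst_tm :: "(nat \<Rightarrow> tm) \<Rightarrow> tm \<Rightarrow> tm" where
  "subst_tm \<sigma> (Bv n) = \<sigma> n"
| "subst_tm \<sigma> (Cst c) = Cst c"
| "subst_tm \<sigma> (App s t) = App (subst_tm \<sigma> s) (subst_tm \<sigma> t)"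

definition under_binder :: "(nat \<Rightarrow> tm) \<Rightarrow> nat \<Rightarrow> tm" where
  "under_binder \<sigma> = case_nat (Bv 0) (\<lambda>n. subst_tm (\<lambda>k. Bv (Suc k)) (\<sigma> n))"

primrec subst :: "(nat \<Rightarrow> tm) \<Rightarrow> fm \<Rightarrow> fm" where
  "subst \<sigma> Fls = Fls"
| "subst \<sigma> (Eq s t) = Eq (subst_tm \<sigma> s) (subst_tm \<sigma> t)"
| "subst \<sigma> (Less s t) = Less (subst_tm \<sigma> s) (subst_tm \<sigma> t)"
| "subst \<sigma> (Imp \<phi> \<psi>) = Imp (subst \<sigma> \<phi>) (subst \<sigma> \<psi>)"
| "subst \<sigma> (All \<rho> \<phi>) = All \<rho> (subst (under_binder \<sigma>) \<phi>)"

abbreviation lift :: "fm \<Rightarrow> fm" where "lift \<equiv> subst (\<lambda>n. Bv (Suc n))"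

abbreviation inst :: "tm \<Rightarrow> fm \<Rightarrow> fm" where "inst t \<equiv> subst (case_nat t Bv)"

primrec univ_closure :: "ty list \<Rightarrow> fm \<Rightarrow> fm" where
  "univ_closure [] \<phi> = \<phi>"
| "univ_closure (\<rho> # ts) \<phi> = univ_closure ts (All \<rho> \<phi>)"


section \<open>Classical natural deduction\<close>

text \<open>
  \<open>prv T ts \<Gamma> \<phi>\<close>: \<open>\<phi>\<close> is derivable from the sentences \<open>T\<close> and the hypotheses \<open>\<Gamma>\<close>, where the
  free variables are typed by \<open>ts\<close>.
\<close>

inductive prv :: "fm set \<Rightarrow> ty list \<Rightarrow> fm list \<Rightarrow> fm \<Rightarrow> bool" for T :: "fm set" where
  axm: "\<phi> \<in> T \<Longrightarrow> wff [] \<phi> \<Longrightarrow> prv T ts \<Gamma> \<phi>"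
| hyp: "\<phi> \<in> set \<Gamma> \<Longrightarrow> wff ts \<phi> \<Longrightarrow> prv T ts \<Gamma> \<phi>"
| impI: "wff ts \<phi> \<Longrightarrow> prv T ts (\<phi> # \<Gamma>) \<psi> \<Longrightarrow> prv T ts \<Gamma> (Imp \<phi> \<psi>)"
| impE: "prv T ts \<Gamma> (Imp \<phi> \<psi>) \<Longrightarrow> prv T ts \<Gamma> \<phi> \<Longrightarrow> prv T ts \<Gamma> \<psi>"
| raa: "wff ts \<phi> \<Longrightarrow> prv T ts (Imp \<phi> Fls # \<Gamma>) Fls \<Longrightarrow> prv T ts \<Gamma> \<phi>"
| allI: "prv T (\<rho> # ts) (map lift \<Gamma>) \<phi> \<Longrightarrow> prv T ts \<Gamma> (All \<rho> \<phi>)"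
| allE: "prv T ts \<Gamma> (All \<rho> \<phi>) \<Longrightarrow> tm_ty ts t = Some \<rho> \<Longrightarrow> prv T ts \<Gamma> (inst t \<phi>)"
| eq_refl: "tm_ty ts t = Some N \<Longrightarrow> prv T ts \<Gamma> (Eq t t)"
| eq_subst: "wff (N # ts) \<phi> \<Longrightarrow> prv T ts \<Gamma> (Eq s t) \<Longrightarrow> prv T ts \<Gamma> (inst s \<phi>)
    \<Longrightarrow> prv T ts \<Gamma> (inst t \<phi>)"


section \<open>Writing formulas with named variables\<close>

text \<open>
  An \<open>hterm\<close> or \<open>hform\<close> maps the number of enclosing quantifiers to a term or formula. The variable
  bound by a quantifier at depth \<open>d\<close> has index \<open>d' - Suc d\<close> at depth \<open>d' > d\<close>, so that formulas can
  be written with Isabelle variables, and the macros below neither lift indices nor choose fresh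
  names. The sentence denoted by \<open>\<phi> :: hform\<close> is \<open>\<phi> 0\<close>.
\<close>

type_synonym hterm = "nat \<Rightarrow> tm"
type_synonym hform = "nat \<Rightarrow> fm"

definition hcst :: "const \<Rightarrow> hterm" where "hcst c = (\<lambda>d. Cst c)"

definition happ :: "hterm \<Rightarrow> hterm \<Rightarrow> hterm"  (infixl "\<cdot>" 90) where
  "s \<cdot> t = (\<lambda>d. App (s d) (t d))"

definition hfalse :: hform where "hfalse = (\<lambda>d. Fls)"

definition heq :: "hterm \<Rightarrow> hterm \<Rightarrow> hform"  (infix "\<^bold>=" 50) where
  "(s \<^bold>= t) = (\<lambda>d. Eq (s d) (t d))"

definition hless :: "hterm \<Rightarrow> hterm \<Rightarrow> hform"  (infix "\<^bold><" 50) where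
  "(s \<^bold>< t) = (\<lambda>d. Less (s d) (t d))"

definition himp :: "hform \<Rightarrow> hform \<Rightarrow> hform"  (infixr "\<^bold>\<longrightarrow>" 25) where
  "(\<phi> \<^bold>\<longrightarrow> \<psi>) = (\<lambda>d. Imp (\<phi> d) (\<psi> d))"

definition hall :: "ty \<Rightarrow> (hterm \<Rightarrow> hform) \<Rightarrow> hform" where
  "hall \<rho> F = (\<lambda>d. All \<rho> (F (\<lambda>d'. Bv (d' - Suc d)) (Suc d)))"

definition hnot :: "hform \<Rightarrow> hform"  ("\<^bold>\<not> _" [40] 40) where
  "(\<^bold>\<not> \<phi>) = (\<phi> \<^bold>\<longrightarrow> hfalse)"

definition hand :: "hform \<Rightarrow> hform \<Rightarrow> hform"  (infixr "\<^bold>\<and>" 35) where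
  "(\<phi> \<^bold>\<and> \<psi>) = (\<^bold>\<not> (\<phi> \<^bold>\<longrightarrow> \<^bold>\<not> \<psi>))"

definition hor :: "hform \<Rightarrow> hform \<Rightarrow> hform"  (infixr "\<^bold>\<or>" 30) where
  "(\<phi> \<^bold>\<or> \<psi>) = (\<^bold>\<not> \<phi> \<^bold>\<longrightarrow> \<psi>)"

definition hiff :: "hform \<Rightarrow> hform \<Rightarrow> hform"  (infixr "\<^bold>\<longleftrightarrow>" 25) where
  "(\<phi> \<^bold>\<longleftrightarrow> \<psi>) = ((\<phi> \<^bold>\<longrightarrow> \<psi>) \<^bold>\<and> (\<psi> \<^bold>\<longrightarrow> \<phi>))"

definition hex :: "ty \<Rightarrow> (hterm \<Rightarrow> hform) \<Rightarrow> hform" where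
  "hex \<rho> F = (\<^bold>\<not> hall \<rho> (\<lambda>x. \<^bold>\<not> F x))"

syntax
  "_hall" :: "[pttrn, ty, hform] \<Rightarrow> hform"  ("(3\<^bold>\<forall>_:_./ _)" [0, 60, 20] 20)
  "_hex" :: "[pttrn, ty, hform] \<Rightarrow> hform"  ("(3\<^bold>\<exists>_:_./ _)" [0, 60, 20] 20)
translations
  "\<^bold>\<forall>x:\<rho>. \<phi>" \<rightleftharpoons> "CONST hall \<rho> (\<lambda>x. \<phi>)"
  "\<^bold>\<exists>x:\<rho>. \<phi>" \<rightleftharpoons> "CONST hex \<rho> (\<lambda>x. \<phi>)"

definition hzero :: hterm  ("\<^bold>0") where "\<^bold>0 = hcst Zero"
definition hone :: hterm  ("\<^bold>1") where "\<^bold>1 = hcst One"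

definition hplus :: "hterm \<Rightarrow> hterm \<Rightarrow> hterm"  (infixl "\<^bold>+" 65) where
  "s \<^bold>+ t = hcst Plus \<cdot> s \<cdot> t"

definition htimes :: "hterm \<Rightarrow> hterm \<Rightarrow> hterm"  (infixl "\<^bold>*" 70) where
  "s \<^bold>* t = hcst Times \<cdot> s \<cdot> t"

text \<open>Equality of higher type is extensional equality.\<close>

fun eq_at :: "ty \<Rightarrow> hterm \<Rightarrow> hterm \<Rightarrow> hform" where
  "eq_at N s t = (s \<^bold>= t)"
| "eq_at (\<rho> \<rightarrow> \<tau>) s t = (\<^bold>\<forall>z:\<rho>. eq_at \<tau> (s \<cdot> z) (t \<cdot> z))"

definition provable :: "fm set \<Rightarrow> hform \<Rightarrow> bool"  (infix "\<turnstile>" 20) where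
  "(T \<turnstile> \<phi>) \<longleftrightarrow> prv T [] [] (\<phi> 0)"


section \<open>The base theory\<close>

text \<open>
  The base theory follows Kohlenbach: arithmetic, the combinators \<open>\<Pi>\<close> and \<open>\<Sigma>\<close>, recursion with values of
  type \<open>N\<close>, extensionality in all types, quantifier-free induction and \<open>QF-AC\<^sup>1\<^sup>,\<^sup>0\<close>. The arithmetical
  axioms are the basic axioms of second-order arithmetic, which together with induction yield a
  discretely ordered semiring.
\<close>

definition basic_arithmetic :: "hform set" where
  "basic_arithmetic =
    { \<^bold>\<forall>n:N. \<^bold>\<not> n \<^bold>+ \<^bold>1 \<^bold>= \<^bold>0,
      \<^bold>\<forall>m:N. \<^bold>\<forall>n:N. m \<^bold>+ \<^bold>1 \<^bold>= n \<^bold>+ \<^bold>1 \<^bold>\<longrightarrow> m \<^bold>= n,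
      \<^bold>\<forall>m:N. m \<^bold>+ \<^bold>0 \<^bold>= m,
      \<^bold>\<forall>m:N. \<^bold>\<forall>n:N. m \<^bold>+ (n \<^bold>+ \<^bold>1) \<^bold>= (m \<^bold>+ n) \<^bold>+ \<^bold>1,
      \<^bold>\<forall>m:N. m \<^bold>* \<^bold>0 \<^bold>= \<^bold>0,
      \<^bold>\<forall>m:N. \<^bold>\<forall>n:N. m \<^bold>* (n \<^bold>+ \<^bold>1) \<^bold>= m \<^bold>* n \<^bold>+ m,
      \<^bold>\<forall>m:N. \<^bold>\<not> m \<^bold>< \<^bold>0,
      \<^bold>\<forall>m:N. \<^bold>\<forall>n:N. m \<^bold>< n \<^bold>+ \<^bold>1 \<^bold>\<longleftrightarrow> (m \<^bold>< n \<^bold>\<or> m \<^bold>= n) }"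

definition Pi_axiom :: "ty \<Rightarrow> ty \<Rightarrow> hform" where
  "Pi_axiom \<rho> \<tau> = (\<^bold>\<forall>x:\<rho>. \<^bold>\<forall>y:\<tau>. eq_at \<rho> (hcst (PiC \<rho> \<tau>) \<cdot> x \<cdot> y) x)"

definition Sigma_axiom :: "ty \<Rightarrow> ty \<Rightarrow> ty \<Rightarrow> hform" where
  "Sigma_axiom \<rho> \<sigma> \<tau> =
    (\<^bold>\<forall>x:\<rho> \<rightarrow> \<sigma> \<rightarrow> \<tau>. \<^bold>\<forall>y:\<rho> \<rightarrow> \<sigma>. \<^bold>\<forall>z:\<rho>.
      eq_at \<tau> (hcst (SigmaC \<rho> \<sigma> \<tau>) \<cdot> x \<cdot> y \<cdot> z) (x \<cdot> z \<cdot> (y \<cdot> z)))"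

definition Rec_axiom :: hform where
  "Rec_axiom =
    (\<^bold>\<forall>f:N \<rightarrow> N \<rightarrow> N. \<^bold>\<forall>m:N.
      hcst Rec \<cdot> f \<cdot> m \<cdot> \<^bold>0 \<^bold>= m \<^bold>\<and>
      (\<^bold>\<forall>n:N. hcst Rec \<cdot> f \<cdot> m \<cdot> (n \<^bold>+ \<^bold>1) \<^bold>= f \<cdot> n \<cdot> (hcst Rec \<cdot> f \<cdot> m \<cdot> n)))"

definition extensionality_axiom :: "ty \<Rightarrow> ty \<Rightarrow> hform" where
  "extensionality_axiom \<rho> \<tau> =
    (\<^bold>\<forall>x:\<rho>. \<^bold>\<forall>y:\<rho>. \<^bold>\<forall>f:\<rho> \<rightarrow> \<tau>. eq_at \<rho> x y \<^bold>\<longrightarrow> eq_at \<tau> (f \<cdot> x) (f \<cdot> y))"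

text \<open>
  In the two schemata \<open>A\<close> is a formula whose variable \<open>Bv 0\<close> is the induction variable, respectively
  whose variables \<open>Bv 0\<close> and \<open>Bv 1\<close> are the number \<open>n\<close> and the function \<open>f\<close> in
  \<open>(\<forall>f)(\<exists>n) A(f,n) \<longrightarrow> (\<exists>F)(\<forall>f) A(f,F(f))\<close>; the remaining variables are parameters.
\<close>

definition induction_axiom :: "fm \<Rightarrow> fm" where
  "induction_axiom A =
    Imp (inst (Cst Zero) A)
      (Imp (All N (Imp A (subst
          (case_nat (App (App (Cst Plus) (Bv 0)) (Cst One)) (\<lambda>k. Bv (Suc k))) A)))
        (All N A))"

definition choice_axiom_10 :: "fm \<Rightarrow> fm" where
  "choice_axiom_10 A =
    (let Neg = (\<lambda>\<phi>. Imp \<phi> Fls); Ex = (\<lambda>\<rho> \<phi>. Neg (All \<rho> (Neg \<phi>))) in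
     Imp (All ty1 (Ex N A))
       (Ex ty2 (All ty1 (subst
          (case_nat (App (Bv 1) (Bv 0)) (case_nat (Bv 0) (\<lambda>k. Bv (k + 2)))) A))))"

inductive_set RCA0w :: "fm set" where
  "\<phi> \<in> basic_arithmetic \<Longrightarrow> \<phi> 0 \<in> RCA0w"
| "Pi_axiom \<rho> \<tau> 0 \<in> RCA0w"
| "Sigma_axiom \<rho> \<sigma> \<tau> 0 \<in> RCA0w"
| "Rec_axiom 0 \<in> RCA0w"
| "extensionality_axiom \<rho> \<tau> 0 \<in> RCA0w"
| "quantifier_free A \<Longrightarrow> wff (N # ts) A \<Longrightarrow> univ_closure ts (induction_axiom A) \<in> RCA0w"
| "quantifier_free A \<Longrightarrow> wff (N # ty1 # ts) A \<Longrightarrow> univ_closure ts (choice_axiom_10 A) \<in> RCA0w"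

definition exists_2 :: hform where
  "exists_2 =
    (\<^bold>\<exists>E:ty2. \<^bold>\<forall>f:ty1. (E \<cdot> f \<^bold>= \<^bold>0 \<^bold>\<or> E \<cdot> f \<^bold>= \<^bold>1) \<^bold>\<and> ((\<^bold>\<exists>n:N. f \<cdot> n \<^bold>= \<^bold>0) \<^bold>\<longleftrightarrow> E \<cdot> f \<^bold>= \<^bold>0))"

definition ACA0w :: "fm set" where
  "ACA0w = insert (exists_2 0) RCA0w"


section \<open>Rationals and reals\<close>

text \<open>\<open>2\<^sup>k\<close> is \<open>Rec (\<lambda>i m. m + m) 1 k\<close>.\<close>

definition pow2 :: "hterm \<Rightarrow> hterm" where
  "pow2 k =
    (let I = hcst (SigmaC N ty1 N) \<cdot> hcst (PiC N ty1) \<cdot> hcst (PiC N N);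
         double = hcst (SigmaC N N N) \<cdot> hcst Plus \<cdot> I
     in hcst Rec \<cdot> (hcst (PiC ty1 N) \<cdot> double) \<cdot> \<^bold>1 \<cdot> k)"

text \<open>
  A triple \<open>(p, n, d)\<close> stands for the rational \<open>(p - n) / d\<close>, where \<open>d > 0\<close>.
\<close>

type_synonym hrat = "hterm \<times> hterm \<times> hterm"

fun rat_plus :: "hrat \<Rightarrow> hrat \<Rightarrow> hrat"  (infixl "+\<^sub>Q" 65) where
  "(p, n, d) +\<^sub>Q (p', n', d') = (p \<^bold>* d' \<^bold>+ p' \<^bold>* d, n \<^bold>* d' \<^bold>+ n' \<^bold>* d, d \<^bold>* d')"

fun rat_uminus :: "hrat \<Rightarrow> hrat"  ("-\<^sub>Q _" [81] 80) where
  "-\<^sub>Q (p, n, d) = (n, p, d)"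

fun rat_eq :: "hrat \<Rightarrow> hrat \<Rightarrow> hform"  (infix "=\<^sub>Q" 50) where
  "((p, n, d) =\<^sub>Q (p', n', d')) = (p \<^bold>* d' \<^bold>+ n' \<^bold>* d \<^bold>= p' \<^bold>* d \<^bold>+ n \<^bold>* d')"

fun rat_less :: "hrat \<Rightarrow> hrat \<Rightarrow> hform"  (infix "<\<^sub>Q" 50) where
  "((p, n, d) <\<^sub>Q (p', n', d')) = (p \<^bold>* d' \<^bold>+ n' \<^bold>* d \<^bold>< p' \<^bold>* d \<^bold>+ n \<^bold>* d')"

definition rat_le :: "hrat \<Rightarrow> hrat \<Rightarrow> hform"  (infix "\<le>\<^sub>Q" 50) where
  "(q \<le>\<^sub>Q r) = (q <\<^sub>Q r \<^bold>\<or> q =\<^sub>Q r)"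

definition rat_zero :: hrat  ("0\<^sub>Q") where "0\<^sub>Q = (\<^bold>0, \<^bold>0, \<^bold>1)"
definition rat_one :: hrat  ("1\<^sub>Q") where "1\<^sub>Q = (\<^bold>1, \<^bold>0, \<^bold>1)"

definition half_pow :: "hterm \<Rightarrow> hrat" where "half_pow k = (\<^bold>1, \<^bold>0, pow2 k)"
definition twice_half_pow :: "hterm \<Rightarrow> hrat" where "twice_half_pow k = (\<^bold>1 \<^bold>+ \<^bold>1, \<^bold>0, pow2 k)"

definition dist_less :: "hrat \<Rightarrow> hrat \<Rightarrow> hrat \<Rightarrow> hform" where
  "dist_less q r e = (q <\<^sub>Q r +\<^sub>Q e \<^bold>\<and> r <\<^sub>Q q +\<^sub>Q e)"

definition dist_le :: "hrat \<Rightarrow> hrat \<Rightarrow> hrat \<Rightarrow> hform" where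
  "dist_le q r e = (q \<le>\<^sub>Q r +\<^sub>Q e \<^bold>\<and> r \<le>\<^sub>Q q +\<^sub>Q e)"

text \<open>
  Kohlenbach's coding: with Cantor's pairing \<open>j(u,v) = (u + v)(u + v + 1) / 2 + u\<close>, the number
  \<open>j(u,v)\<close> codes the rational \<open>(u/2) / (v+1)\<close> for even \<open>u\<close> and \<open>-((u+1)/2) / (v+1)\<close> for odd \<open>u\<close>.
  Every number is the code of exactly one such triple.
\<close>

definition codes_rat :: "hterm \<Rightarrow> hterm \<Rightarrow> hterm \<Rightarrow> hterm \<Rightarrow> hform" where
  "codes_rat c p n d =
    (\<^bold>\<exists>u:N. \<^bold>\<exists>v:N.
       c \<^bold>+ c \<^bold>= (u \<^bold>+ v) \<^bold>* (u \<^bold>+ v \<^bold>+ \<^bold>1) \<^bold>+ (u \<^bold>+ u) \<^bold>\<and>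
       d \<^bold>= v \<^bold>+ \<^bold>1 \<^bold>\<and>
       ((u \<^bold>= p \<^bold>+ p \<^bold>\<and> n \<^bold>= \<^bold>0) \<^bold>\<or> (u \<^bold>+ \<^bold>1 \<^bold>= n \<^bold>+ n \<^bold>\<and> p \<^bold>= \<^bold>0)))"

definition decode :: "hterm \<Rightarrow> (hrat \<Rightarrow> hform) \<Rightarrow> hform" where
  "decode c \<phi> = (\<^bold>\<exists>p:N. \<^bold>\<exists>n:N. \<^bold>\<exists>d:N. codes_rat c p n d \<^bold>\<and> \<phi> (p, n, d))"

text \<open>
  A real is a sequence of codes of rationals with \<open>\<bar>q\<^sub>n - q\<^sub>n\<^sub>+\<^sub>i\<bar> < 2\<^sup>-\<^sup>n\<close>. Hence the \<open>k\<close>-th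
  approximation of a real is within \<open>2\<^sup>-\<^sup>k\<close> of it, which accounts for the error terms below.
\<close>

definition is_real :: "hterm \<Rightarrow> hform" where
  "is_real x =
    (\<^bold>\<forall>n:N. \<^bold>\<forall>i:N. decode (x \<cdot> n) (\<lambda>q. decode (x \<cdot> (n \<^bold>+ i)) (\<lambda>r. dist_less q r (half_pow n))))"

definition real_eq :: "hterm \<Rightarrow> hterm \<Rightarrow> hform"  (infix "=\<^sub>R" 50) where
  "(x =\<^sub>R y) = (\<^bold>\<forall>n:N. decode (x \<cdot> n) (\<lambda>q. decode (y \<cdot> n) (\<lambda>r. dist_le q r (twice_half_pow n))))"

definition rat_less_real :: "hrat \<Rightarrow> hterm \<Rightarrow> hform" where
  "rat_less_real q x = (\<^bold>\<exists>k:N. decode (x \<cdot> k) (\<lambda>r. q +\<^sub>Q half_pow k <\<^sub>Q r))"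

definition real_less_rat :: "hterm \<Rightarrow> hrat \<Rightarrow> hform" where
  "real_less_rat x q = (\<^bold>\<exists>k:N. decode (x \<cdot> k) (\<lambda>r. r +\<^sub>Q half_pow k <\<^sub>Q q))"

definition in_unit_interval :: "hterm \<Rightarrow> hform" where
  "in_unit_interval x = (is_real x \<^bold>\<and> \<^bold>\<not> real_less_rat x 0\<^sub>Q \<^bold>\<and> \<^bold>\<not> rat_less_real 1\<^sub>Q x)"

text \<open>\<open>\<bar>x - y\<bar> < 2\<^sup>-\<^sup>k\<close>\<close>

definition real_dist_less :: "hterm \<Rightarrow> hterm \<Rightarrow> hterm \<Rightarrow> hform" where
  "real_dist_less x y k =
    (\<^bold>\<exists>j:N. decode (x \<cdot> j) (\<lambda>q. decode (y \<cdot> j) (\<lambda>r.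
       (q +\<^sub>Q -\<^sub>Q r) +\<^sub>Q twice_half_pow j <\<^sub>Q half_pow k \<^bold>\<and>
       (r +\<^sub>Q -\<^sub>Q q) +\<^sub>Q twice_half_pow j <\<^sub>Q half_pow k)))"


section \<open>Sets of reals\<close>

text \<open>
  As usual, functions on the reals are functionals respecting \<open>=\<^sub>R\<close>; their values at arguments that
  do not represent reals are irrelevant.
\<close>

definition is_set :: "hterm \<Rightarrow> hform" where
  "is_set S =
    (\<^bold>\<forall>x:ty1. is_real x \<^bold>\<longrightarrow>
       (S \<cdot> x \<^bold>= \<^bold>0 \<^bold>\<or> S \<cdot> x \<^bold>= \<^bold>1) \<^bold>\<and> (\<^bold>\<forall>y:ty1. is_real y \<^bold>\<and> x =\<^sub>R y \<^bold>\<longrightarrow> S \<cdot> x \<^bold>= S \<cdot> y))"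

definition elem :: "hterm \<Rightarrow> hterm \<Rightarrow> hform" where
  "elem x S = (is_real x \<^bold>\<and> S \<cdot> x \<^bold>= \<^bold>1)"

definition is_subset_of_unit_interval :: "hterm \<Rightarrow> hform" where
  "is_subset_of_unit_interval S =
    (is_set S \<^bold>\<and> (\<^bold>\<forall>x:ty1. elem x S \<^bold>\<longrightarrow> in_unit_interval x))"

definition nonempty :: "hterm \<Rightarrow> hform" where
  "nonempty S = (\<^bold>\<exists>x:ty1. elem x S)"

text \<open>\<open>y\<close> is a sequence of reals containing all elements of \<open>S\<close> (and possibly other reals).\<close>

definition enumerates :: "hterm \<Rightarrow> hterm \<Rightarrow> hform" where
  "enumerates y S =
    ((\<^bold>\<forall>m:N. is_real (y \<cdot> m)) \<^bold>\<and> (\<^bold>\<forall>x:ty1. elem x S \<^bold>\<longrightarrow> (\<^bold>\<exists>m:N. x =\<^sub>R y \<cdot> m)))"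

definition enumerable :: "hterm \<Rightarrow> hform" where
  "enumerable S = (\<^bold>\<exists>y:N \<rightarrow> ty1. enumerates y S)"

definition in_closure :: "hterm \<Rightarrow> hterm \<Rightarrow> hform" where
  "in_closure x S =
    (is_real x \<^bold>\<and>
     (\<^bold>\<exists>y:N \<rightarrow> ty1. enumerates y S \<^bold>\<and>
        (\<^bold>\<forall>k:N. \<^bold>\<exists>m:N. real_dist_less x (y \<cdot> m) k \<^bold>\<and> elem (y \<cdot> m) S)))"

text \<open>
  The closure of \<open>S\<close> has positive Lebesgue measure if the total lengths of its covers by sequences of
  open intervals \<open>(a\<^sub>i, b\<^sub>i)\<close> with rational end-points are bounded away from \<open>0\<close>. The sequence \<open>s\<close>
  consists of the partial sums \<open>\<Sum>\<^sub>i\<^sub><\<^sub>m (b\<^sub>i - a\<^sub>i)\<close>.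
\<close>

definition covers_closure :: "hterm \<Rightarrow> hterm \<Rightarrow> hterm \<Rightarrow> hform" where
  "covers_closure a b S =
    ((\<^bold>\<forall>i:N. decode (a \<cdot> i) (\<lambda>p. decode (b \<cdot> i) (\<lambda>q. p \<le>\<^sub>Q q))) \<^bold>\<and>
     (\<^bold>\<forall>x:ty1. in_closure x S \<^bold>\<longrightarrow>
        (\<^bold>\<exists>i:N. decode (a \<cdot> i) (\<lambda>p. rat_less_real p x) \<^bold>\<and> decode (b \<cdot> i) (\<lambda>q. real_less_rat x q))))"

definition partial_lengths :: "hterm \<Rightarrow> hterm \<Rightarrow> hterm \<Rightarrow> hform" where
  "partial_lengths a b s =
    (decode (s \<cdot> \<^bold>0) (\<lambda>u. u =\<^sub>Q 0\<^sub>Q) \<^bold>\<and>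
     (\<^bold>\<forall>i:N. decode (a \<cdot> i) (\<lambda>p. decode (b \<cdot> i) (\<lambda>q. decode (s \<cdot> i) (\<lambda>u.
        decode (s \<cdot> (i \<^bold>+ \<^bold>1)) (\<lambda>v. v =\<^sub>Q u +\<^sub>Q (q +\<^sub>Q -\<^sub>Q p)))))))"

definition closure_has_positive_measure :: "hterm \<Rightarrow> hform" where
  "closure_has_positive_measure S =
    (\<^bold>\<exists>k:N. \<^bold>\<forall>a:ty1. \<^bold>\<forall>b:ty1. \<^bold>\<forall>s:ty1.
       covers_closure a b S \<^bold>\<and> partial_lengths a b s \<^bold>\<longrightarrow>
       (\<^bold>\<exists>m:N. decode (s \<cdot> m) (\<lambda>u. half_pow k <\<^sub>Q u)))"

definition strongly_countable :: "hterm \<Rightarrow> hform" where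
  "strongly_countable A =
    (\<^bold>\<exists>Y:ty2.
       (\<^bold>\<forall>x:ty1. \<^bold>\<forall>y:ty1. in_unit_interval x \<^bold>\<and> in_unit_interval y \<^bold>\<and> x =\<^sub>R y \<^bold>\<longrightarrow> Y \<cdot> x \<^bold>= Y \<cdot> y) \<^bold>\<and>
       (\<^bold>\<forall>x:ty1. \<^bold>\<forall>y:ty1. elem x A \<^bold>\<and> elem y A \<^bold>\<and> Y \<cdot> x \<^bold>= Y \<cdot> y \<^bold>\<longrightarrow> x =\<^sub>R y) \<^bold>\<and>
       (\<^bold>\<forall>n:N. \<^bold>\<exists>x:ty1. elem x A \<^bold>\<and> Y \<cdot> x \<^bold>= n))"


section \<open>The principles\<close>

definition QF_AC_01 :: hform where
  "QF_AC_01 =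
    (\<^bold>\<forall>Y:ty1 \<rightarrow> N \<rightarrow> N.
       (\<^bold>\<forall>n:N. \<^bold>\<exists>f:ty1. Y \<cdot> f \<cdot> n \<^bold>= \<^bold>0) \<^bold>\<longrightarrow>
       (\<^bold>\<exists>f:N \<rightarrow> ty1. \<^bold>\<forall>n:N. Y \<cdot> (f \<cdot> n) \<cdot> n \<^bold>= \<^bold>0))"

definition closure_choice_nonempty :: hform where
  "closure_choice_nonempty =
    (\<^bold>\<forall>S:N \<rightarrow> ty2.
       (\<^bold>\<forall>n:N. is_subset_of_unit_interval (S \<cdot> n) \<^bold>\<and> enumerable (S \<cdot> n) \<^bold>\<and> nonempty (S \<cdot> n)) \<^bold>\<longrightarrow>
       (\<^bold>\<exists>x:N \<rightarrow> ty1. \<^bold>\<forall>n:N. in_closure (x \<cdot> n) (S \<cdot> n)))"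

definition closure_choice_positive_measure :: hform where
  "closure_choice_positive_measure =
    (\<^bold>\<forall>S:N \<rightarrow> ty2.
       (\<^bold>\<forall>n:N. is_subset_of_unit_interval (S \<cdot> n) \<^bold>\<and> enumerable (S \<cdot> n) \<^bold>\<and>
               closure_has_positive_measure (S \<cdot> n)) \<^bold>\<longrightarrow>
       (\<^bold>\<exists>x:N \<rightarrow> ty1. \<^bold>\<forall>n:N. in_closure (x \<cdot> n) (S \<cdot> n)))"

definition cocode_1 :: hform where
  "cocode_1 =
    (\<^bold>\<forall>A:ty2. is_subset_of_unit_interval A \<^bold>\<and> strongly_countable A \<^bold>\<longrightarrow> enumerable A)"

end

theory Submission
  imports Defs "HOL-Library.Countable" "HOL-Computational_Algebra.Fraction_Field"
begin

text \<open>
  By completeness of the calculus it suffices to argue in an arbitrary model of \<open>ACA\<^sub>0\<^sup>\<omega>\<close>, possibly with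
  non-standard numbers; by the extensionality axioms it may be taken to be extensional, with true
  equality in all types. The combinators, \<open>QF-AC\<^sup>1\<^sup>,\<^sup>0\<close> and \<open>\<exists>\<^sup>2\<close> make all arithmetically definable
  functionals elements of the model and give induction for arithmetical predicates.

  (i) to (ii): membership in \<open>S\<^sub>n\<close> is arithmetical, so \<open>QF-AC\<^sup>0\<^sup>,\<^sup>1\<close> chooses elements of the \<open>S\<^sub>n\<close> themselves.
  (ii) to (iii): the closure of an empty set is covered by degenerate intervals.
  (iii) to (iv): let \<open>w\<^sub>n\<close> be the element of \<open>A\<close> with label \<open>n\<close>. The set \<open>S\<^sub>n\<^sub>,\<^sub>k\<close> of the points of \<open>[0,1]\<close> that
  are rational translates of \<open>w\<^sub>n\<close> by less than \<open>2\<^sup>-\<^sup>k\<close> is arithmetical in \<open>A\<close> and the labelling. For each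
  \<open>n\<close> and \<open>k\<close> it is enumerable, and its closure contains an interval, which has positive measure by
  a bisection argument. Points chosen from the closures converge to \<open>w\<^sub>n\<close> as \<open>k\<close> grows, at a known rate.
\<close>


section \<open>Substitution\<close>

text \<open>The difficulty of (iii) to (iv): for each label \<open>n\<close> there is, up to
  equality of reals, one point \<open>w\<close> of \<open>A\<close> bearing it, yet no sequence of
  these points is at hand, since producing one is the conclusion. So the sets fed to (iii) must not
  mention the points. They are described from the side of the argument: some small rational shift of
  \<open>x\<close> lies in \<open>A\<close> and bears label \<open>n\<close>. This quantifies over
  numbers only, so \<open>exists_2\<close> decides it. The points themselves enter in verifications
  only, one label at a time.

  Since a model may be non-standard, HOL's own induction, recursion and search do not apply to its
  numbers. Each such step is made inside the model, together with a proof that the predicate or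
  function concerned is definable there. This accounts for the many side goals about
  \<open>dfn\<close>, \<open>dec\<close>, \<open>ndf\<close> and \<open>qdf\<close>. Linear
  arithmetic over the rationals of the model, on the other hand, calls for a HOL type of class
  \<open>linordered_idom\<close>, and a type cannot depend on a varying model. Hence a single
  counter-model is fixed globally and then shown not to exist.\<close>

instance ty :: countable by countable_datatype
instance const :: countable by countable_datatype
instance tm :: countable by countable_datatype
instance fm :: countable by countable_datatype

lemma tm_ty_append: "tm_ty ts t = Some \<tau> \<Longrightarrow> tm_ty (ts @ us) t = Some \<tau>"
  by (induction t arbitrary: \<tau>) (auto simp: nth_append split: if_splits option.splits ty.splits)

lemma wff_append: "wff ts \<phi> \<Longrightarrow> wff (ts @ us) \<phi>"
proof (induction \<phi> arbitrary: ts)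
  case (All \<rho> \<phi>)
  then show ?case using All.IH[of "\<rho> # ts"] by simp
qed (auto simp: tm_ty_append)

definition well_typed :: "ty list \<Rightarrow> (nat \<Rightarrow> tm) \<Rightarrow> ty list \<Rightarrow> bool" where
  "well_typed us \<sigma> ts \<longleftrightarrow> (\<forall>i<length ts. tm_ty us (\<sigma> i) = Some (ts ! i))"

lemma tm_ty_subst: "tm_ty ts t = Some \<tau> \<Longrightarrow> well_typed us \<sigma> ts \<Longrightarrow> tm_ty us (subst_tm \<sigma> t) = Some \<tau>"
  by (induction t arbitrary: \<tau>)
    (auto simp: well_typed_def split: if_splits option.splits ty.splits)

lemma well_typed_shift: "well_typed (\<rho> # ts) (\<lambda>n. Bv (Suc n)) ts"
  by (auto simp: well_typed_def)

lemma well_typed_under: "well_typed us \<sigma> ts \<Longrightarrow> well_typed (\<rho> # us) (under_binder \<sigma>) (\<rho> # ts)"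
  unfolding under_binder_def
  by (subst well_typed_def, auto simp: less_Suc_eq_0_disj)
     (metis tm_ty_subst well_typed_def well_typed_shift)

lemma wff_subst: "wff ts \<phi> \<Longrightarrow> well_typed us \<sigma> ts \<Longrightarrow> wff us (subst \<sigma> \<phi>)"
  by (induction \<phi> arbitrary: ts us \<sigma>) (auto simp: tm_ty_subst well_typed_under)

lemma well_typed_inst: "tm_ty ts t = Some \<rho> \<Longrightarrow> well_typed ts (case_nat t Bv) (\<rho> # ts)"
  by (auto simp: well_typed_def less_Suc_eq_0_disj)

lemma subst_tm_cong:
  "tm_ty ts t = Some \<tau> \<Longrightarrow> (\<And>i. i < length ts \<Longrightarrow> \<sigma> i = \<sigma>' i) \<Longrightarrow> subst_tm \<sigma> t = subst_tm \<sigma>' t"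
  by (induction t arbitrary: \<tau>) (auto split: if_splits option.splits ty.splits)

lemma subst_cong:
  "wff ts \<phi> \<Longrightarrow> (\<And>i. i < length ts \<Longrightarrow> \<sigma> i = \<sigma>' i) \<Longrightarrow> subst \<sigma> \<phi> = subst \<sigma>' \<phi>"
proof (induction \<phi> arbitrary: ts \<sigma> \<sigma>')
  case (Imp \<phi> \<psi>)
  show ?case using Imp.prems(1) Imp.IH(1)[of ts \<sigma> \<sigma>', OF _ Imp.prems(2)]
      Imp.IH(2)[of ts \<sigma> \<sigma>', OF _ Imp.prems(2)] by auto
next
  case (All \<rho> \<phi>)
  have "under_binder \<sigma> i = under_binder \<sigma>' i" if "i < length (\<rho> # ts)" for i
    using All.prems(2) that by (auto simp: under_binder_def split: nat.splits)
  from All.IH[of "\<rho> # ts" "under_binder \<sigma>" "under_binder \<sigma>'", OF _ this]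
  show ?case using All.prems(1) by simp
next
  case (Eq s t)
  then show ?case using subst_tm_cong[of ts _ _ \<sigma> \<sigma>', OF _ Eq.prems(2)] by simp
next
  case (Less s t)
  then show ?case using subst_tm_cong[of ts _ _ \<sigma> \<sigma>', OF _ Less.prems(2)] by simp
qed simp

lemma subst_tm_subst_tm: "subst_tm \<sigma> (subst_tm \<theta> t) = subst_tm (\<lambda>n. subst_tm \<sigma> (\<theta> n)) t"
  by (induction t) auto

lemma under_binder_comp:
  "(\<lambda>n. subst_tm (under_binder \<sigma>) (under_binder \<theta> n)) = under_binder (\<lambda>n. subst_tm \<sigma> (\<theta> n))"
  by (auto simp: fun_eq_iff under_binder_def subst_tm_subst_tm split: nat.splits)

lemma subst_subst: "subst \<sigma> (subst \<theta> \<phi>) = subst (\<lambda>n. subst_tm \<sigma> (\<theta> n)) \<phi>"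
  by (induction \<phi> arbitrary: \<sigma> \<theta>) (auto simp: subst_tm_subst_tm under_binder_comp)

lemma subst_tm_Bv: "subst_tm Bv t = t"
  by (induction t) auto

lemma under_binder_Bv: "under_binder Bv = Bv"
  by (auto simp: fun_eq_iff under_binder_def split: nat.splits)

lemma subst_Bv: "subst Bv \<phi> = \<phi>"
  by (induction \<phi>) (auto simp: subst_tm_Bv under_binder_Bv)

lemma subst_closed: "wff [] \<phi> \<Longrightarrow> subst \<sigma> \<phi> = \<phi>"
  using subst_cong[of "[]" \<phi> \<sigma> Bv] by (simp add: subst_Bv)

lemma subst_inst: "subst \<sigma> (inst t \<phi>) = inst (subst_tm \<sigma> t) (subst (under_binder \<sigma>) \<phi>)"
  unfolding subst_subst
  by (rule arg_cong[where f = "\<lambda>s. subst s \<phi>"])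
     (auto simp: fun_eq_iff under_binder_def subst_tm_subst_tm subst_tm_Bv split: nat.splits)

lemma subst_lift: "subst (under_binder \<sigma>) (lift \<phi>) = lift (subst \<sigma> \<phi>)"
  unfolding subst_subst
  by (rule arg_cong[where f = "\<lambda>s. subst s \<phi>"]) (auto simp: fun_eq_iff under_binder_def)

text \<open>In the quantifier case of \<open>sat_model\<close>, instantiating the bound variable
  thereby becomes an extended substitution, to which the induction hypothesis applies.\<close>

lemma inst_under: "inst t (subst (under_binder \<sigma>) \<phi>) = subst (case_nat t \<sigma>) \<phi>"
  unfolding subst_subst
  by (rule arg_cong[where f = "\<lambda>s. subst s \<phi>"])
     (auto simp: fun_eq_iff under_binder_def subst_tm_subst_tm subst_tm_Bv split: nat.splits)


section \<open>Structural rules\<close>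

text \<open>Source of context weakening (with the identity substitution) and of the removal of
  surplus variables in \<open>derives_allI\<close> and \<open>completeness\<close>. The induction
  varies \<open>\<sigma>\<close> and \<open>us\<close> because \<open>allI\<close> moves under a
  binder.\<close>

lemma prv_subst:
  "prv T ts \<Gamma> \<phi> \<Longrightarrow> well_typed us \<sigma> ts \<Longrightarrow> prv T us (map (subst \<sigma>) \<Gamma>) (subst \<sigma> \<phi>)"
proof (induction arbitrary: us \<sigma> rule: prv.induct)
  case (axm \<phi> ts \<Gamma>)
  then show ?case by (simp add: subst_closed prv.axm)
next
  case (hyp \<phi> \<Gamma> ts)
  then show ?case by (auto intro!: prv.hyp intro: wff_subst)
next
  case (impI ts \<phi> \<Gamma> \<psi>)
  show ?case unfolding subst.simps
    by (rule prv.impI) (use impI.hyps impI.prems impI.IH[OF impI.prems] in \<open>auto intro: wff_subst\<close>)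
next
  case (impE ts \<Gamma> \<phi> \<psi>)
  show ?case by (rule prv.impE[where \<phi> = "subst \<sigma> \<phi>"]) (use impE in simp_all)
next
  case (raa ts \<phi> \<Gamma>)
  show ?case by (rule prv.raa) (use raa.hyps raa.prems raa.IH[OF raa.prems] in \<open>auto intro: wff_subst\<close>)
next
  case (allI \<rho> ts \<Gamma> \<phi>)
  have "prv T (\<rho> # us) (map (subst (under_binder \<sigma>)) (map lift \<Gamma>)) (subst (under_binder \<sigma>) \<phi>)"
    by (rule allI.IH) (rule well_typed_under[OF allI.prems])
  then have "prv T (\<rho> # us) (map lift (map (subst \<sigma>) \<Gamma>)) (subst (under_binder \<sigma>) \<phi>)"
    by (simp add: comp_def subst_lift)
  then show ?case by (auto intro: prv.allI)
next
  case (allE ts \<Gamma> \<rho> \<phi> t)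
  have "prv T us (map (subst \<sigma>) \<Gamma>) (All \<rho> (subst (under_binder \<sigma>) \<phi>))"
    using allE.IH[OF allE.prems] by simp
  from prv.allE[OF this tm_ty_subst[OF allE.hyps(2) allE.prems]]
  show ?case by (simp add: subst_inst)
next
  case (eq_refl ts t \<Gamma>)
  then show ?case by (auto intro!: prv.eq_refl intro: tm_ty_subst)
next
  case (eq_subst ts \<phi> \<Gamma> s t)
  have "prv T us (map (subst \<sigma>) \<Gamma>) (Eq (subst_tm \<sigma> s) (subst_tm \<sigma> t))"
    using eq_subst.IH(1)[OF eq_subst.prems] by simp
  from prv.eq_subst[OF wff_subst[OF eq_subst.hyps(1) well_typed_under[OF eq_subst.prems]] this]
  show ?case using eq_subst.IH(2)[OF eq_subst.prems] by (simp add: subst_inst)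
qed

lemma prv_mono: "prv T ts \<Gamma> \<phi> \<Longrightarrow> set \<Gamma> \<subseteq> set \<Delta> \<Longrightarrow> prv T ts \<Delta> \<phi>"
proof (induction arbitrary: \<Delta> rule: prv.induct)
  case (impI ts \<phi> \<Gamma> \<psi>)
  show ?case by (rule prv.impI) (use impI in \<open>auto intro!: impI.IH\<close>)
next
  case (raa ts \<phi> \<Gamma>)
  show ?case by (rule prv.raa) (use raa in \<open>auto intro!: raa.IH\<close>)
next
  case (allI \<rho> ts \<Gamma> \<phi>)
  show ?case by (rule prv.allI) (rule allI.IH, use allI.prems in auto)
next
  case (impE ts \<Gamma> \<phi> \<psi>)
  show ?case by (rule prv.impE[OF impE.IH]) (use impE.prems in auto)
next
  case (allE ts \<Gamma> \<rho> \<phi> t)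
  show ?case by (rule prv.allE[OF allE.IH]) (use allE in auto)
next
  case (eq_subst ts \<phi> \<Gamma> s t)
  show ?case by (rule prv.eq_subst[OF _ eq_subst.IH]) (use eq_subst in auto)
qed (auto intro: prv.axm prv.hyp prv.eq_refl)

lemma prv_append: "prv T ts \<Gamma> \<phi> \<Longrightarrow> prv T (ts @ us) \<Gamma> \<phi>"
  using prv_subst[of T ts \<Gamma> \<phi> "ts @ us" Bv]
  by (simp add: well_typed_def nth_append subst_Bv[abs_def] map_idI)

lemma prv_wff: "prv T ts \<Gamma> \<phi> \<Longrightarrow> wff ts \<phi>"
proof (induction rule: prv.induct)
  case (axm \<phi> ts \<Gamma>)
  then show ?case using wff_append[of "[]" \<phi> ts] by simp
next
  case (allE ts \<Gamma> \<rho> \<phi> t)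
  then show ?case by (auto intro: wff_subst well_typed_inst)
next
  case (eq_subst ts \<phi> \<Gamma> s t)
  then show ?case by (auto intro!: wff_subst[of "N # ts"] well_typed_inst)
qed auto


section \<open>A complete Henkin theory\<close>

text \<open>The variables are split into infinitely many of each type; those beyond a given finite stage
  serve as Henkin witnesses.\<close>

definition var_ty :: "nat \<Rightarrow> ty" where "var_ty n = fst (from_nat n :: ty \<times> nat)"

lemma var_ty_infinite: "\<exists>k\<ge>m. var_ty k = \<rho>"
proof -
  have "inj (\<lambda>i::nat. to_nat (\<rho>, i))" by (auto simp: inj_def)
  then have "\<not> finite (range (\<lambda>i::nat. to_nat (\<rho>, i)))" using finite_imageD infinite_UNIV_nat by blast
  then obtain k where "k \<ge> m" "k \<in> range (\<lambda>i::nat. to_nat (\<rho>, i))"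
    by (metis finite_nat_set_iff_bounded not_less)
  then show ?thesis by (auto simp: var_ty_def)
qed

definition ctx :: "nat \<Rightarrow> ty list" where "ctx n = map var_ty [0..<n]"

lemma length_ctx [simp]: "length (ctx n) = n" by (simp add: ctx_def)

lemma nth_ctx [simp]: "i < n \<Longrightarrow> ctx n ! i = var_ty i" by (simp add: ctx_def)

lemma ctx_mono: "m \<le> n \<Longrightarrow> \<exists>us. ctx n = ctx m @ us"
proof
  assume "m \<le> n"
  then have "[0..<n] = [0..<m] @ [m..<n]"
    by (metis le_add_diff_inverse upt_add_eq_append zero_le)
  then show "ctx n = ctx m @ map var_ty [m..<n]" by (simp add: ctx_def)
qed

text \<open>The language has infinitely many typed variables, but a typing context is a finite list.
  A term, formula or derivation uses an initial segment, so the infinite context is replaced by an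
  existential quantifier over its initial segments.\<close>

definition has_ty :: "tm \<Rightarrow> ty \<Rightarrow> bool" where "has_ty t \<tau> \<longleftrightarrow> (\<exists>n. tm_ty (ctx n) t = Some \<tau>)"
definition wfm :: "fm \<Rightarrow> bool" where "wfm \<phi> \<longleftrightarrow> (\<exists>n. wff (ctx n) \<phi>)"
definition derives :: "fm set \<Rightarrow> fm list \<Rightarrow> fm \<Rightarrow> bool" where
  "derives T \<Gamma> \<phi> \<longleftrightarrow> (\<exists>n. prv T (ctx n) \<Gamma> \<phi>)"

lemma tm_ty_ctx_mono: "tm_ty (ctx m) t = Some \<tau> \<Longrightarrow> m \<le> n \<Longrightarrow> tm_ty (ctx n) t = Some \<tau>"
  by (metis ctx_mono tm_ty_append)

lemma wff_ctx_mono: "wff (ctx m) \<phi> \<Longrightarrow> m \<le> n \<Longrightarrow> wff (ctx n) \<phi>"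
  by (metis ctx_mono wff_append)

lemma prv_ctx_mono: "prv T (ctx m) \<Gamma> \<phi> \<Longrightarrow> m \<le> n \<Longrightarrow> prv T (ctx n) \<Gamma> \<phi>"
  by (metis ctx_mono prv_append)

lemma has_ty_Bv: "has_ty (Bv k) (var_ty k)"
  unfolding has_ty_def by (rule exI[of _ "Suc k"]) simp

lemma has_ty_Cst: "has_ty (Cst c) (const_ty c)"
  by (simp add: has_ty_def)

lemma has_ty_App: "has_ty s (\<rho> \<rightarrow> \<tau>) \<Longrightarrow> has_ty t \<rho> \<Longrightarrow> has_ty (App s t) \<tau>"
proof -
  assume "has_ty s (\<rho> \<rightarrow> \<tau>)" "has_ty t \<rho>"
  then obtain m n where "tm_ty (ctx m) s = Some (\<rho> \<rightarrow> \<tau>)" "tm_ty (ctx n) t = Some \<rho>"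
    by (auto simp: has_ty_def)
  then have "tm_ty (ctx (max m n)) (App s t) = Some \<tau>"
    using tm_ty_ctx_mono[of m s _ "max m n"] tm_ty_ctx_mono[of n t _ "max m n"] by simp
  then show ?thesis by (auto simp: has_ty_def)
qed

lemma has_ty_unique: "has_ty t \<rho> \<Longrightarrow> has_ty t \<tau> \<Longrightarrow> \<rho> = \<tau>"
proof -
  assume "has_ty t \<rho>" "has_ty t \<tau>"
  then obtain m n where "tm_ty (ctx m) t = Some \<rho>" "tm_ty (ctx n) t = Some \<tau>" by (auto simp: has_ty_def)
  then show ?thesis
    using tm_ty_ctx_mono[of m t \<rho> "max m n"] tm_ty_ctx_mono[of n t \<tau> "max m n"] by simp
qed

lemma has_ty_bound:
  assumes "\<forall>i<n. has_ty (\<sigma> i) (ts ! i)"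
  shows "\<exists>m. \<forall>i<n. tm_ty (ctx m) (\<sigma> i) = Some (ts ! i)"
  using assms
proof (induction n)
  case (Suc n)
  then obtain m where m: "\<forall>i<n. tm_ty (ctx m) (\<sigma> i) = Some (ts ! i)" by auto
  obtain k where k: "tm_ty (ctx k) (\<sigma> n) = Some (ts ! n)"
    using Suc.prems by (auto simp: has_ty_def)
  have "\<forall>i<Suc n. tm_ty (ctx (max m k)) (\<sigma> i) = Some (ts ! i)"
    using m k by (auto simp: less_Suc_eq intro: tm_ty_ctx_mono)
  then show ?case by blast
qed simp

lemma has_ty_subst:
  assumes "tm_ty ts t = Some \<tau>" "\<forall>i<length ts. has_ty (\<sigma> i) (ts ! i)"
  shows "has_ty (subst_tm \<sigma> t) \<tau>"
  using has_ty_bound[OF assms(2)] tm_ty_subst[OF assms(1)]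
  by (auto simp: has_ty_def well_typed_def)

lemma wfm_subst:
  assumes "wff ts \<phi>" "\<forall>i<length ts. has_ty (\<sigma> i) (ts ! i)"
  shows "wfm (subst \<sigma> \<phi>)"
  using has_ty_bound[OF assms(2)] wff_subst[OF assms(1)]
  by (auto simp: wfm_def well_typed_def)

text \<open>Closed terms, namely iterated constant functions over zero. They are substituted for
  variables that have to vanish from a derivation.\<close>

primrec inhabitant :: "ty \<Rightarrow> tm" where
  "inhabitant N = Cst Zero"
| "inhabitant (\<rho> \<rightarrow> \<tau>) = App (Cst (PiC \<tau> \<rho>)) (inhabitant \<tau>)"

lemma tm_ty_inhabitant: "tm_ty ts (inhabitant \<rho>) = Some \<rho>"
  by (induction \<rho>) auto

lemma wfm_Imp: "wfm (Imp \<phi> \<psi>) \<longleftrightarrow> wfm \<phi> \<and> wfm \<psi>"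
proof
  assume "wfm \<phi> \<and> wfm \<psi>"
  then obtain m n where "wff (ctx m) \<phi>" "wff (ctx n) \<psi>" by (auto simp: wfm_def)
  then have "wff (ctx (max m n)) (Imp \<phi> \<psi>)"
    using wff_ctx_mono[of m \<phi> "max m n"] wff_ctx_mono[of n \<psi> "max m n"] by simp
  then show "wfm (Imp \<phi> \<psi>)" by (auto simp: wfm_def)
qed (auto simp: wfm_def)

lemma wfm_Fls: "wfm Fls" by (simp add: wfm_def)

lemma wfm_inst: "wfm (All \<rho> \<phi>) \<Longrightarrow> has_ty t \<rho> \<Longrightarrow> wfm (inst t \<phi>)"
proof -
  assume "wfm (All \<rho> \<phi>)" "has_ty t \<rho>"
  then obtain m n where "wff (ctx m) (All \<rho> \<phi>)" "tm_ty (ctx n) t = Some \<rho>"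
    by (auto simp: wfm_def has_ty_def)
  then have "wff (ctx (max m n)) (All \<rho> \<phi>)" "tm_ty (ctx (max m n)) t = Some \<rho>"
    by (meson max.cobounded1 max.cobounded2 wff_ctx_mono tm_ty_ctx_mono)+
  then show ?thesis unfolding wfm_def by (auto intro: wff_subst well_typed_inst)
qed

lemma derives_mono: "derives T \<Gamma> \<phi> \<Longrightarrow> set \<Gamma> \<subseteq> set \<Delta> \<Longrightarrow> derives T \<Delta> \<phi>"
  unfolding derives_def by (auto intro: prv_mono)

lemma derives_wfm: "derives T \<Gamma> \<phi> \<Longrightarrow> wfm \<phi>"
  unfolding derives_def wfm_def by (auto dest: prv_wff)

lemma derives_impE: "derives T \<Gamma> (Imp \<phi> \<psi>) \<Longrightarrow> derives T \<Gamma> \<phi> \<Longrightarrow> derives T \<Gamma> \<psi>"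
proof -
  assume "derives T \<Gamma> (Imp \<phi> \<psi>)" "derives T \<Gamma> \<phi>"
  then obtain m n where *: "prv T (ctx m) \<Gamma> (Imp \<phi> \<psi>)" "prv T (ctx n) \<Gamma> \<phi>"
    by (auto simp: derives_def)
  show ?thesis unfolding derives_def
    using prv.impE[OF prv_ctx_mono[OF *(1) max.cobounded1[of m n]] prv_ctx_mono[OF *(2) max.cobounded2[of n m]]]
    by blast
qed

lemma derives_impI: "wfm \<phi> \<Longrightarrow> derives T (\<phi> # \<Gamma>) \<psi> \<Longrightarrow> derives T \<Gamma> (Imp \<phi> \<psi>)"
proof -
  assume "wfm \<phi>" "derives T (\<phi> # \<Gamma>) \<psi>"
  then obtain m n where *: "wff (ctx m) \<phi>" "prv T (ctx n) (\<phi> # \<Gamma>) \<psi>"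
    by (auto simp: derives_def wfm_def)
  show ?thesis unfolding derives_def
    using prv.impI[OF wff_ctx_mono[OF *(1) max.cobounded1[of m n]] prv_ctx_mono[OF *(2) max.cobounded2[of n m]]]
    by blast
qed

lemma derives_raa: "wfm \<phi> \<Longrightarrow> derives T (Imp \<phi> Fls # \<Gamma>) Fls \<Longrightarrow> derives T \<Gamma> \<phi>"
proof -
  assume "wfm \<phi>" "derives T (Imp \<phi> Fls # \<Gamma>) Fls"
  then obtain m n where *: "wff (ctx m) \<phi>" "prv T (ctx n) (Imp \<phi> Fls # \<Gamma>) Fls"
    by (auto simp: derives_def wfm_def)
  show ?thesis unfolding derives_def
    using prv.raa[OF wff_ctx_mono[OF *(1) max.cobounded1[of m n]] prv_ctx_mono[OF *(2) max.cobounded2[of n m]]]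
    by blast
qed

lemma derives_hyp: "\<phi> \<in> set \<Gamma> \<Longrightarrow> wfm \<phi> \<Longrightarrow> derives T \<Gamma> \<phi>"
  unfolding derives_def wfm_def by (auto intro: prv.hyp)

lemma derives_allE: "derives T \<Gamma> (All \<rho> \<phi>) \<Longrightarrow> has_ty t \<rho> \<Longrightarrow> derives T \<Gamma> (inst t \<phi>)"
proof -
  assume "derives T \<Gamma> (All \<rho> \<phi>)" "has_ty t \<rho>"
  then obtain m n where *: "prv T (ctx m) \<Gamma> (All \<rho> \<phi>)" "tm_ty (ctx n) t = Some \<rho>"
    by (auto simp: derives_def has_ty_def)
  show ?thesis unfolding derives_def
    using prv.allE[OF prv_ctx_mono[OF *(1) max.cobounded1[of m n]] tm_ty_ctx_mono[OF *(2) max.cobounded2[of n m]]]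
    by blast
qed

lemma derives_cut: "derives T (\<phi> # \<Gamma>) \<psi> \<Longrightarrow> derives T \<Gamma> \<phi> \<Longrightarrow> derives T \<Gamma> \<psi>"
  by (meson derives_impE derives_impI derives_wfm)

text \<open>\<open>m \<le> k\<close> expresses that the eigenvariable is fresh: hypotheses and
  conclusion use the first \<open>m\<close> variables only. The given derivation may use further
  variables, which have to be disposed of.\<close>

lemma derives_allI:
  assumes k: "k \<ge> m" "var_ty k = \<rho>"
    and m: "\<forall>\<gamma>\<in>set \<Gamma>. wff (ctx m) \<gamma>" "wff (ctx m) (All \<rho> \<chi>)"
    and d: "derives T \<Gamma> (inst (Bv k) \<chi>)"
  shows "derives T \<Gamma> (All \<rho> \<chi>)"
proof -
  obtain n where "prv T (ctx n) \<Gamma> (inst (Bv k) \<chi>)" using d by (auto simp: derives_def)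
  \<comment> \<open>The rule \<open>allI\<close> expects the generalised variable at index 0. So
    \<open>k\<close> becomes 0, the first \<open>m\<close> variables move up by one, and any other
    variable is replaced by a closed term.\<close>
  define \<sigma> where "\<sigma> i = (if i < m then Bv (Suc i) else if i = k then Bv 0 else inhabitant (var_ty i))" for i
  have "well_typed (\<rho> # ctx m) \<sigma> (ctx n)"
    using k by (auto simp: well_typed_def \<sigma>_def tm_ty_inhabitant)
  with \<open>prv T (ctx n) \<Gamma> _\<close>
  have p: "prv T (\<rho> # ctx m) (map (subst \<sigma>) \<Gamma>) (subst \<sigma> (inst (Bv k) \<chi>))"
    by (rule prv_subst)
  have "map (subst \<sigma>) \<Gamma> = map lift \<Gamma>"
    using m(1) by (auto intro!: subst_cong[where ts = "ctx m"] simp: \<sigma>_def)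
  moreover have "subst \<sigma> (inst (Bv k) \<chi>) = \<chi>"
  proof -
    have "subst \<sigma> (inst (Bv k) \<chi>) = subst Bv \<chi>"
      unfolding subst_subst
      using m(2) k by (intro subst_cong[where ts = "\<rho> # ctx m"]) (auto simp: \<sigma>_def split: nat.splits)
    then show ?thesis by (simp add: subst_Bv)
  qed
  ultimately have "prv T (\<rho> # ctx m) (map lift \<Gamma>) \<chi>" using p by metis
  then have "prv T (ctx m) \<Gamma> (All \<rho> \<chi>)" by (rule prv.allI)
  then show ?thesis unfolding derives_def by blast
qed

section \<open>Lindenbaum extension with Henkin witnesses\<close>

definition consistent :: "fm set \<Rightarrow> fm list \<Rightarrow> bool" where
  "consistent T \<Gamma> \<longleftrightarrow> \<not> derives T \<Gamma> Fls"

definition wfs :: "fm list \<Rightarrow> bool" where "wfs \<Gamma> \<longleftrightarrow> (\<forall>\<gamma>\<in>set \<Gamma>. wfm \<gamma>)"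

lemma wfs_bound: "wfs \<Gamma> \<Longrightarrow> \<exists>m. \<forall>\<gamma>\<in>set \<Gamma>. wff (ctx m) \<gamma>"
proof (induction \<Gamma>)
  case (Cons \<gamma> \<Gamma>)
  then obtain m n where "\<forall>\<gamma>\<in>set \<Gamma>. wff (ctx m) \<gamma>" "wff (ctx n) \<gamma>" by (auto simp: wfs_def wfm_def)
  then have "\<forall>\<gamma>\<in>set (\<gamma> # \<Gamma>). wff (ctx (max m n)) \<gamma>" by (auto intro: wff_ctx_mono)
  then show ?case by blast
qed simp

text \<open>If the negated instance at a fresh variable were inconsistent with the rest, the
  instance would be derivable, hence by \<open>derives_allI\<close> the universal formula, against
  \<open>\<phi>\<close>. For formulas of another form \<open>w\<close> is empty.\<close>

lemma witness_exists:
  assumes "consistent T (\<phi> # \<Gamma>)" "wfs (\<phi> # \<Gamma>)"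
  shows "\<exists>w. consistent T (w @ \<phi> # \<Gamma>) \<and> wfs w \<and>
    (\<forall>\<rho> \<chi>. \<phi> = Imp (All \<rho> \<chi>) Fls \<longrightarrow> (\<exists>k. var_ty k = \<rho> \<and> Imp (inst (Bv k) \<chi>) Fls \<in> set w))"
proof (cases "\<exists>\<rho> \<chi>. \<phi> = Imp (All \<rho> \<chi>) Fls")
  case True
  then obtain \<rho> \<chi> where \<phi>: "\<phi> = Imp (All \<rho> \<chi>) Fls" by blast
  obtain m where m: "\<forall>\<gamma>\<in>set (\<phi> # \<Gamma>). wff (ctx m) \<gamma>" using wfs_bound[OF assms(2)] by blast
  obtain k where k: "k \<ge> m" "var_ty k = \<rho>" using var_ty_infinite by blast
  have wfm: "wfm (inst (Bv k) \<chi>)"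
    using wfm_inst[of \<rho> \<chi> "Bv k"] has_ty_Bv[of k] k m \<phi> by (auto simp: wfm_def)
  have "consistent T (Imp (inst (Bv k) \<chi>) Fls # \<phi> # \<Gamma>)"
    unfolding consistent_def
  proof
    assume "derives T (Imp (inst (Bv k) \<chi>) Fls # \<phi> # \<Gamma>) Fls"
    then have "derives T (\<phi> # \<Gamma>) (inst (Bv k) \<chi>)" using wfm by (rule derives_raa[rotated])
    then have "derives T (\<phi> # \<Gamma>) (All \<rho> \<chi>)" using k m \<phi> by (intro derives_allI[of m k]) auto
    moreover have "derives T (\<phi> # \<Gamma>) (Imp (All \<rho> \<chi>) Fls)"
      using assms(2) by (intro derives_hyp) (auto simp: \<phi> wfs_def)
    ultimately show False using assms(1) unfolding consistent_def by (metis derives_impE)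
  qed
  then show ?thesis using k wfm \<phi>
    by (intro exI[of _ "[Imp (inst (Bv k) \<chi>) Fls]"]) (auto simp: wfs_def wfm_Imp wfm_Fls)
next
  case False
  then show ?thesis using assms by (intro exI[of _ "[]"]) (auto simp: wfs_def)
qed

text \<open>Formula number \<open>n\<close> is decided in step \<open>n\<close>, and the witness of
  a negated universal formula is added in the same step, so that no second round over the new
  formulas is required.\<close>

primrec stage :: "fm set \<Rightarrow> fm \<Rightarrow> nat \<Rightarrow> fm list" where
  "stage T \<psi> 0 = [\<psi>]"
| "stage T \<psi> (Suc n) =
    (let \<phi> = from_nat n; \<Gamma> = stage T \<psi> n in
     if wfm \<phi> \<and> consistent T (\<phi> # \<Gamma>)
     then (SOME w. consistent T (w @ \<phi> # \<Gamma>) \<and> wfs w \<and>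
       (\<forall>\<rho> \<chi>. \<phi> = Imp (All \<rho> \<chi>) Fls \<longrightarrow> (\<exists>k. var_ty k = \<rho> \<and> Imp (inst (Bv k) \<chi>) Fls \<in> set w))) @ \<phi> # \<Gamma>
     else \<Gamma>)"

definition henkin_theory :: "fm set \<Rightarrow> fm \<Rightarrow> fm set" where
  "henkin_theory T \<psi> = {\<phi>. \<exists>n. derives T (stage T \<psi> n) \<phi>}"

locale henkin =
  fixes T :: "fm set" and \<psi> :: fm
  assumes wfm_start: "wfm \<psi>" and consistent_start: "consistent T [\<psi>]"
begin

abbreviation "G \<equiv> stage T \<psi>"
abbreviation "Th \<equiv> henkin_theory T \<psi>"

lemma wfs_stage: "consistent T (G n) \<and> wfs (G n)"
proof (induction n)
  case 0
  then show ?case using wfm_start consistent_start by (simp add: wfs_def)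
next
  case (Suc n)
  let ?\<phi> = "from_nat n"
  show ?case
  proof (cases "wfm ?\<phi> \<and> consistent T (?\<phi> # G n)")
    case True
    then have "wfs (?\<phi> # G n)" using Suc by (auto simp: wfs_def)
    from someI_ex[OF witness_exists[OF conjunct2[OF True] this]] True Suc
    show ?thesis by (auto simp: Let_def wfs_def)
  next
    case False
    then have "G (Suc n) = G n" unfolding stage.simps Let_def by (rule if_not_P)
    then show ?thesis using Suc by simp
  qed
qed

lemma stage_step:
  assumes "wfm \<phi>" "consistent T (\<phi> # G (to_nat \<phi>))"
  shows "\<phi> \<in> set (G (Suc (to_nat \<phi>)))"
    and "\<phi> = Imp (All \<rho> \<chi>) Fls \<Longrightarrow>
      \<exists>k. var_ty k = \<rho> \<and> Imp (inst (Bv k) \<chi>) Fls \<in> set (G (Suc (to_nat \<phi>)))"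
proof -
  let ?n = "to_nat \<phi>"
  have "wfs (\<phi> # G ?n)" using assms(1) wfs_stage by (auto simp: wfs_def)
  note * = someI_ex[OF witness_exists[OF assms(2) this]]
  show "\<phi> \<in> set (G (Suc (to_nat \<phi>)))" using assms by (simp add: Let_def)
  show "\<phi> = Imp (All \<rho> \<chi>) Fls \<Longrightarrow>
      \<exists>k. var_ty k = \<rho> \<and> Imp (inst (Bv k) \<chi>) Fls \<in> set (G (Suc (to_nat \<phi>)))"
  proof -
    assume eq: "\<phi> = Imp (All \<rho> \<chi>) Fls"
    have G: "G (Suc ?n) = (SOME w. consistent T (w @ \<phi> # G ?n) \<and> wfs w \<and>
       (\<forall>\<rho> \<chi>. \<phi> = Imp (All \<rho> \<chi>) Fls \<longrightarrow> (\<exists>k. var_ty k = \<rho> \<and> Imp (inst (Bv k) \<chi>) Fls \<in> set w)))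
       @ \<phi> # G ?n"
      unfolding stage.simps Let_def from_nat_to_nat by (rule if_P) (use assms in blast)
    from * eq obtain k where "var_ty k = \<rho>" "Imp (inst (Bv k) \<chi>) Fls \<in> set (G (Suc ?n))"
      unfolding G set_append by blast
    then show ?thesis by blast
  qed
qed

lemma stage_mono: "m \<le> n \<Longrightarrow> set (G m) \<subseteq> set (G n)"
  by (rule lift_Suc_mono_le[of "\<lambda>n. set (G n)"]) (auto simp: Let_def)

lemma derives_stage_mono: "derives T (G m) \<phi> \<Longrightarrow> m \<le> n \<Longrightarrow> derives T (G n) \<phi>"
  by (meson derives_mono stage_mono)

lemma Th_wfm: "\<phi> \<in> Th \<Longrightarrow> wfm \<phi>"
  by (auto simp: henkin_theory_def dest: derives_wfm)

lemma Th_start: "\<psi> \<in> Th"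
  unfolding henkin_theory_def using derives_hyp[of \<psi> "G 0" T] wfm_start by (auto intro: exI[of _ 0])

lemma Th_Fls: "Fls \<notin> Th"
  using wfs_stage by (auto simp: henkin_theory_def consistent_def)

lemma Th_mp: "Imp \<phi> \<chi> \<in> Th \<Longrightarrow> \<phi> \<in> Th \<Longrightarrow> \<chi> \<in> Th"
proof -
  assume "Imp \<phi> \<chi> \<in> Th" "\<phi> \<in> Th"
  then obtain m n where "derives T (G m) (Imp \<phi> \<chi>)" "derives T (G n) \<phi>"
    by (auto simp: henkin_theory_def)
  then have "derives T (G (max m n)) \<chi>"
    by (meson derives_impE derives_stage_mono max.cobounded1 max.cobounded2)
  then show ?thesis by (auto simp: henkin_theory_def)
qed

lemma Th_stage: "\<phi> \<in> set (G n) \<Longrightarrow> \<phi> \<in> Th"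
  unfolding henkin_theory_def using wfs_stage[of n] derives_hyp[of \<phi> "G n" T] by (auto simp: wfs_def)

lemma Th_complete: "wfm \<phi> \<Longrightarrow> \<phi> \<in> Th \<or> Imp \<phi> Fls \<in> Th"
proof (cases "consistent T (\<phi> # G (to_nat \<phi>))")
  case True
  then show "wfm \<phi> \<Longrightarrow> ?thesis" using stage_step(1) Th_stage by blast
next
  case False
  then show "wfm \<phi> \<Longrightarrow> ?thesis"
    using derives_impI[of \<phi> T "G (to_nat \<phi>)" Fls] by (auto simp: consistent_def henkin_theory_def)
qed

text \<open>Ensures that a member of \<open>Th\<close> was accepted at its own stage; a negated
  universal formula in \<open>Th\<close> therefore received its witness there.\<close>

lemma Th_consistent: "\<phi> \<in> Th \<Longrightarrow> consistent T (\<phi> # G n)"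
  unfolding consistent_def
proof
  assume "\<phi> \<in> Th" and d: "derives T (\<phi> # G n) Fls"
  then obtain m where "derives T (G m) \<phi>" by (auto simp: henkin_theory_def)
  then have "derives T (G (max m n)) \<phi>" using derives_stage_mono by auto
  moreover have "derives T (\<phi> # G (max m n)) Fls"
    by (rule derives_mono[OF d]) (use stage_mono[of n "max m n"] in auto)
  ultimately have "derives T (G (max m n)) Fls" by (rule derives_cut[rotated])
  then show False using wfs_stage by (auto simp: consistent_def)
qed

lemma Th_Imp: "wfm \<phi> \<Longrightarrow> wfm \<chi> \<Longrightarrow> Imp \<phi> \<chi> \<in> Th \<longleftrightarrow> (\<phi> \<in> Th \<longrightarrow> \<chi> \<in> Th)"
proof
  assume wfm: "wfm \<phi>" "wfm \<chi>"
  show "Imp \<phi> \<chi> \<in> Th \<Longrightarrow> \<phi> \<in> Th \<longrightarrow> \<chi> \<in> Th" using Th_mp by blast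
  assume "\<phi> \<in> Th \<longrightarrow> \<chi> \<in> Th"
  then consider "Imp \<phi> Fls \<in> Th" | "\<chi> \<in> Th" using Th_complete[OF wfm(1)] by blast
  then show "Imp \<phi> \<chi> \<in> Th"
  proof cases
    case 1
    then obtain n where n: "derives T (G n) (Imp \<phi> Fls)" by (auto simp: henkin_theory_def)
    have "derives T (Imp \<chi> Fls # \<phi> # G n) Fls"
      using derives_mono[OF n, of "Imp \<chi> Fls # \<phi> # G n"] derives_hyp[of \<phi> "Imp \<chi> Fls # \<phi> # G n" T] wfm(1)
      by (auto intro: derives_impE)
    then have "derives T (G n) (Imp \<phi> \<chi>)" by (rule derives_impI[OF wfm(1) derives_raa[OF wfm(2)]])
    then show ?thesis by (auto simp: henkin_theory_def)
  next
    case 2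
    then obtain n where n: "derives T (G n) \<chi>" by (auto simp: henkin_theory_def)
    have "derives T (\<phi> # G n) \<chi>" by (rule derives_mono[OF n]) auto
    then have "derives T (G n) (Imp \<phi> \<chi>)" by (rule derives_impI[OF wfm(1)])
    then show ?thesis by (auto simp: henkin_theory_def)
  qed
qed

text \<open>From right to left: otherwise completeness puts the negation into \<open>Th\<close>, and
  the instance at its witness variable is refuted there.\<close>

lemma Th_All: "wfm (All \<rho> \<chi>) \<Longrightarrow> All \<rho> \<chi> \<in> Th \<longleftrightarrow> (\<forall>t. has_ty t \<rho> \<longrightarrow> inst t \<chi> \<in> Th)"
proof
  assume wfm: "wfm (All \<rho> \<chi>)"
  show "All \<rho> \<chi> \<in> Th \<Longrightarrow> \<forall>t. has_ty t \<rho> \<longrightarrow> inst t \<chi> \<in> Th"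
    by (auto simp: henkin_theory_def intro: derives_allE)
  assume all: "\<forall>t. has_ty t \<rho> \<longrightarrow> inst t \<chi> \<in> Th"
  show "All \<rho> \<chi> \<in> Th"
  proof (rule ccontr)
    assume "All \<rho> \<chi> \<notin> Th"
    then have "Imp (All \<rho> \<chi>) Fls \<in> Th" using Th_complete[OF wfm] by blast
    from stage_step(2)[OF Th_wfm[OF this] Th_consistent[OF this] refl]
    obtain k where "var_ty k = \<rho>" "Imp (inst (Bv k) \<chi>) Fls \<in> Th" using Th_stage by blast
    then show False using all has_ty_Bv[of k] Th_mp Th_Fls by blast
  qed
qed

lemma Th_axm: "\<phi> \<in> T \<Longrightarrow> wff [] \<phi> \<Longrightarrow> \<phi> \<in> Th"
  unfolding henkin_theory_def derives_def by (auto intro: prv.axm)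

lemma Th_eq_refl: "has_ty t N \<Longrightarrow> Eq t t \<in> Th"
  unfolding henkin_theory_def derives_def has_ty_def by (auto intro: prv.eq_refl)

lemma Th_eq_subst:
  assumes "wff (N # ctx m) \<phi>" "Eq s t \<in> Th" "inst s \<phi> \<in> Th"
  shows "inst t \<phi> \<in> Th"
proof -
  obtain i j where ij: "derives T (G i) (Eq s t)" "derives T (G j) (inst s \<phi>)"
    using assms by (auto simp: henkin_theory_def)
  let ?k = "max i j"
  have "derives T (G ?k) (Eq s t)" "derives T (G ?k) (inst s \<phi>)"
    using ij derives_stage_mono by auto
  then obtain a b where ab: "prv T (ctx a) (G ?k) (Eq s t)" "prv T (ctx b) (G ?k) (inst s \<phi>)"
    by (auto simp: derives_def)
  have "prv T (ctx (max m (max a b))) (G ?k) (Eq s t)" "prv T (ctx (max m (max a b))) (G ?k) (inst s \<phi>)"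
    by (rule prv_ctx_mono[OF ab(1)], simp) (rule prv_ctx_mono[OF ab(2)], simp)
  moreover have "wff (N # ctx (max m (max a b))) \<phi>"
    using assms(1) ctx_mono[of m "max m (max a b)"] wff_append[of "N # ctx m" \<phi>] by auto
  ultimately have "prv T (ctx (max m (max a b))) (G ?k) (inst t \<phi>)"
    by (meson prv.eq_subst)
  then show ?thesis unfolding henkin_theory_def derives_def by blast
qed

end


section \<open>Structures\<close>

text \<open>One carrier serves all types, which keeps application a single HOL function;
  \<open>dom\<close> cuts out the objects of each type.\<close>

record 'u struct =
  dom :: "ty \<Rightarrow> 'u set"
  app :: "'u \<Rightarrow> 'u \<Rightarrow> 'u"
  cst :: "const \<Rightarrow> 'u"
  lss :: "'u \<Rightarrow> 'u \<Rightarrow> bool"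

primrec evl :: "'u struct \<Rightarrow> (nat \<Rightarrow> 'u) \<Rightarrow> tm \<Rightarrow> 'u" where
  "evl M e (Bv n) = e n"
| "evl M e (Cst c) = cst M c"
| "evl M e (App s t) = app M (evl M e s) (evl M e t)"

primrec sat :: "'u struct \<Rightarrow> (nat \<Rightarrow> 'u) \<Rightarrow> fm \<Rightarrow> bool" where
  "sat M e Fls \<longleftrightarrow> False"
| "sat M e (Eq s t) \<longleftrightarrow> evl M e s = evl M e t"
| "sat M e (Less s t) \<longleftrightarrow> lss M (evl M e s) (evl M e t)"
| "sat M e (Imp \<phi> \<psi>) \<longleftrightarrow> (sat M e \<phi> \<longrightarrow> sat M e \<psi>)"
| "sat M e (All \<rho> \<phi>) \<longleftrightarrow> (\<forall>a\<in>dom M \<rho>. sat M (case_nat a e) \<phi>)"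

definition truth :: "'u struct \<Rightarrow> fm \<Rightarrow> bool" where
  "truth M \<phi> \<longleftrightarrow> sat M (\<lambda>_. cst M Zero) \<phi>"

locale ext_structure =
  fixes M :: "'u struct"
  assumes cst_dom: "cst M c \<in> dom M (const_ty c)"
    and app_dom: "f \<in> dom M (\<rho> \<rightarrow> \<tau>) \<Longrightarrow> x \<in> dom M \<rho> \<Longrightarrow> app M f x \<in> dom M \<tau>"
    and ext: "f \<in> dom M (\<rho> \<rightarrow> \<tau>) \<Longrightarrow> g \<in> dom M (\<rho> \<rightarrow> \<tau>) \<Longrightarrow>
      (\<And>x. x \<in> dom M \<rho> \<Longrightarrow> app M f x = app M g x) \<Longrightarrow> f = g"


section \<open>Completeness\<close>

abbreviation shift :: "tm \<Rightarrow> tm" where "shift \<equiv> subst_tm (\<lambda>n. Bv (Suc n))"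

text \<open>De Bruijn form of \<open>eq_at\<close>. Substitution and typing can be computed on it,
  whereas \<open>eq_at\<close> acts on functions of the depth; \<open>eq_at_eqf\<close> connects the
  two.\<close>

fun eqf :: "ty \<Rightarrow> tm \<Rightarrow> tm \<Rightarrow> fm" where
  "eqf N s t = Eq s t"
| "eqf (\<rho> \<rightarrow> \<tau>) s t = All \<rho> (eqf \<tau> (App (shift s) (Bv 0)) (App (shift t) (Bv 0)))"

text \<open>Says that an \<open>hterm\<close> is, from depth \<open>d\<close> on, one and the same
  term with its indices adjusted to the number of binders passed.\<close>

definition coherent :: "nat \<Rightarrow> hterm \<Rightarrow> bool" where
  "coherent d x \<longleftrightarrow> (\<forall>d'\<ge>d. x (Suc d') = shift (x d'))"

lemma coherent_Suc: "coherent d x \<Longrightarrow> coherent (Suc d) x"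
  by (simp add: coherent_def)

lemma coherent_happ: "coherent d x \<Longrightarrow> coherent d y \<Longrightarrow> coherent d (x \<cdot> y)"
  by (simp add: coherent_def happ_def)

lemma coherent_hcst: "coherent d (hcst c)"
  by (simp add: coherent_def hcst_def)

lemma coherent_var: "coherent (Suc d) (\<lambda>d'. Bv (d' - Suc d))"
  by (auto simp: coherent_def)

lemma eq_at_eqf: "coherent d x \<Longrightarrow> coherent d y \<Longrightarrow> eq_at \<rho> x y d = eqf \<rho> (x d) (y d)"
proof (induction \<rho> arbitrary: x y d)
  case (Arr \<rho> \<tau>)
  let ?z = "\<lambda>d'. Bv (d' - Suc d)"
  have "eq_at \<tau> (x \<cdot> ?z) (y \<cdot> ?z) (Suc d) = eqf \<tau> ((x \<cdot> ?z) (Suc d)) ((y \<cdot> ?z) (Suc d))"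
    using Arr.prems by (intro Arr.IH coherent_happ coherent_Suc coherent_var)
  then show ?case using Arr.prems by (simp add: hall_def happ_def coherent_def)
qed (simp add: heq_def)

lemma shift_under: "subst_tm (under_binder \<sigma>) (shift t) = shift (subst_tm \<sigma> t)"
  by (simp add: subst_tm_subst_tm under_binder_def)

lemma shift_inst: "subst_tm (case_nat r \<sigma>) (shift t) = subst_tm \<sigma> t"
  by (simp add: subst_tm_subst_tm)

lemma subst_eqf: "subst \<sigma> (eqf \<rho> s t) = eqf \<rho> (subst_tm \<sigma> s) (subst_tm \<sigma> t)"
  by (induction \<rho> arbitrary: \<sigma> s t) (simp_all add: shift_under, simp add: under_binder_def)

lemma wff_eqf: "tm_ty ts s = Some \<rho> \<Longrightarrow> tm_ty ts t = Some \<rho> \<Longrightarrow> wff ts (eqf \<rho> s t)"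
proof (induction \<rho> arbitrary: ts s t)
  case (Arr \<rho> \<tau>)
  have "tm_ty (\<rho> # ts) (shift s) = Some (\<rho> \<rightarrow> \<tau>)" "tm_ty (\<rho> # ts) (shift t) = Some (\<rho> \<rightarrow> \<tau>)"
    using Arr.prems by (auto intro: tm_ty_subst well_typed_shift)
  then show ?case by (auto intro: Arr.IH)
qed simp

lemma extensionality_axiom_eqf:
  "extensionality_axiom \<rho> \<tau> 0 = All \<rho> (All \<rho> (All (\<rho> \<rightarrow> \<tau>)
    (Imp (eqf \<rho> (Bv 2) (Bv 1)) (eqf \<tau> (App (Bv 0) (Bv 2)) (App (Bv 0) (Bv 1))))))"
proof -
  let ?x = "\<lambda>d. Bv (d - Suc 0)" and ?y = "\<lambda>d. Bv (d - Suc (Suc 0))" and ?f = "\<lambda>d. Bv (d - Suc (Suc (Suc 0)))"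
  have coh: "coherent 3 ?x" "coherent 3 ?y" "coherent 3 ?f" by (auto simp: coherent_def)
  have "eq_at \<rho> ?x ?y 3 = eqf \<rho> (Bv 2) (Bv 1)"
    by (subst eq_at_eqf) (use coh in \<open>auto simp: numeral_eq_Suc\<close>)
  moreover have "eq_at \<tau> (?f \<cdot> ?x) (?f \<cdot> ?y) 3 = eqf \<tau> (App (Bv 0) (Bv 2)) (App (Bv 0) (Bv 1))"
    by (subst eq_at_eqf, (rule coherent_happ coh)+) (simp add: happ_def numeral_eq_Suc)
  ultimately show ?thesis
    unfolding extensionality_axiom_def hall_def himp_def by (simp add: numeral_eq_Suc)
qed

section \<open>Equality according to the Henkin theory is a congruence in all types\<close>

locale ext_henkin = henkin +
  assumes extT: "extensionality_axiom \<rho> \<tau> 0 \<in> T"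
begin

text \<open>The formal quantifiers of \<open>eqf\<close> are replaced by quantification over terms
  of the language. With Henkin witnesses both have the same force, see
  \<open>eqf_Th\<close>.\<close>

fun teq :: "ty \<Rightarrow> tm \<Rightarrow> tm \<Rightarrow> bool" where
  "teq N s t \<longleftrightarrow> Eq s t \<in> Th"
| "teq (\<rho> \<rightarrow> \<tau>) s t \<longleftrightarrow> (\<forall>r. has_ty r \<rho> \<longrightarrow> teq \<tau> (App s r) (App t r))"

lemma wfm_eqf: "has_ty s \<rho> \<Longrightarrow> has_ty t \<rho> \<Longrightarrow> wfm (eqf \<rho> s t)"
proof -
  assume "has_ty s \<rho>" "has_ty t \<rho>"
  then obtain m n where mn: "tm_ty (ctx m) s = Some \<rho>" "tm_ty (ctx n) t = Some \<rho>"
    by (auto simp: has_ty_def)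
  show ?thesis unfolding wfm_def
    using wff_eqf[OF tm_ty_ctx_mono[OF mn(1) max.cobounded1] tm_ty_ctx_mono[OF mn(2) max.cobounded2]]
    by blast
qed

lemma eqf_Th: "has_ty s \<rho> \<Longrightarrow> has_ty t \<rho> \<Longrightarrow> eqf \<rho> s t \<in> Th \<longleftrightarrow> teq \<rho> s t"
proof (induction \<rho> arbitrary: s t)
  case (Arr \<rho> \<tau>)
  have "eqf (\<rho> \<rightarrow> \<tau>) s t \<in> Th \<longleftrightarrow> (\<forall>r. has_ty r \<rho> \<longrightarrow> eqf \<tau> (App s r) (App t r) \<in> Th)"
    using Th_All[of \<rho> "eqf \<tau> (App (shift s) (Bv 0)) (App (shift t) (Bv 0))"] wfm_eqf[OF Arr.prems]
    by (simp add: subst_eqf shift_inst subst_tm_Bv)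
  also have "\<dots> \<longleftrightarrow> (\<forall>r. has_ty r \<rho> \<longrightarrow> teq \<tau> (App s r) (App t r))"
    using Arr.IH(2) has_ty_App Arr.prems by blast
  finally show ?case by simp
qed simp

lemma Th_Eq_sym: "Eq s t \<in> Th \<Longrightarrow> Eq t s \<in> Th"
proof -
  assume e: "Eq s t \<in> Th"
  then obtain m where m: "tm_ty (ctx m) s = Some N" by (auto simp: wfm_def dest!: Th_wfm)
  have "wff (N # ctx m) (Eq (Bv 0) (shift s))"
    using tm_ty_subst[OF m well_typed_shift] by simp
  moreover have "Eq s s \<in> Th" using m Th_eq_refl[of s] by (auto simp: has_ty_def)
  ultimately show ?thesis
    using Th_eq_subst[of m "Eq (Bv 0) (shift s)", OF _ e] by (simp add: shift_inst subst_tm_Bv)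
qed

lemma Th_Eq_trans: "Eq s t \<in> Th \<Longrightarrow> Eq t u \<in> Th \<Longrightarrow> Eq s u \<in> Th"
proof -
  assume e: "Eq s t \<in> Th" "Eq t u \<in> Th"
  then obtain m where m: "tm_ty (ctx m) s = Some N" by (auto simp: wfm_def dest!: Th_wfm)
  have "wff (N # ctx m) (Eq (shift s) (Bv 0))"
    using tm_ty_subst[OF m well_typed_shift] by simp
  from Th_eq_subst[OF this e(2)] show ?thesis
    using e by (auto simp: shift_inst subst_tm_Bv)
qed

lemma Th_Less_cong:
  assumes e: "Eq s s' \<in> Th" "Eq t t' \<in> Th" and l: "Less s t \<in> Th"
  shows "Less s' t' \<in> Th"
proof -
  obtain m where m: "tm_ty (ctx m) t = Some N" using Th_wfm[OF l] by (auto simp: wfm_def)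
  have "wff (N # ctx m) (Less (Bv 0) (shift t))"
    using tm_ty_subst[OF m well_typed_shift] by simp
  from Th_eq_subst[OF this e(1)] l have l': "Less s' t \<in> Th"
    by (auto simp: shift_inst subst_tm_Bv)
  obtain k where k: "tm_ty (ctx k) s' = Some N" using Th_wfm[OF l'] by (auto simp: wfm_def)
  have "wff (N # ctx k) (Less (shift s') (Bv 0))"
    using tm_ty_subst[OF k well_typed_shift] by simp
  from Th_eq_subst[OF this e(2)] l' show ?thesis
    by (auto simp: shift_inst subst_tm_Bv)
qed

lemma teq_refl: "has_ty t \<rho> \<Longrightarrow> teq \<rho> t t"
  by (induction \<rho> arbitrary: t) (auto intro: Th_eq_refl has_ty_App)

lemma teq_sym: "teq \<rho> s t \<Longrightarrow> teq \<rho> t s"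
  by (induction \<rho> arbitrary: s t) (auto intro: Th_Eq_sym)

lemma teq_trans: "teq \<rho> s t \<Longrightarrow> teq \<rho> t u \<Longrightarrow> teq \<rho> s u"
proof (induction \<rho> arbitrary: s t u)
  case (Arr \<rho> \<tau>)
  show ?case using Arr.prems Arr.IH(2) by fastforce
qed (auto intro: Th_Eq_trans)

lemma wff_extensionality: "wff [] (extensionality_axiom \<rho> \<tau> 0)"
  unfolding extensionality_axiom_eqf by (auto intro!: wff_eqf)

text \<open>This is where the extensionality axioms act: without them application would not be well
  defined on classes of extensionally equal terms. The axiom is instantiated from the outermost
  quantifier inwards, hence the shifts still present in the intermediate formulas.\<close>

lemma teq_app:
  assumes "has_ty r \<rho>" "has_ty r' \<rho>" "has_ty f (\<rho> \<rightarrow> \<tau>)" "teq \<rho> r r'"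
  shows "teq \<tau> (App f r) (App f r')"
proof -
  let ?A = "\<lambda>r r' f. Imp (eqf \<rho> r r') (eqf \<tau> (App f r) (App f r'))"
  have "extensionality_axiom \<rho> \<tau> 0 \<in> Th" using Th_axm extT wff_extensionality by blast
  then have "All \<rho> (All \<rho> (All (\<rho> \<rightarrow> \<tau>) (?A (Bv 2) (Bv 1) (Bv 0)))) \<in> Th"
    by (simp only: extensionality_axiom_eqf)
  moreover from this have "wfm (All \<rho> (All \<rho> (All (\<rho> \<rightarrow> \<tau>) (?A (Bv 2) (Bv 1) (Bv 0)))))"
    by (rule Th_wfm)
  ultimately have "inst r (All \<rho> (All (\<rho> \<rightarrow> \<tau>) (?A (Bv 2) (Bv 1) (Bv 0)))) \<in> Th"
    using Th_All assms by blast
  then have "All \<rho> (All (\<rho> \<rightarrow> \<tau>) (?A (shift (shift r)) (Bv 1) (Bv 0))) \<in> Th"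
    by (simp add: subst_eqf under_binder_def numeral_2_eq_2)
  from Th_All[THEN iffD1, rule_format, OF Th_wfm, OF this this assms(2)]
  have "All (\<rho> \<rightarrow> \<tau>) (?A (shift r) (shift r') (Bv 0)) \<in> Th"
    by (simp add: subst_eqf shift_under shift_inst subst_tm_Bv) (simp add: under_binder_def)
  from Th_All[THEN iffD1, rule_format, OF Th_wfm, OF this this assms(3)]
  have "?A r r' f \<in> Th"
    by (simp add: subst_eqf shift_under shift_inst subst_tm_Bv)
  then have "eqf \<tau> (App f r) (App f r') \<in> Th"
    by (rule Th_mp) (use assms eqf_Th in blast)
  then show ?thesis using assms eqf_Th has_ty_App by blast
qed

lemma teq_cong:
  assumes "has_ty r \<rho>" "has_ty r' \<rho>" "has_ty f (\<rho> \<rightarrow> \<tau>)" "has_ty g (\<rho> \<rightarrow> \<tau>)"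
    "teq (\<rho> \<rightarrow> \<tau>) f g" "teq \<rho> r r'"
  shows "teq \<tau> (App f r) (App g r')"
  using assms teq_app[OF assms(1,2,4,6)] teq_trans by auto

section \<open>The quotient of the terms and its truth lemma\<close>

definition cls :: "tm \<Rightarrow> tm set" where
  "cls t = {s. \<exists>\<tau>. has_ty s \<tau> \<and> has_ty t \<tau> \<and> teq \<tau> s t}"

lemma cls_eq: "has_ty s \<tau> \<Longrightarrow> has_ty t \<tau> \<Longrightarrow> cls s = cls t \<longleftrightarrow> teq \<tau> s t"
proof
  assume "has_ty s \<tau>" "has_ty t \<tau>" "cls s = cls t"
  then have "s \<in> cls t" using teq_refl by (auto simp: cls_def)
  then show "teq \<tau> s t" using \<open>has_ty s \<tau>\<close> has_ty_unique by (auto simp: cls_def)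
next
  assume "has_ty s \<tau>" "has_ty t \<tau>" "teq \<tau> s t"
  then show "cls s = cls t"
    unfolding cls_def using has_ty_unique teq_trans teq_sym by blast
qed

lemma some_cls: "has_ty t \<tau> \<Longrightarrow> has_ty (SOME s. s \<in> cls t) \<tau> \<and> teq \<tau> (SOME s. s \<in> cls t) t"
proof -
  assume t: "has_ty t \<tau>"
  then have "t \<in> cls t" using teq_refl by (auto simp: cls_def)
  then have "(SOME s. s \<in> cls t) \<in> cls t" by (rule someI)
  then show ?thesis using t has_ty_unique by (auto simp: cls_def)
qed

text \<open>Operations are computed on chosen representatives; \<open>teq_cong\<close> and
  \<open>Th_Less_cong\<close> show that the choice does not matter.\<close>

definition model :: "tm set struct" where
  "model = \<lparr> dom = (\<lambda>\<rho>. cls ` {t. has_ty t \<rho>}),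
     app = (\<lambda>X Y. cls (App (SOME s. s \<in> X) (SOME t. t \<in> Y))),
     cst = (\<lambda>c. cls (Cst c)),
     lss = (\<lambda>X Y. Less (SOME s. s \<in> X) (SOME t. t \<in> Y) \<in> Th) \<rparr>"

lemma app_model: "has_ty f (\<rho> \<rightarrow> \<tau>) \<Longrightarrow> has_ty t \<rho> \<Longrightarrow> app model (cls f) (cls t) = cls (App f t)"
proof -
  assume ft: "has_ty f (\<rho> \<rightarrow> \<tau>)" "has_ty t \<rho>"
  let ?f = "SOME s. s \<in> cls f" and ?t = "SOME s. s \<in> cls t"
  have "teq \<tau> (App ?f ?t) (App f t)" using some_cls[OF ft(1)] some_cls[OF ft(2)] ft by (intro teq_cong[of _ \<rho>]) blast+
  moreover have "has_ty (App ?f ?t) \<tau>" "has_ty (App f t) \<tau>" using some_cls ft has_ty_App by blast+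
  ultimately show ?thesis by (simp add: model_def cls_eq[of _ \<tau>])
qed

lemma lss_model: "has_ty s N \<Longrightarrow> has_ty t N \<Longrightarrow> lss model (cls s) (cls t) \<longleftrightarrow> Less s t \<in> Th"
  using some_cls[of s N] some_cls[of t N]
  by (auto simp: model_def intro: Th_Less_cong Th_Eq_sym)

lemma ext_structure_model: "ext_structure model"
proof
  show "cst model c \<in> dom model (const_ty c)" for c by (auto simp: model_def has_ty_Cst)
next
  fix f x \<rho> \<tau> assume "f \<in> dom model (\<rho> \<rightarrow> \<tau>)" "x \<in> dom model \<rho>"
  then obtain s t where "f = cls s" "x = cls t" "has_ty s (\<rho> \<rightarrow> \<tau>)" "has_ty t \<rho>"
    by (auto simp: model_def)
  then show "app model f x \<in> dom model \<tau>"
    using app_model has_ty_App by (auto simp: model_def)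
next
  fix f g \<rho> \<tau> assume fg: "f \<in> dom model (\<rho> \<rightarrow> \<tau>)" "g \<in> dom model (\<rho> \<rightarrow> \<tau>)"
    and eq: "\<And>x. x \<in> dom model \<rho> \<Longrightarrow> app model f x = app model g x"
  then obtain s t where st: "f = cls s" "g = cls t" "has_ty s (\<rho> \<rightarrow> \<tau>)" "has_ty t (\<rho> \<rightarrow> \<tau>)"
    by (auto simp: model_def)
  have "teq \<tau> (App s r) (App t r)" if r: "has_ty r \<rho>" for r
  proof -
    have "cls (App s r) = cls (App t r)"
      using eq[of "cls r"] st r by (simp add: app_model[of _ \<rho> \<tau>]) (simp add: model_def)
    then show ?thesis using cls_eq has_ty_App st r by blast
  qed
  then show "f = g" using st cls_eq[OF st(3,4)] by simp
qed

lemma evl_model: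
  assumes "tm_ty ts t = Some \<tau>" "\<forall>i<length ts. has_ty (\<sigma> i) (ts ! i)"
  shows "evl model (\<lambda>i. cls (\<sigma> i)) t = cls (subst_tm \<sigma> t)"
  using assms(1)
proof (induction t arbitrary: \<tau>)
  case (App s t)
  then obtain \<rho> where *: "tm_ty ts s = Some (\<rho> \<rightarrow> \<tau>)" "tm_ty ts t = Some \<rho>"
    by (auto split: option.splits ty.splits if_splits)
  then show ?case
    using App.IH app_model[OF has_ty_subst[OF *(1) assms(2)] has_ty_subst[OF *(2) assms(2)]] by simp
qed (auto simp: model_def)

text \<open>The truth lemma has to be stated for open formulas. An environment of classes
  corresponds to a substitution by representatives, and every element of a domain is such a class,
  which settles the quantifier case by \<open>Th_All\<close>.\<close>

lemma sat_model:
  assumes "wff ts \<phi>" "\<forall>i<length ts. has_ty (\<sigma> i) (ts ! i)"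
  shows "sat model (\<lambda>i. cls (\<sigma> i)) \<phi> \<longleftrightarrow> subst \<sigma> \<phi> \<in> Th"
  using assms
proof (induction \<phi> arbitrary: ts \<sigma>)
  case Fls
  then show ?case by (simp add: Th_Fls)
next
  case (Eq s t)
  then show ?case
    using has_ty_subst[of ts _ N \<sigma>] evl_model[of ts _ N \<sigma>] by (simp add: cls_eq[of _ N])
next
  case (Less s t)
  then show ?case
    using has_ty_subst[of ts _ N \<sigma>] evl_model[of ts _ N \<sigma>] by (simp add: lss_model)
next
  case (Imp \<phi> \<psi>)
  then show ?case using Imp.IH[of ts \<sigma>] wfm_subst[of ts _ \<sigma>] by (simp add: Th_Imp)
next
  case (All \<rho> \<phi>)
  have *: "sat model (case_nat (cls t) (\<lambda>i. cls (\<sigma> i))) \<phi> \<longleftrightarrow> inst t (subst (under_binder \<sigma>) \<phi>) \<in> Th"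
    if "has_ty t \<rho>" for t
  proof -
    have "case_nat (cls t) (\<lambda>i. cls (\<sigma> i)) = (\<lambda>i. cls (case_nat t \<sigma> i))"
      by (auto simp: fun_eq_iff split: nat.splits)
    moreover have "\<forall>i<length (\<rho> # ts). has_ty (case_nat t \<sigma> i) ((\<rho> # ts) ! i)"
      using All.prems(2) that by (auto simp: less_Suc_eq_0_disj)
    ultimately show ?thesis using All.IH[of "\<rho> # ts" "case_nat t \<sigma>"] All.prems(1) by (simp add: inst_under)
  qed
  have "wfm (All \<rho> (subst (under_binder \<sigma>) \<phi>))" using wfm_subst[OF All.prems] by simp
  then show ?case using * by (auto simp: Th_All) (auto simp: model_def)
qed

lemma truth_model: "wff [] \<phi> \<Longrightarrow> truth model \<phi> \<longleftrightarrow> \<phi> \<in> Th"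
  using sat_model[of "[]" \<phi> "\<lambda>_. Cst Zero"] by (simp add: truth_def subst_closed model_def)

end

theorem completeness:
  assumes "wff [] \<phi>" "\<not> prv T [] [] \<phi>" "\<And>\<rho> \<tau>. extensionality_axiom \<rho> \<tau> 0 \<in> T"
  shows "\<exists>M :: tm set struct. ext_structure M \<and> (\<forall>\<psi>\<in>T. wff [] \<psi> \<longrightarrow> truth M \<psi>) \<and> \<not> truth M \<phi>"
proof -
  let ?\<psi> = "Imp \<phi> Fls"
  have ctx0: "ctx 0 = []" by (simp add: ctx_def)
  have wf: "wff [] ?\<psi>" using assms(1) by simp
  have "consistent T [?\<psi>]"
    unfolding consistent_def derives_def
  proof
    assume "\<exists>n. prv T (ctx n) [?\<psi>] Fls"
    then obtain n where "prv T (ctx n) [?\<psi>] Fls" by blast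
    \<comment> \<open>The refutation may mention variables, while provability is defined in the
      empty context; closed terms are put in their place, which leaves the sentence itself
      unchanged.\<close>
    moreover have "well_typed [] (\<lambda>i. inhabitant (var_ty i)) (ctx n)"
      by (simp add: well_typed_def tm_ty_inhabitant)
    ultimately have "prv T [] (map (subst (\<lambda>i. inhabitant (var_ty i))) [?\<psi>]) Fls"
      using prv_subst[of T "ctx n" "[?\<psi>]" Fls] by simp
    then have "prv T [] [?\<psi>] Fls" using subst_closed[OF assms(1)] by simp
    then have "prv T [] [] \<phi>" by (rule prv.raa[OF assms(1)])
    with assms(2) show False ..
  qed
  moreover have "wfm ?\<psi>" unfolding wfm_def using wf ctx0 by (intro exI[of _ 0]) simp
  ultimately interpret ext_henkin T ?\<psi> using assms(3) by unfold_locales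
  have "?\<psi> \<in> Th" by (rule Th_start)
  then have "\<phi> \<notin> Th" using Th_mp Th_Fls by blast
  then show ?thesis
    using ext_structure_model truth_model assms(1) Th_axm by (intro exI[of _ model]) auto
qed


section \<open>Models of the base theory\<close>

locale aca_structure = ext_structure +
  assumes axioms_true: "\<phi> \<in> ACA0w \<Longrightarrow> wff [] \<phi> \<Longrightarrow> truth M \<phi>"
begin

abbreviation ap (infixl "$$" 90) where "f $$ x \<equiv> app M f x"
abbreviation D where "D \<equiv> dom M"
abbreviation "ze \<equiv> cst M Zero"
abbreviation "on \<equiv> cst M One"
abbreviation pl (infixl "\<oplus>" 65) where "a \<oplus> b \<equiv> cst M Plus $$ a $$ b"
abbreviation ti (infixl "\<odot>" 70) where "a \<odot> b \<equiv> cst M Times $$ a $$ b"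

lemma RCA0w_true: "\<phi> \<in> RCA0w \<Longrightarrow> wff [] \<phi> \<Longrightarrow> truth M \<phi>"
  using axioms_true by (simp add: ACA0w_def)

lemma ze_D [simp]: "ze \<in> D N" and on_D [simp]: "on \<in> D N"
  and pl_D: "cst M Plus \<in> D (N \<rightarrow> N \<rightarrow> N)" and ti_D: "cst M Times \<in> D (N \<rightarrow> N \<rightarrow> N)"
  using cst_dom[of Zero] cst_dom[of One] cst_dom[of Plus] cst_dom[of Times] by simp_all

lemma plus_D [simp]: "a \<in> D N \<Longrightarrow> b \<in> D N \<Longrightarrow> a \<oplus> b \<in> D N"
  and times_D [simp]: "a \<in> D N \<Longrightarrow> b \<in> D N \<Longrightarrow> a \<odot> b \<in> D N"
  using pl_D ti_D app_dom by blast+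

lemmas hoas_simps = truth_def hall_def himp_def heq_def hless_def hnot_def hfalse_def hand_def
  hor_def hiff_def hex_def hzero_def hone_def hplus_def htimes_def happ_def hcst_def
  basic_arithmetic_def

lemma basic_arithmetic_true: "\<phi> \<in> basic_arithmetic \<Longrightarrow> truth M (\<phi> 0)"
proof -
  assume "\<phi> \<in> basic_arithmetic"
  moreover have "wff [] (\<phi> 0)" if "\<phi> \<in> basic_arithmetic"
    using that by (auto simp: hoas_simps)
  ultimately show ?thesis using RCA0w_true RCA0w.intros(1) by blast
qed

lemma plus_one_neq: "n \<in> D N \<Longrightarrow> n \<oplus> on \<noteq> ze"
  and plus_one_inj: "m \<in> D N \<Longrightarrow> n \<in> D N \<Longrightarrow> m \<oplus> on = n \<oplus> on \<Longrightarrow> m = n"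
  and plus_zero: "m \<in> D N \<Longrightarrow> m \<oplus> ze = m"
  and plus_suc: "m \<in> D N \<Longrightarrow> n \<in> D N \<Longrightarrow> m \<oplus> (n \<oplus> on) = (m \<oplus> n) \<oplus> on"
  and times_zero: "m \<in> D N \<Longrightarrow> m \<odot> ze = ze"
  and times_suc: "m \<in> D N \<Longrightarrow> n \<in> D N \<Longrightarrow> m \<odot> (n \<oplus> on) = m \<odot> n \<oplus> m"
  and not_less_zero: "m \<in> D N \<Longrightarrow> \<not> lss M m ze"
  and less_suc: "m \<in> D N \<Longrightarrow> n \<in> D N \<Longrightarrow> lss M m (n \<oplus> on) \<longleftrightarrow> lss M m n \<or> m = n"
proof -
  have "\<forall>\<phi>\<in>basic_arithmetic. truth M (\<phi> 0)" using basic_arithmetic_true by blast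
  note this[unfolded basic_arithmetic_def ball_simps, unfolded hoas_simps]
  note * = this[simplified nat.case sat.simps evl.simps diff_Suc_Suc diff_zero diff_self_eq_0 simp_thms]
  show "n \<in> D N \<Longrightarrow> n \<oplus> on \<noteq> ze" using *[THEN conjunct1] by simp
  show "m \<in> D N \<Longrightarrow> n \<in> D N \<Longrightarrow> m \<oplus> on = n \<oplus> on \<Longrightarrow> m = n"
    using *[THEN conjunct2, THEN conjunct1, rule_format] by metis
  show "m \<in> D N \<Longrightarrow> m \<oplus> ze = m" using *[THEN conjunct2, THEN conjunct2, THEN conjunct1] by simp
  show "m \<in> D N \<Longrightarrow> n \<in> D N \<Longrightarrow> m \<oplus> (n \<oplus> on) = (m \<oplus> n) \<oplus> on" using *[THEN conjunct2, THEN conjunct2, THEN conjunct2, THEN conjunct1] by simp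
  show "m \<in> D N \<Longrightarrow> m \<odot> ze = ze" using *[THEN conjunct2, THEN conjunct2, THEN conjunct2, THEN conjunct2, THEN conjunct1] by simp
  show "m \<in> D N \<Longrightarrow> n \<in> D N \<Longrightarrow> m \<odot> (n \<oplus> on) = m \<odot> n \<oplus> m" using *[THEN conjunct2, THEN conjunct2, THEN conjunct2, THEN conjunct2, THEN conjunct2, THEN conjunct1] by simp
  show "m \<in> D N \<Longrightarrow> \<not> lss M m ze" using *[THEN conjunct2, THEN conjunct2, THEN conjunct2, THEN conjunct2, THEN conjunct2, THEN conjunct2, THEN conjunct1] by simp
  show "m \<in> D N \<Longrightarrow> n \<in> D N \<Longrightarrow> lss M m (n \<oplus> on) \<longleftrightarrow> lss M m n \<or> m = n"
    using *[THEN conjunct2, THEN conjunct2, THEN conjunct2, THEN conjunct2, THEN conjunct2, THEN conjunct2, THEN conjunct2] by blast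
qed

lemma evl_shift: "evl M (case_nat a e) (shift t) = evl M e t"
  by (induction t) auto

lemma evl_subst: "evl M e (subst_tm \<sigma> t) = evl M (\<lambda>i. evl M e (\<sigma> i)) t"
  by (induction t) auto

lemma sat_subst: "sat M e (subst \<sigma> \<phi>) \<longleftrightarrow> sat M (\<lambda>i. evl M e (\<sigma> i)) \<phi>"
proof (induction \<phi> arbitrary: e \<sigma>)
  case (All \<rho> \<phi>)
  have "(\<lambda>i. evl M (case_nat a e) (under_binder \<sigma> i)) = case_nat a (\<lambda>i. evl M e (\<sigma> i))" for a
    by (auto simp: fun_eq_iff under_binder_def evl_shift split: nat.splits)
  then show ?case by (simp add: All.IH)
qed (auto simp: evl_subst)

text \<open>Induction on the type: formal equality at an arrow type is pointwise, and
  \<open>ext\<close> turns pointwise equality into identity. The axioms for the combinators thus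
  become plain equations.\<close>

lemma sat_eqf:
  "tm_ty ts s = Some \<rho> \<Longrightarrow> tm_ty ts t = Some \<rho> \<Longrightarrow> evl M e s \<in> D \<rho> \<Longrightarrow> evl M e t \<in> D \<rho> \<Longrightarrow>
    sat M e (eqf \<rho> s t) \<longleftrightarrow> evl M e s = evl M e t"
proof (induction \<rho> arbitrary: ts e s t)
  case (Arr \<rho> \<tau>)
  have ty: "tm_ty (\<rho> # ts) (shift s) = Some (\<rho> \<rightarrow> \<tau>)" "tm_ty (\<rho> # ts) (shift t) = Some (\<rho> \<rightarrow> \<tau>)"
    using Arr.prems by (auto intro: tm_ty_subst well_typed_shift)
  have "sat M e (eqf (\<rho> \<rightarrow> \<tau>) s t) \<longleftrightarrow> (\<forall>a\<in>D \<rho>. evl M e s $$ a = evl M e t $$ a)"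
    using Arr.IH(2)[of "\<rho> # ts" "App (shift s) (Bv 0)" "App (shift t) (Bv 0)" "case_nat a e" for a]
      ty Arr.prems by (simp add: evl_shift app_dom)
  also have "\<dots> \<longleftrightarrow> evl M e s = evl M e t"
    using ext[OF Arr.prems(3,4)] by auto
  finally show ?case .
qed simp

text \<open>The types are schematic here, so the axiom cannot be evaluated like the ground ones; it
  is brought into \<open>eqf\<close> form first.\<close>

lemma Pi_app: "x \<in> D \<rho> \<Longrightarrow> y \<in> D \<tau> \<Longrightarrow> cst M (PiC \<rho> \<tau>) $$ x $$ y = x"
proof -
  let ?x = "\<lambda>d. Bv (d - Suc 0)" and ?y = "\<lambda>d. Bv (d - Suc (Suc 0))"
  assume xy: "x \<in> D \<rho>" "y \<in> D \<tau>"
  have coh: "coherent 2 ?x" "coherent 2 ?y" by (auto simp: coherent_def)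
  have "Pi_axiom \<rho> \<tau> 0 = All \<rho> (All \<tau> (eq_at \<rho> (hcst (PiC \<rho> \<tau>) \<cdot> ?x \<cdot> ?y) ?x 2))"
    by (simp add: Pi_axiom_def hall_def numeral_2_eq_2)
  also have "\<dots> = All \<rho> (All \<tau> (eqf \<rho> (App (App (Cst (PiC \<rho> \<tau>)) (Bv 1)) (Bv 0)) (Bv 1)))"
    by (subst eq_at_eqf, (rule coherent_happ coherent_hcst coh)+) (simp add: happ_def hcst_def)
  finally have eq: "Pi_axiom \<rho> \<tau> 0 = \<dots>" .
  have "wff [] (Pi_axiom \<rho> \<tau> 0)" unfolding eq by (auto intro!: wff_eqf)
  then have "truth M (Pi_axiom \<rho> \<tau> 0)" using RCA0w_true RCA0w.intros(2) by blast
  then have "sat M (case_nat y (case_nat x (\<lambda>_. ze))) (eqf \<rho> (App (App (Cst (PiC \<rho> \<tau>)) (Bv 1)) (Bv 0)) (Bv 1))"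
    using xy by (simp add: eq truth_def)
  moreover have "cst M (PiC \<rho> \<tau>) $$ x $$ y \<in> D \<rho>"
    using xy cst_dom[of "PiC \<rho> \<tau>"] app_dom by (metis const_ty.simps(5))
  ultimately show ?thesis using xy by (subst (asm) sat_eqf[where ts = "[\<tau>, \<rho>]"]) auto
qed

lemma Sigma_app:
  assumes xyz: "x \<in> D (\<rho> \<rightarrow> \<sigma> \<rightarrow> \<tau>)" "y \<in> D (\<rho> \<rightarrow> \<sigma>)" "z \<in> D \<rho>"
  shows "cst M (SigmaC \<rho> \<sigma> \<tau>) $$ x $$ y $$ z = x $$ z $$ (y $$ z)"
proof -
  let ?x = "\<lambda>d. Bv (d - Suc 0)" and ?y = "\<lambda>d. Bv (d - Suc (Suc 0))" and ?z = "\<lambda>d. Bv (d - Suc (Suc (Suc 0)))"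
  let ?s = "App (App (App (Cst (SigmaC \<rho> \<sigma> \<tau>)) (Bv 2)) (Bv 1)) (Bv 0)"
    and ?t = "App (App (Bv 2) (Bv 0)) (App (Bv 1) (Bv 0))"
  have coh: "coherent 3 ?x" "coherent 3 ?y" "coherent 3 ?z" by (auto simp: coherent_def)
  have "Sigma_axiom \<rho> \<sigma> \<tau> 0 = All (\<rho> \<rightarrow> \<sigma> \<rightarrow> \<tau>) (All (\<rho> \<rightarrow> \<sigma>) (All \<rho>
      (eq_at \<tau> (hcst (SigmaC \<rho> \<sigma> \<tau>) \<cdot> ?x \<cdot> ?y \<cdot> ?z) (?x \<cdot> ?z \<cdot> (?y \<cdot> ?z)) 3)))"
    by (simp add: Sigma_axiom_def hall_def numeral_3_eq_3)
  also have "\<dots> = All (\<rho> \<rightarrow> \<sigma> \<rightarrow> \<tau>) (All (\<rho> \<rightarrow> \<sigma>) (All \<rho> (eqf \<tau> ?s ?t)))"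
    by (subst eq_at_eqf, (rule coherent_happ coherent_hcst coh)+) (simp add: happ_def hcst_def)
  finally have eq: "Sigma_axiom \<rho> \<sigma> \<tau> 0 = \<dots>" .
  have "wff [] (Sigma_axiom \<rho> \<sigma> \<tau> 0)" unfolding eq by (auto intro!: wff_eqf)
  then have "truth M (Sigma_axiom \<rho> \<sigma> \<tau> 0)" using RCA0w_true RCA0w.intros(3) by blast
  then have "sat M (case_nat z (case_nat y (case_nat x (\<lambda>_. ze)))) (eqf \<tau> ?s ?t)"
    using xyz by (simp add: eq truth_def)
  moreover have "cst M (SigmaC \<rho> \<sigma> \<tau>) $$ x $$ y $$ z \<in> D \<tau>"
    using xyz cst_dom[of "SigmaC \<rho> \<sigma> \<tau>"] app_dom by (metis const_ty.simps(6))
  moreover have "x $$ z $$ (y $$ z) \<in> D \<tau>" using xyz app_dom by blast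
  ultimately show ?thesis
    by (subst (asm) sat_eqf[where ts = "[\<rho>, \<rho> \<rightarrow> \<sigma>, \<rho> \<rightarrow> \<sigma> \<rightarrow> \<tau>]"]) (auto simp: numeral_eq_Suc)
qed

lemma Rec_D: "cst M Rec \<in> D ((N \<rightarrow> N \<rightarrow> N) \<rightarrow> N \<rightarrow> N \<rightarrow> N)"
  using cst_dom[of Rec] by simp

lemma Rec_true:
  assumes "f \<in> D (N \<rightarrow> N \<rightarrow> N)" "m \<in> D N"
  shows Rec_zero: "cst M Rec $$ f $$ m $$ ze = m"
    and Rec_suc: "n \<in> D N \<Longrightarrow> cst M Rec $$ f $$ m $$ (n \<oplus> on) = f $$ n $$ (cst M Rec $$ f $$ m $$ n)"
proof -
  have "wff [] (Rec_axiom 0)" by code_simp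
  then have "truth M (Rec_axiom 0)" using RCA0w_true RCA0w.intros(4) by blast
  then show "cst M Rec $$ f $$ m $$ ze = m"
    "n \<in> D N \<Longrightarrow> cst M Rec $$ f $$ m $$ (n \<oplus> on) = f $$ n $$ (cst M Rec $$ f $$ m $$ n)"
    using assms by (auto simp: Rec_axiom_def hoas_simps)
qed


subsection \<open>Definable functions\<close>

definition env :: "ty list \<Rightarrow> (nat \<Rightarrow> 'a) \<Rightarrow> bool" where
  "env \<Gamma> e \<longleftrightarrow> (\<forall>i<length \<Gamma>. e i \<in> D (\<Gamma> ! i))"

lemma env_Cons: "env (\<rho> # \<Gamma>) (case_nat a e) \<longleftrightarrow> a \<in> D \<rho> \<and> env \<Gamma> e"
  by (auto simp: env_def less_Suc_eq_0_disj)

lemma env_ConsD: "env (\<rho> # \<Gamma>) e \<Longrightarrow> e 0 \<in> D \<rho> \<and> env \<Gamma> (\<lambda>i. e (Suc i))"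
  by (auto simp: env_def)

text \<open>Applicative polynomials over the structure, with elements of the model as parameters.
  The rule \<open>agree\<close> frees the HOL expression from this shape: its values on well-typed
  environments are what counts.\<close>

inductive dfn :: "ty list \<Rightarrow> ty \<Rightarrow> ((nat \<Rightarrow> 'a) \<Rightarrow> 'a) \<Rightarrow> bool" for \<Gamma> where
  var: "i < length \<Gamma> \<Longrightarrow> \<Gamma> ! i = \<tau> \<Longrightarrow> dfn \<Gamma> \<tau> (\<lambda>e. e i)"
| par: "c \<in> D \<tau> \<Longrightarrow> dfn \<Gamma> \<tau> (\<lambda>e. c)"
| app: "dfn \<Gamma> (\<rho> \<rightarrow> \<tau>) F \<Longrightarrow> dfn \<Gamma> \<rho> G \<Longrightarrow> dfn \<Gamma> \<tau> (\<lambda>e. F e $$ G e)"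
| agree: "dfn \<Gamma> \<tau> F \<Longrightarrow> (\<And>e. env \<Gamma> e \<Longrightarrow> F e = G e) \<Longrightarrow> dfn \<Gamma> \<tau> G"

lemma dfn_D: "dfn \<Gamma> \<tau> F \<Longrightarrow> env \<Gamma> e \<Longrightarrow> F e \<in> D \<tau>"
  by (induction rule: dfn.induct) (auto simp: env_def intro: app_dom)

lemma PiC_D: "cst M (PiC \<rho> \<tau>) \<in> D (\<rho> \<rightarrow> \<tau> \<rightarrow> \<rho>)" using cst_dom[of "PiC \<rho> \<tau>"] by simp

lemma SigmaC_D: "cst M (SigmaC \<rho> \<sigma> \<tau>) \<in> D ((\<rho> \<rightarrow> \<sigma> \<rightarrow> \<tau>) \<rightarrow> (\<rho> \<rightarrow> \<sigma>) \<rightarrow> \<rho> \<rightarrow> \<tau>)"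
  using cst_dom[of "SigmaC \<rho> \<sigma> \<tau>"] by simp

text \<open>Combinatory completeness: the usual translation of abstraction, carried out along the
  derivation of definability.\<close>

lemma bracket_abstraction:
  assumes "dfn (\<rho> # \<Gamma>) \<tau> F"
  shows "\<exists>F'. dfn \<Gamma> (\<rho> \<rightarrow> \<tau>) F' \<and> (\<forall>e. env \<Gamma> e \<longrightarrow> (\<forall>a\<in>D \<rho>. F' e $$ a = F (case_nat a e)))"
  using assms
proof (induction rule: dfn.induct)
  case (var i \<tau>)
  show ?case
  proof (cases i)
    case 0
    \<comment> \<open>The identity as SKK; the second type argument of the first K is forced by the
      type of S.\<close>
    let ?I = "cst M (SigmaC \<rho> (\<rho> \<rightarrow> \<rho>) \<rho>) $$ cst M (PiC \<rho> (\<rho> \<rightarrow> \<rho>)) $$ cst M (PiC \<rho> \<rho>)"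
    have "?I \<in> D (\<rho> \<rightarrow> \<rho>)" by (meson app_dom PiC_D SigmaC_D)
    moreover have "?I $$ a = a" if "a \<in> D \<rho>" for a
      using that by (subst Sigma_app) (auto intro: PiC_D app_dom simp: Pi_app app_dom[OF PiC_D])
    ultimately show ?thesis using 0 var by (intro exI[of _ "\<lambda>e. ?I"]) (auto intro: dfn.par)
  next
    case (Suc j)
    have "dfn \<Gamma> (\<rho> \<rightarrow> \<tau>) (\<lambda>e. cst M (PiC \<tau> \<rho>) $$ e j)"
      using var Suc by (intro dfn.app[where \<rho> = \<tau>] dfn.par PiC_D dfn.var) auto
    moreover have "env \<Gamma> e \<Longrightarrow> e j \<in> D \<tau>" for e
      using var Suc by (auto simp: env_def)
    ultimately show ?thesis using Suc
      by (intro exI[of _ "\<lambda>e. cst M (PiC \<tau> \<rho>) $$ e j"]) (auto simp: Pi_app)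
  qed
next
  case (par c \<tau>)
  then have "dfn \<Gamma> (\<rho> \<rightarrow> \<tau>) (\<lambda>e. cst M (PiC \<tau> \<rho>) $$ c)"
    by (intro dfn.app[where \<rho> = \<tau>] dfn.par PiC_D)
  then show ?case using par by (intro exI[of _ "\<lambda>e. cst M (PiC \<tau> \<rho>) $$ c"]) (auto simp: Pi_app)
next
  case (app \<sigma> \<tau> F G)
  then obtain F' G' where F': "dfn \<Gamma> (\<rho> \<rightarrow> \<sigma> \<rightarrow> \<tau>) F'" "\<forall>e. env \<Gamma> e \<longrightarrow> (\<forall>a\<in>D \<rho>. F' e $$ a = F (case_nat a e))"
    and G': "dfn \<Gamma> (\<rho> \<rightarrow> \<sigma>) G'" "\<forall>e. env \<Gamma> e \<longrightarrow> (\<forall>a\<in>D \<rho>. G' e $$ a = G (case_nat a e))"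
    by blast
  let ?H = "\<lambda>e. cst M (SigmaC \<rho> \<sigma> \<tau>) $$ F' e $$ G' e"
  have "dfn \<Gamma> (\<rho> \<rightarrow> \<tau>) ?H"
    by (rule dfn.app[OF dfn.app[OF dfn.par[OF SigmaC_D] F'(1)] G'(1)])
  moreover have "env \<Gamma> e \<Longrightarrow> a \<in> D \<rho> \<Longrightarrow> ?H e $$ a = F (case_nat a e) $$ G (case_nat a e)" for e a
    using F' G' dfn_D by (subst Sigma_app) auto
  ultimately show ?case by (intro exI[of _ ?H]) auto
next
  case (agree \<tau> F G)
  then show ?case by (metis env_Cons)
qed

text \<open>By extensionality at most one element of the model represents \<open>f\<close>, so a
  definite description suffices; for definable \<open>f\<close> there is one by
  \<open>lam_exists\<close>.\<close>

definition lam :: "ty \<Rightarrow> ty \<Rightarrow> ('a \<Rightarrow> 'a) \<Rightarrow> 'a" where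
  "lam \<rho> \<tau> f = (THE g. g \<in> D (\<rho> \<rightarrow> \<tau>) \<and> (\<forall>a\<in>D \<rho>. g $$ a = f a))"

lemma lam_eqI: "g \<in> D (\<rho> \<rightarrow> \<tau>) \<Longrightarrow> (\<And>a. a \<in> D \<rho> \<Longrightarrow> g $$ a = f a) \<Longrightarrow> lam \<rho> \<tau> f = g"
  unfolding lam_def by (rule the_equality) (auto intro: ext)

lemma lam_exists:
  assumes "dfn (\<rho> # \<Gamma>) \<tau> (\<lambda>e. F (e 0) (\<lambda>i. e (Suc i)))"
  shows "\<exists>F'. dfn \<Gamma> (\<rho> \<rightarrow> \<tau>) F' \<and> (\<forall>e. env \<Gamma> e \<longrightarrow> F' e = lam \<rho> \<tau> (\<lambda>a. F a e) \<and>
    (\<forall>a\<in>D \<rho>. F' e $$ a = F a e))"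
proof -
  obtain F' where F': "dfn \<Gamma> (\<rho> \<rightarrow> \<tau>) F'" "\<forall>e. env \<Gamma> e \<longrightarrow> (\<forall>a\<in>D \<rho>. F' e $$ a = F a e)"
    using bracket_abstraction[OF assms] by auto
  moreover have "F' e = lam \<rho> \<tau> (\<lambda>a. F a e)" if "env \<Gamma> e" for e
    using F' that dfn_D by (intro lam_eqI[symmetric]) auto
  ultimately show ?thesis by blast
qed

text \<open>The premise shows the body as a function of the newest variable and of the remaining
  environment; resolution can then read off \<open>F\<close> from a goal containing a HOL
  abstraction.\<close>

lemma dfn_lam:
  "dfn (\<rho> # \<Gamma>) \<tau> (\<lambda>e. F (e 0) (\<lambda>i. e (Suc i))) \<Longrightarrow> dfn \<Gamma> (\<rho> \<rightarrow> \<tau>) (\<lambda>e. lam \<rho> \<tau> (\<lambda>a. F a e))"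
  by (drule lam_exists) (auto intro: dfn.agree)

lemma lam_app_env:
  "dfn (\<rho> # \<Gamma>) \<tau> (\<lambda>e. F (e 0) (\<lambda>i. e (Suc i))) \<Longrightarrow> env \<Gamma> e \<Longrightarrow> a \<in> D \<rho> \<Longrightarrow>
    lam \<rho> \<tau> (\<lambda>a. F a e) $$ a = F a e"
  by (drule lam_exists) auto

lemma env_Nil [simp]: "env [] e" by (simp add: env_def)

lemma lam_app: "dfn [\<rho>] \<tau> (\<lambda>e. F (e 0)) \<Longrightarrow> a \<in> D \<rho> \<Longrightarrow> lam \<rho> \<tau> F $$ a = F a"
  using lam_app_env[of \<rho> "[]" \<tau> "\<lambda>a e. F a"] by simp

lemma lam_D: "dfn [\<rho>] \<tau> (\<lambda>e. F (e 0)) \<Longrightarrow> lam \<rho> \<tau> F \<in> D (\<rho> \<rightarrow> \<tau>)"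
  using dfn_D[OF dfn_lam[of \<rho> "[]" \<tau> "\<lambda>a e. F a"]] by simp


subsection \<open>Decidable predicates\<close>

text \<open>Zero stands for truth. The basic decision functionals come from \<open>QF-AC\<^sup>1\<^sup>,\<^sup>0\<close>: a pair of numbers
  is coded by a function \<open>f\<close> through \<open>f 0\<close> and \<open>f 1\<close>.\<close>

lemma choice_true:
  assumes "quantifier_free A" "wff [N, ty1, ty2] A" "G \<in> D ty2"
    and "\<And>f. f \<in> D ty1 \<Longrightarrow> \<exists>n\<in>D N. sat M (case_nat n (case_nat f (case_nat G (\<lambda>_. ze)))) A"
  shows "\<exists>F\<in>D ty2. \<forall>f\<in>D ty1. sat M (case_nat (F $$ f) (case_nat f (case_nat G (\<lambda>_. ze)))) A"
proof -
  let ?\<sigma> = "case_nat (App (Bv 1) (Bv 0)) (case_nat (Bv 0) (\<lambda>k. Bv (k + 2)))"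
  let ?\<phi> = "univ_closure [ty2] (choice_axiom_10 A)"
  have "well_typed [ty1, ty2, ty2] ?\<sigma> [N, ty1, ty2]"
    by (auto simp: well_typed_def less_Suc_eq numeral_eq_Suc split: nat.splits)
  then have "wff [] ?\<phi>"
    using wff_subst[OF assms(2)] assms(2) by (simp add: choice_axiom_10_def Let_def)
  then have "truth M ?\<phi>" using RCA0w_true RCA0w.intros(7)[OF assms(1,2)] by blast
  have "(\<lambda>i. evl M (case_nat f (case_nat F (case_nat G (\<lambda>_. ze)))) (?\<sigma> i))
      = case_nat (F $$ f) (case_nat f (case_nat G (\<lambda>_. ze)))" for f F
    by (auto simp: fun_eq_iff split: nat.splits)
  then have eq: "sat M (case_nat f (case_nat F (case_nat G (\<lambda>_. ze)))) (subst ?\<sigma> A)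
      \<longleftrightarrow> sat M (case_nat (F $$ f) (case_nat f (case_nat G (\<lambda>_. ze)))) A" for f F
    by (simp only: sat_subst)
  from \<open>truth M ?\<phi>\<close> have "\<forall>G\<in>D ty2. (\<forall>f\<in>D ty1. \<exists>n\<in>D N. sat M (case_nat n (case_nat f (case_nat G (\<lambda>_. ze)))) A) \<longrightarrow>
    (\<exists>F\<in>D ty2. \<forall>f\<in>D ty1. sat M (case_nat f (case_nat F (case_nat G (\<lambda>_. ze)))) (subst ?\<sigma> A))"
    by (simp only: choice_axiom_10_def Let_def truth_def univ_closure.simps sat.simps) blast
  from this[rule_format, OF assms(3) assms(4)] show ?thesis unfolding eq .
qed

text \<open>Stands in for \<open>on\<close> until induction has produced \<open>on_eq\<close>. As a
  successor it is distinct from \<open>ze\<close> by an axiom, and \<open>Rec_suc\<close> evaluates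
  recursions at it.\<close>

definition one' :: 'a where "one' = ze \<oplus> on"

lemma one'_D [simp]: "one' \<in> D N" by (simp add: one'_def)

lemma one'_neq [simp]: "one' \<noteq> ze" using plus_one_neq by (simp add: one'_def)

lemma decide_bool: "\<exists>n\<in>D N. n = ze \<longleftrightarrow> P"
  using one'_neq one'_D ze_D by metis

lemma exists_2_true:
  "\<exists>E\<in>D ty2. \<forall>f\<in>D ty1. (E $$ f = ze \<or> E $$ f = on) \<and> (E $$ f = ze \<longleftrightarrow> (\<exists>n\<in>D N. f $$ n = ze))"
proof -
  have "wff [] (exists_2 0)" by code_simp
  then have "truth M (exists_2 0)" using axioms_true by (simp add: ACA0w_def)
  then show ?thesis by (auto simp: exists_2_def hoas_simps)
qed

text \<open>\<open>?A\<close> says that the number is zero exactly if \<open>B\<close> holds. It is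
  quantifier-free and classically has a solution for every \<open>f\<close>, so choice turns truth
  values into a functional.\<close>

lemma decision_functional:
  assumes "quantifier_free B" "wff [N, ty1, ty2] B"
    and B: "\<And>n f G. sat M (case_nat n (case_nat f (case_nat G (\<lambda>_. ze)))) B \<longleftrightarrow> P f"
  shows "\<exists>F\<in>D ty2. \<forall>f\<in>D ty1. F $$ f = ze \<longleftrightarrow> P f"
proof -
  let ?A = "Imp (Imp (Imp (Eq (Bv 0) (Cst Zero)) B) (Imp (Imp B (Eq (Bv 0) (Cst Zero))) Fls)) Fls"
  obtain G where G: "G \<in> D ty2" using exists_2_true by blast
  have "\<exists>F\<in>D ty2. \<forall>f\<in>D ty1. sat M (case_nat (F $$ f) (case_nat f (case_nat G (\<lambda>_. ze)))) ?A"
    using assms(1,2) decide_bool by (intro choice_true G) (auto simp: B)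
  then show ?thesis by (auto simp: B)
qed

abbreviation "tm_at_one \<equiv> App (Bv 1) (App (App (Cst Plus) (Cst Zero)) (Cst One))"

lemma eq_functional: "\<exists>F\<in>D ty2. \<forall>f\<in>D ty1. F $$ f = ze \<longleftrightarrow> f $$ ze = f $$ one'"
  by (rule decision_functional[of "Eq (App (Bv 1) (Cst Zero)) tm_at_one"]) (auto simp: one'_def)

lemma less_functional: "\<exists>F\<in>D ty2. \<forall>f\<in>D ty1. F $$ f = ze \<longleftrightarrow> lss M (f $$ ze) (f $$ one')"
  by (rule decision_functional[of "Less (App (Bv 1) (Cst Zero)) tm_at_one"]) (auto simp: one'_def)

lemma imp_functional: "\<exists>F\<in>D ty2. \<forall>f\<in>D ty1. F $$ f = ze \<longleftrightarrow> (f $$ ze = ze \<longrightarrow> f $$ one' = ze)"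
  by (rule decision_functional[of "Imp (Eq (App (Bv 1) (Cst Zero)) (Cst Zero)) (Eq tm_at_one (Cst Zero))"])
    (auto simp: one'_def)

text \<open>Unbounded search. Writing the hypothesis that \<open>f\<close> has a zero as
  \<open>E f = 0\<close> makes the matrix quantifier-free, and \<open>E\<close> enters the choice
  axiom as a parameter. The zero found need not be the least.\<close>

lemma zero_functional: "\<exists>F\<in>D ty2. \<forall>f\<in>D ty1. (\<exists>n\<in>D N. f $$ n = ze) \<longrightarrow> f $$ (F $$ f) = ze"
proof -
  obtain E where E: "E \<in> D ty2" "\<forall>f\<in>D ty1. E $$ f = ze \<longleftrightarrow> (\<exists>n\<in>D N. f $$ n = ze)"
    using exists_2_true by blast
  let ?A = "Imp (Eq (App (Bv 2) (Bv 1)) (Cst Zero)) (Eq (App (Bv 1) (Bv 0)) (Cst Zero))"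
  have "\<exists>F\<in>D ty2. \<forall>f\<in>D ty1. sat M (case_nat (F $$ f) (case_nat f (case_nat E (\<lambda>_. ze)))) ?A"
  proof (rule choice_true)
    fix f assume f: "f \<in> D ty1"
    show "\<exists>n\<in>D N. sat M (case_nat n (case_nat f (case_nat E (\<lambda>_. ze)))) ?A"
    proof (cases "\<exists>n\<in>D N. f $$ n = ze")
      case True
      then show ?thesis by auto
    next
      case False
      then show ?thesis using E f by (intro bexI[of _ ze]) (auto simp: numeral_eq_Suc)
    qed
  qed (use E in auto)
  then show ?thesis using E by (auto simp: numeral_eq_Suc)
qed

text \<open>A recursion with constant step: \<open>x\<close> at zero and \<open>y\<close> at
  successors. A functional of type \<open>ty2\<close> can thus take two numbers as its
  argument.\<close>

definition pair :: "'a \<Rightarrow> 'a \<Rightarrow> 'a" where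
  "pair x y = cst M Rec $$ (cst M (PiC (N \<rightarrow> N) N) $$ (cst M (PiC N N) $$ y)) $$ x"

lemma pair: "x \<in> D N \<Longrightarrow> y \<in> D N \<Longrightarrow> pair x y $$ ze = x \<and> pair x y $$ one' = y"
proof -
  assume xy: "x \<in> D N" "y \<in> D N"
  then have "cst M (PiC N N) $$ y \<in> D (N \<rightarrow> N)"
    "cst M (PiC (N \<rightarrow> N) N) $$ (cst M (PiC N N) $$ y) \<in> D (N \<rightarrow> N \<rightarrow> N)"
    by (blast intro: app_dom PiC_D)+
  moreover from this have "pair x y \<in> D ty1" unfolding pair_def using xy Rec_D app_dom by blast
  ultimately show ?thesis using xy unfolding one'_def pair_def
    by (simp add: Rec_zero Rec_suc Pi_app app_dom)
qed

lemma dfn_pair: "dfn \<Gamma> N F \<Longrightarrow> dfn \<Gamma> N G \<Longrightarrow> dfn \<Gamma> ty1 (\<lambda>e. pair (F e) (G e))"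
  unfolding pair_def
  by (rule dfn.app[OF dfn.app[OF dfn.par[OF Rec_D] dfn.app[OF dfn.par[OF PiC_D] dfn.app[OF dfn.par[OF PiC_D]]]]])

definition dec :: "ty list \<Rightarrow> ((nat \<Rightarrow> 'a) \<Rightarrow> bool) \<Rightarrow> bool" where
  "dec \<Gamma> P \<longleftrightarrow> (\<exists>F. dfn \<Gamma> N F \<and> (\<forall>e. env \<Gamma> e \<longrightarrow> (F e = ze \<longleftrightarrow> P e)))"

lemma dec_cong: "dec \<Gamma> P \<Longrightarrow> (\<And>e. env \<Gamma> e \<Longrightarrow> P e \<longleftrightarrow> Q e) \<Longrightarrow> dec \<Gamma> Q"
  unfolding dec_def by metis

lemma dec_pair:
  assumes "dfn \<Gamma> N F" "dfn \<Gamma> N G"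
    and "\<exists>H\<in>D ty2. \<forall>f\<in>D ty1. H $$ f = ze \<longleftrightarrow> R (f $$ ze) (f $$ one')"
  shows "dec \<Gamma> (\<lambda>e. R (F e) (G e))"
proof -
  obtain H where H: "H \<in> D ty2" "\<forall>f\<in>D ty1. H $$ f = ze \<longleftrightarrow> R (f $$ ze) (f $$ one')"
    using assms(3) by blast
  have "dfn \<Gamma> N (\<lambda>e. H $$ pair (F e) (G e))"
    by (rule dfn.app[OF dfn.par[OF H(1)] dfn_pair[OF assms(1,2)]])
  moreover have "H $$ pair (F e) (G e) = ze \<longleftrightarrow> R (F e) (G e)" if "env \<Gamma> e" for e
    using H(2) pair[of "F e" "G e"] dfn_D[OF assms(1) that] dfn_D[OF assms(2) that]
      dfn_D[OF dfn_pair[OF assms(1,2)] that] by simp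
  ultimately show ?thesis unfolding dec_def by blast
qed

lemma dec_eq: "dfn \<Gamma> N F \<Longrightarrow> dfn \<Gamma> N G \<Longrightarrow> dec \<Gamma> (\<lambda>e. F e = G e)"
  by (rule dec_pair[OF _ _ eq_functional])

lemma dec_lss: "dfn \<Gamma> N F \<Longrightarrow> dfn \<Gamma> N G \<Longrightarrow> dec \<Gamma> (\<lambda>e. lss M (F e) (G e))"
  by (rule dec_pair[OF _ _ less_functional])

lemma dec_imp: "dec \<Gamma> P \<Longrightarrow> dec \<Gamma> Q \<Longrightarrow> dec \<Gamma> (\<lambda>e. P e \<longrightarrow> Q e)"
proof -
  assume "dec \<Gamma> P" "dec \<Gamma> Q"
  then obtain F G where F: "dfn \<Gamma> N F" "\<forall>e. env \<Gamma> e \<longrightarrow> (F e = ze \<longleftrightarrow> P e)"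
    and G: "dfn \<Gamma> N G" "\<forall>e. env \<Gamma> e \<longrightarrow> (G e = ze \<longleftrightarrow> Q e)" by (auto simp: dec_def)
  show ?thesis
    by (rule dec_cong[OF dec_pair[OF F(1) G(1), where R = "\<lambda>x y. x = ze \<longrightarrow> y = ze", OF imp_functional]])
      (use F G in auto)
qed

lemma dec_const: "dec \<Gamma> (\<lambda>e. b)"
  unfolding dec_def
  by (rule exI[of _ "\<lambda>e. if b then ze else one'"]) (cases b; auto intro: dfn.par)

lemma dec_not: "dec \<Gamma> P \<Longrightarrow> dec \<Gamma> (\<lambda>e. \<not> P e)"
proof -
  assume "dec \<Gamma> P"
  from dec_cong[OF dec_imp[OF this dec_const[of _ False]]] show ?thesis by simp
qed

lemma dec_disj: "dec \<Gamma> P \<Longrightarrow> dec \<Gamma> Q \<Longrightarrow> dec \<Gamma> (\<lambda>e. P e \<or> Q e)"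
proof -
  assume "dec \<Gamma> P" "dec \<Gamma> Q"
  from dec_imp[OF dec_not[OF this(1)] this(2)] show ?thesis by (rule dec_cong) auto
qed

lemma dec_conj: "dec \<Gamma> P \<Longrightarrow> dec \<Gamma> Q \<Longrightarrow> dec \<Gamma> (\<lambda>e. P e \<and> Q e)"
proof -
  assume "dec \<Gamma> P" "dec \<Gamma> Q"
  from dec_not[OF dec_imp[OF this(1) dec_not[OF this(2)]]] show ?thesis by (rule dec_cong) auto
qed

lemma dec_iff: "dec \<Gamma> P \<Longrightarrow> dec \<Gamma> Q \<Longrightarrow> dec \<Gamma> (\<lambda>e. P e = Q e)"
proof -
  assume "dec \<Gamma> P" "dec \<Gamma> Q"
  from dec_conj[OF dec_imp[OF this] dec_imp[OF this(2,1)]] show ?thesis by (rule dec_cong) auto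
qed

text \<open>Normalising the values to \<open>ze\<close> and \<open>on\<close> makes the function
  unique by extensionality, which the definite description in \<open>mu\<close> relies on.\<close>

lemma characteristic_function:
  assumes "dec (N # \<Gamma>) (\<lambda>e. P (e 0) (\<lambda>i. e (Suc i)))"
  shows "\<exists>F. dfn \<Gamma> ty1 F \<and> (\<forall>e. env \<Gamma> e \<longrightarrow> (\<forall>n\<in>D N. (F e $$ n = ze \<or> F e $$ n = on) \<and> (F e $$ n = ze \<longleftrightarrow> P n e)))"
proof -
  obtain G where G: "dfn (N # \<Gamma>) N G" "\<forall>e. env (N # \<Gamma>) e \<longrightarrow> (G e = ze \<longleftrightarrow> P (e 0) (\<lambda>i. e (Suc i)))"
    using assms by (auto simp: dec_def)
  obtain E where E: "E \<in> D ty2"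
    "\<forall>f\<in>D ty1. (E $$ f = ze \<or> E $$ f = on) \<and> (E $$ f = ze \<longleftrightarrow> (\<exists>n\<in>D N. f $$ n = ze))"
    using exists_2_true by blast
  \<comment> \<open>\<open>E\<close> is applied to the constant function with value
    \<open>G e\<close>, which has a zero exactly if \<open>G e\<close> is zero; the value of
    \<open>E\<close> is \<open>ze\<close> or \<open>on\<close>.\<close>
  let ?G = "\<lambda>e. E $$ (cst M (PiC N N) $$ G e)"
  have "dfn (N # \<Gamma>) N ?G"
    by (rule dfn.app[OF dfn.par[OF E(1)] dfn.app[OF dfn.par[OF PiC_D] G(1)]])
  from bracket_abstraction[OF this] obtain F where
    F: "dfn \<Gamma> (N \<rightarrow> N) F" "\<forall>e. env \<Gamma> e \<longrightarrow> (\<forall>a\<in>D N. F e $$ a = ?G (case_nat a e))" by blast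
  have "(F e $$ n = ze \<or> F e $$ n = on) \<and> (F e $$ n = ze \<longleftrightarrow> P n e)" if "env \<Gamma> e" "n \<in> D N" for e n
  proof -
    have en: "env (N # \<Gamma>) (case_nat n e)" using that by (simp add: env_Cons)
    then have GD: "G (case_nat n e) \<in> D N" by (rule dfn_D[OF G(1)])
    then have "cst M (PiC N N) $$ G (case_nat n e) \<in> D ty1" by (blast intro: app_dom PiC_D)
    then show ?thesis
      using bspec[OF E(2), of "cst M (PiC N N) $$ G (case_nat n e)"] F(2) G(2)[rule_format, OF en] that GD
      by (auto simp: Pi_app)
  qed
  then show ?thesis using F(1) by blast
qed

text \<open>The decisive use of \<open>exists_2\<close>: decidable predicates are closed under
  number quantifiers, hence contain everything arithmetical in parameters of the model.\<close>

lemma dec_ex: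
  assumes "dec (N # \<Gamma>) (\<lambda>e. P (e 0) (\<lambda>i. e (Suc i)))"
  shows "dec \<Gamma> (\<lambda>e. \<exists>n\<in>D N. P n e)"
proof -
  obtain F where F: "dfn \<Gamma> ty1 F"
    "\<forall>e. env \<Gamma> e \<longrightarrow> (\<forall>n\<in>D N. (F e $$ n = ze \<or> F e $$ n = on) \<and> (F e $$ n = ze \<longleftrightarrow> P n e))"
    using characteristic_function[OF assms] by blast
  obtain E where E: "E \<in> D ty2"
    "\<forall>f\<in>D ty1. (E $$ f = ze \<or> E $$ f = on) \<and> (E $$ f = ze \<longleftrightarrow> (\<exists>n\<in>D N. f $$ n = ze))"
    using exists_2_true by blast
  have "dfn \<Gamma> N (\<lambda>e. E $$ F e)" by (rule dfn.app[OF dfn.par[OF E(1)] F(1)])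
  moreover have "E $$ F e = ze \<longleftrightarrow> (\<exists>n\<in>D N. P n e)" if "env \<Gamma> e" for e
    using E(2) F(2) dfn_D[OF F(1) that] that by auto
  ultimately show ?thesis unfolding dec_def by blast
qed

lemma dec_all:
  assumes "dec (N # \<Gamma>) (\<lambda>e. P (e 0) (\<lambda>i. e (Suc i)))"
  shows "dec \<Gamma> (\<lambda>e. \<forall>n\<in>D N. P n e)"
  by (rule dec_cong[OF dec_not[OF dec_ex[OF dec_not[OF assms]]]]) auto

text \<open>The search operator is a function of the predicate alone because the structure is extensional.\<close>

definition zero_fun :: 'a where
  "zero_fun = (SOME F. F \<in> D ty2 \<and> (\<forall>f\<in>D ty1. (\<exists>n\<in>D N. f $$ n = ze) \<longrightarrow> f $$ (F $$ f) = ze))"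

definition mu :: "('a \<Rightarrow> bool) \<Rightarrow> 'a" where
  "mu P = zero_fun $$ (THE f. f \<in> D ty1 \<and>
     (\<forall>n\<in>D N. (f $$ n = ze \<or> f $$ n = on) \<and> (f $$ n = ze \<longleftrightarrow> P n)))"

lemma zero_fun: "zero_fun \<in> D ty2"
  "f \<in> D ty1 \<Longrightarrow> n \<in> D N \<Longrightarrow> f $$ n = ze \<Longrightarrow> f $$ (zero_fun $$ f) = ze"
proof -
  have "\<exists>F. F \<in> D ty2 \<and> (\<forall>f\<in>D ty1. (\<exists>n\<in>D N. f $$ n = ze) \<longrightarrow> f $$ (F $$ f) = ze)"
    using zero_functional by blast
  from someI_ex[OF this] show "zero_fun \<in> D ty2"
    "f \<in> D ty1 \<Longrightarrow> n \<in> D N \<Longrightarrow> f $$ n = ze \<Longrightarrow> f $$ (zero_fun $$ f) = ze"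
    unfolding zero_fun_def by blast+
qed

text \<open>The normalised characteristic function is the only candidate for the description inside
  \<open>mu\<close>, so search over a definable family is definable in the parameters of the
  family.\<close>

lemma mu_aux:
  assumes "dec (N # \<Gamma>) (\<lambda>e. P (e 0) (\<lambda>i. e (Suc i)))"
  shows "\<exists>F. dfn \<Gamma> ty1 F \<and> (\<forall>e. env \<Gamma> e \<longrightarrow> mu (\<lambda>n. P n e) = zero_fun $$ F e \<and>
    (\<forall>n\<in>D N. F e $$ n = ze \<longleftrightarrow> P n e))"
proof -
  obtain F where F: "dfn \<Gamma> ty1 F"
    "\<forall>e. env \<Gamma> e \<longrightarrow> (\<forall>n\<in>D N. (F e $$ n = ze \<or> F e $$ n = on) \<and> (F e $$ n = ze \<longleftrightarrow> P n e))"
    using characteristic_function[OF assms] by blast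
  have the: "(THE f. f \<in> D ty1 \<and> (\<forall>n\<in>D N. (f $$ n = ze \<or> f $$ n = on) \<and> (f $$ n = ze \<longleftrightarrow> P n e))) = F e"
    if "env \<Gamma> e" for e
  proof (rule the_equality)
    show "F e \<in> D ty1 \<and> (\<forall>n\<in>D N. (F e $$ n = ze \<or> F e $$ n = on) \<and> (F e $$ n = ze \<longleftrightarrow> P n e))"
      using F dfn_D that by blast
    fix f assume f: "f \<in> D ty1 \<and> (\<forall>n\<in>D N. (f $$ n = ze \<or> f $$ n = on) \<and> (f $$ n = ze \<longleftrightarrow> P n e))"
    show "f = F e"
    proof (rule ext)
      show "f \<in> D (N \<rightarrow> N)" using f by blast
      show "F e \<in> D (N \<rightarrow> N)" using F dfn_D that by blast
      show "f $$ n = F e $$ n" if "n \<in> D N" for n using f F(2) \<open>env \<Gamma> e\<close> that by metis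
    qed
  qed
  have "mu (\<lambda>n. P n e) = zero_fun $$ F e \<and> (\<forall>n\<in>D N. F e $$ n = ze \<longleftrightarrow> P n e)" if "env \<Gamma> e" for e
    unfolding mu_def using F(2) the[OF that] that by simp
  then show ?thesis using F(1) by blast
qed

lemma dfn_mu:
  "dec (N # \<Gamma>) (\<lambda>e. P (e 0) (\<lambda>i. e (Suc i))) \<Longrightarrow> dfn \<Gamma> N (\<lambda>e. mu (\<lambda>n. P n e))"
proof -
  assume "dec (N # \<Gamma>) (\<lambda>e. P (e 0) (\<lambda>i. e (Suc i)))"
  from mu_aux[OF this] obtain F where F: "dfn \<Gamma> ty1 F"
    "\<And>e. env \<Gamma> e \<Longrightarrow> mu (\<lambda>n. P n e) = zero_fun $$ F e" by blast
  show ?thesis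
    by (rule dfn.agree[OF dfn.app[OF dfn.par[OF zero_fun(1)] F(1)]]) (simp add: F(2))
qed

lemma mu_env:
  assumes "dec (N # \<Gamma>) (\<lambda>e. P (e 0) (\<lambda>i. e (Suc i)))" "env \<Gamma> e" "n \<in> D N" "P n e"
  shows "P (mu (\<lambda>n. P n e)) e"
proof -
  obtain F where F: "dfn \<Gamma> ty1 F" "mu (\<lambda>n. P n e) = zero_fun $$ F e"
    "\<forall>n\<in>D N. F e $$ n = ze \<longleftrightarrow> P n e"
    using mu_aux[OF assms(1)] assms(2) by blast
  have "F e \<in> D ty1" using F(1) assms(2) by (rule dfn_D)
  then show ?thesis using F(2,3) assms(3,4) zero_fun app_dom by metis
qed


subsection \<open>Induction\<close>

text \<open>The axiom covers quantifier-free formulas with parameters only. With the characteristic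
  function as a parameter, any decidable predicate takes the form \<open>f n = 0\<close>.\<close>

lemma induction:
  assumes "dec [N] (\<lambda>e. P (e 0))" "P ze" "\<And>n. n \<in> D N \<Longrightarrow> P n \<Longrightarrow> P (n \<oplus> on)" "n \<in> D N"
  shows "P n"
proof -
  obtain F where F: "dfn [] ty1 F" "\<forall>n\<in>D N. F (\<lambda>_. ze) $$ n = ze \<longleftrightarrow> P n"
    using characteristic_function[of "[]" "\<lambda>n e. P n"] assms(1) by force
  let ?f = "F (\<lambda>_. ze)" and ?A = "Eq (App (Bv 1) (Bv 0)) (Cst Zero)"
  have f: "?f \<in> D ty1" using F(1) by (rule dfn_D) simp
  have "wff [] (univ_closure [ty1] (induction_axiom ?A))" by code_simp
  moreover have "univ_closure [ty1] (induction_axiom ?A) \<in> RCA0w"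
    by (rule RCA0w.intros(6)) auto
  ultimately have "truth M (univ_closure [ty1] (induction_axiom ?A))" using RCA0w_true by blast
  then have "?f $$ ze = ze \<longrightarrow> (\<forall>n\<in>D N. ?f $$ n = ze \<longrightarrow> ?f $$ (n \<oplus> on) = ze) \<longrightarrow> (\<forall>n\<in>D N. ?f $$ n = ze)"
    using f by (simp add: truth_def induction_axiom_def under_binder_def)
  then show ?thesis using F(2) assms(2-4) by simp
qed

end


section \<open>Arithmetic\<close>

context aca_structure
begin

lemma dfn_plus: "dfn \<Gamma> N F \<Longrightarrow> dfn \<Gamma> N G \<Longrightarrow> dfn \<Gamma> N (\<lambda>e. F e \<oplus> G e)"
  by (rule dfn.app[OF dfn.app[OF dfn.par[OF pl_D]]])

lemma dfn_times: "dfn \<Gamma> N F \<Longrightarrow> dfn \<Gamma> N G \<Longrightarrow> dfn \<Gamma> N (\<lambda>e. F e \<odot> G e)"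
  by (rule dfn.app[OF dfn.app[OF dfn.par[OF ti_D]]])

lemmas arith_intros = dfn_plus dfn_times dfn.var dfn.par
  dec_eq dec_lss dec_const dec_not dec_conj dec_disj dec_imp dec_ex dec_all

lemma zero_plus: "n \<in> D N \<Longrightarrow> ze \<oplus> n = n"
proof (rule induction[where P = "\<lambda>n. ze \<oplus> n = n"])
  show "dec [N] (\<lambda>e. ze \<oplus> e 0 = e 0)" by (intro arith_intros) auto
qed (auto simp: plus_zero plus_suc)

lemma suc_plus: "m \<in> D N \<Longrightarrow> n \<in> D N \<Longrightarrow> (m \<oplus> on) \<oplus> n = (m \<oplus> n) \<oplus> on"
proof (rule induction[where P = "\<lambda>n. (m \<oplus> on) \<oplus> n = (m \<oplus> n) \<oplus> on"])
  show "m \<in> D N \<Longrightarrow> dec [N] (\<lambda>e. (m \<oplus> on) \<oplus> e 0 = (m \<oplus> e 0) \<oplus> on)" by (intro arith_intros) auto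
qed (auto simp: plus_zero plus_suc)

lemma plus_comm: "m \<in> D N \<Longrightarrow> n \<in> D N \<Longrightarrow> m \<oplus> n = n \<oplus> m"
proof (rule induction[where P = "\<lambda>n. m \<oplus> n = n \<oplus> m"])
  show "m \<in> D N \<Longrightarrow> dec [N] (\<lambda>e. m \<oplus> e 0 = e 0 \<oplus> m)" by (intro arith_intros) auto
qed (auto simp: plus_zero zero_plus plus_suc suc_plus)

lemma plus_assoc: "k \<in> D N \<Longrightarrow> m \<in> D N \<Longrightarrow> n \<in> D N \<Longrightarrow> (k \<oplus> m) \<oplus> n = k \<oplus> (m \<oplus> n)"
proof (rule induction[where P = "\<lambda>n. (k \<oplus> m) \<oplus> n = k \<oplus> (m \<oplus> n)"])
  show "k \<in> D N \<Longrightarrow> m \<in> D N \<Longrightarrow> dec [N] (\<lambda>e. (k \<oplus> m) \<oplus> e 0 = k \<oplus> (m \<oplus> e 0))"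
    by (intro arith_intros) auto
qed (auto simp: plus_zero plus_suc)

lemma zero_times: "n \<in> D N \<Longrightarrow> ze \<odot> n = ze"
proof (rule induction[where P = "\<lambda>n. ze \<odot> n = ze"])
  show "dec [N] (\<lambda>e. ze \<odot> e 0 = ze)" by (intro arith_intros) auto
qed (auto simp: plus_zero times_zero times_suc)

lemma suc_times: "m \<in> D N \<Longrightarrow> n \<in> D N \<Longrightarrow> (m \<oplus> on) \<odot> n = m \<odot> n \<oplus> n"
proof (rule induction[where P = "\<lambda>n. (m \<oplus> on) \<odot> n = m \<odot> n \<oplus> n"])
  show "m \<in> D N \<Longrightarrow> dec [N] (\<lambda>e. (m \<oplus> on) \<odot> e 0 = m \<odot> e 0 \<oplus> e 0)" by (intro arith_intros) auto
  fix k assume "m \<in> D N" "k \<in> D N" "(m \<oplus> on) \<odot> k = m \<odot> k \<oplus> k"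
  then show "(m \<oplus> on) \<odot> (k \<oplus> on) = m \<odot> (k \<oplus> on) \<oplus> (k \<oplus> on)"
    using plus_assoc[of "m \<odot> k" k m] plus_assoc[of "m \<odot> k" m k] plus_comm[of k m]
    by (simp add: times_suc plus_suc)
qed (auto simp: plus_zero times_zero)

lemma times_comm: "m \<in> D N \<Longrightarrow> n \<in> D N \<Longrightarrow> m \<odot> n = n \<odot> m"
proof (rule induction[where P = "\<lambda>n. m \<odot> n = n \<odot> m"])
  show "m \<in> D N \<Longrightarrow> dec [N] (\<lambda>e. m \<odot> e 0 = e 0 \<odot> m)" by (intro arith_intros) auto
qed (auto simp: times_zero zero_times times_suc suc_times)

lemma distrib: "k \<in> D N \<Longrightarrow> m \<in> D N \<Longrightarrow> n \<in> D N \<Longrightarrow> k \<odot> (m \<oplus> n) = k \<odot> m \<oplus> k \<odot> n"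
proof (rule induction[where P = "\<lambda>n. k \<odot> (m \<oplus> n) = k \<odot> m \<oplus> k \<odot> n"])
  show "k \<in> D N \<Longrightarrow> m \<in> D N \<Longrightarrow> dec [N] (\<lambda>e. k \<odot> (m \<oplus> e 0) = k \<odot> m \<oplus> k \<odot> e 0)"
    by (intro arith_intros) auto
  fix i assume "k \<in> D N" "m \<in> D N" "i \<in> D N" "k \<odot> (m \<oplus> i) = k \<odot> m \<oplus> k \<odot> i"
  then show "k \<odot> (m \<oplus> (i \<oplus> on)) = k \<odot> m \<oplus> k \<odot> (i \<oplus> on)"
    using plus_assoc[of "k \<odot> m" "k \<odot> i" k] by (simp add: plus_suc times_suc)
qed (auto simp: plus_zero times_zero)

lemma times_assoc: "k \<in> D N \<Longrightarrow> m \<in> D N \<Longrightarrow> n \<in> D N \<Longrightarrow> (k \<odot> m) \<odot> n = k \<odot> (m \<odot> n)"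
proof (rule induction[where P = "\<lambda>n. (k \<odot> m) \<odot> n = k \<odot> (m \<odot> n)"])
  show "k \<in> D N \<Longrightarrow> m \<in> D N \<Longrightarrow> dec [N] (\<lambda>e. (k \<odot> m) \<odot> e 0 = k \<odot> (m \<odot> e 0))"
    by (intro arith_intros) auto
  fix i assume "k \<in> D N" "m \<in> D N" "i \<in> D N" "(k \<odot> m) \<odot> i = k \<odot> (m \<odot> i)"
  then show "(k \<odot> m) \<odot> (i \<oplus> on) = k \<odot> (m \<odot> (i \<oplus> on))"
    using distrib[of k "m \<odot> i" m] by (simp add: times_suc)
qed (auto simp: times_zero)

lemma on_eq: "ze \<oplus> on = on" by (simp add: zero_plus)

lemma times_one: "m \<in> D N \<Longrightarrow> on \<odot> m = m"
  using suc_times[of ze m] by (simp add: on_eq zero_times zero_plus)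

lemma zero_or_suc: "n \<in> D N \<Longrightarrow> n = ze \<or> (\<exists>k\<in>D N. n = k \<oplus> on)"
proof (rule induction[where P = "\<lambda>n. n = ze \<or> (\<exists>k\<in>D N. n = k \<oplus> on)"])
  show "dec [N] (\<lambda>e. e 0 = ze \<or> (\<exists>k\<in>D N. e 0 = k \<oplus> on))" by (intro arith_intros) auto
qed auto

lemma plus_cancel: "k \<in> D N \<Longrightarrow> m \<in> D N \<Longrightarrow> n \<in> D N \<Longrightarrow> k \<oplus> m = k \<oplus> n \<Longrightarrow> m = n"
proof -
  assume mn: "k \<in> D N" "m \<in> D N" "n \<in> D N"
  have "k \<oplus> m = k \<oplus> n \<longrightarrow> m = n"
  proof (rule induction[where P = "\<lambda>k. k \<oplus> m = k \<oplus> n \<longrightarrow> m = n"])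
    show "dec [N] (\<lambda>e. e 0 \<oplus> m = e 0 \<oplus> n \<longrightarrow> m = n)" using mn by (intro arith_intros) auto
    show "(j \<oplus> on) \<oplus> m = (j \<oplus> on) \<oplus> n \<longrightarrow> m = n" if "j \<in> D N" "j \<oplus> m = j \<oplus> n \<longrightarrow> m = n" for j
      using that mn plus_one_inj[of "j \<oplus> m" "j \<oplus> n"] by (simp add: suc_plus)
  qed (use mn zero_plus in auto)
  then show "k \<oplus> m = k \<oplus> n \<Longrightarrow> m = n" by blast
qed

lemma plus_eq_zero: "m \<in> D N \<Longrightarrow> n \<in> D N \<Longrightarrow> m \<oplus> n = ze \<Longrightarrow> m = ze"
proof -
  assume "m \<in> D N" "n \<in> D N" "m \<oplus> n = ze"
  moreover have "n = ze" using zero_or_suc[of n] calculation plus_one_neq plus_suc plus_D by metis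
  ultimately show "m = ze" by (simp add: plus_zero)
qed

text \<open>By \<open>less_suc\<close> both sides satisfy the same recursion in \<open>n\<close>.
  Afterwards the order is expressible by addition.\<close>

lemma lss_iff: "m \<in> D N \<Longrightarrow> n \<in> D N \<Longrightarrow> lss M m n \<longleftrightarrow> (\<exists>k\<in>D N. n = m \<oplus> (k \<oplus> on))"
proof -
  assume m: "m \<in> D N" and n: "n \<in> D N"
  have "lss M m n = (\<exists>k\<in>D N. n = m \<oplus> (k \<oplus> on))"
  proof (rule induction[where P = "\<lambda>n. lss M m n = (\<exists>k\<in>D N. n = m \<oplus> (k \<oplus> on))"])
    show "dec [N] (\<lambda>e. lss M m (e 0) = (\<exists>k\<in>D N. e 0 = m \<oplus> (k \<oplus> on)))"
      using m by (intro arith_intros dec_iff) auto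
    have "ze \<noteq> m \<oplus> (k \<oplus> on)" if "k \<in> D N" for k
      using that m plus_one_neq[of "m \<oplus> k"] by (metis plus_suc plus_D)
    then show "lss M m ze = (\<exists>k\<in>D N. ze = m \<oplus> (k \<oplus> on))" using not_less_zero m by blast
  next
    fix i assume i: "i \<in> D N" and IH: "lss M m i = (\<exists>k\<in>D N. i = m \<oplus> (k \<oplus> on))"
    have "lss M m (i \<oplus> on) \<longleftrightarrow> (\<exists>k\<in>D N. i = m \<oplus> (k \<oplus> on)) \<or> m = i"
      using i m IH less_suc by simp
    also have "\<dots> \<longleftrightarrow> (\<exists>k\<in>D N. i = m \<oplus> k)"
    proof
      assume "\<exists>k\<in>D N. i = m \<oplus> k"
      then obtain k where k: "k \<in> D N" "i = m \<oplus> k" by blast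
      from zero_or_suc[OF k(1)] show "(\<exists>k\<in>D N. i = m \<oplus> (k \<oplus> on)) \<or> m = i"
        using k m plus_zero by auto
    next
      assume "(\<exists>k\<in>D N. i = m \<oplus> (k \<oplus> on)) \<or> m = i"
      then show "\<exists>k\<in>D N. i = m \<oplus> k"
        using m plus_zero[of m] ze_D plus_D on_D by metis
    qed
    also have "\<dots> \<longleftrightarrow> (\<exists>k\<in>D N. i \<oplus> on = m \<oplus> (k \<oplus> on))"
      using plus_suc[OF m] plus_one_inj[OF i] m plus_D by metis
    finally show "lss M m (i \<oplus> on) = (\<exists>k\<in>D N. i \<oplus> on = m \<oplus> (k \<oplus> on))" .
  qed (rule n)
  then show ?thesis .
qed

lemma linear: "m \<in> D N \<Longrightarrow> n \<in> D N \<Longrightarrow> (\<exists>k\<in>D N. n = m \<oplus> k) \<or> (\<exists>k\<in>D N. m = n \<oplus> k)"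
proof (rule induction[where P = "\<lambda>n. (\<exists>k\<in>D N. n = m \<oplus> k) \<or> (\<exists>k\<in>D N. m = n \<oplus> k)"])
  assume m: "m \<in> D N"
  show "dec [N] (\<lambda>e. (\<exists>k\<in>D N. e 0 = m \<oplus> k) \<or> (\<exists>k\<in>D N. m = e 0 \<oplus> k))"
    using m by (intro arith_intros) auto
  show "(\<exists>k\<in>D N. ze = m \<oplus> k) \<or> (\<exists>k\<in>D N. m = ze \<oplus> k)" using m zero_plus by metis
  fix i assume i: "i \<in> D N" and "(\<exists>k\<in>D N. i = m \<oplus> k) \<or> (\<exists>k\<in>D N. m = i \<oplus> k)"
  then consider k where "k \<in> D N" "i = m \<oplus> k" | "m = i" | k where "k \<in> D N" "m = i \<oplus> (k \<oplus> on)"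
    using zero_or_suc plus_zero by metis
  then show "(\<exists>k\<in>D N. i \<oplus> on = m \<oplus> k) \<or> (\<exists>k\<in>D N. m = (i \<oplus> on) \<oplus> k)"
  proof cases
    case 1
    then have "i \<oplus> on = m \<oplus> (k \<oplus> on)" using m plus_suc by simp
    then show ?thesis using 1 by (meson plus_D on_D)
  next
    case 2
    then show ?thesis using on_D by blast
  next
    case 3
    then have "m = (i \<oplus> on) \<oplus> k" using i by (simp add: suc_plus plus_suc)
    then show ?thesis using 3 by blast
  qed
qed

end

text \<open>Discretely ordered semirings relative to a carrier set, with the order expressed by
  addition. One predicate covers the numbers of a model and the natural numbers used when there is
  no counter-model.\<close>

definition semidom_on :: "'u set \<Rightarrow> 'u \<Rightarrow> 'u \<Rightarrow> ('u \<Rightarrow> 'u \<Rightarrow> 'u) \<Rightarrow> ('u \<Rightarrow> 'u \<Rightarrow> 'u) \<Rightarrow> bool" where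
  "semidom_on A z u p t \<longleftrightarrow> z \<in> A \<and> u \<in> A \<and> z \<noteq> u \<and>
    (\<forall>a\<in>A. p z a = a \<and> t z a = z \<and> t u a = a \<and> (a = z \<or> (\<exists>k\<in>A. a = p k u))) \<and>
    (\<forall>a\<in>A. \<forall>b\<in>A. p a b \<in> A \<and> t a b \<in> A \<and> p a b = p b a \<and> t a b = t b a \<and> (p a b = z \<longrightarrow> a = z) \<and>
      ((\<exists>k\<in>A. b = p a k) \<or> (\<exists>k\<in>A. a = p b k))) \<and>
    (\<forall>a\<in>A. \<forall>b\<in>A. \<forall>c\<in>A. p (p a b) c = p a (p b c) \<and> t (t a b) c = t a (t b c) \<and>
      t (p a b) c = p (t a c) (t b c) \<and> (p a b = p a c \<longrightarrow> b = c))"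

lemma semidom_onD:
  assumes "semidom_on A z u p t"
  shows "z \<in> A"
    and "u \<in> A"
    and "z \<noteq> u"
    and "a \<in> A \<Longrightarrow> p z a = a"
    and "a \<in> A \<Longrightarrow> t z a = z"
    and "a \<in> A \<Longrightarrow> t u a = a"
    and "a \<in> A \<Longrightarrow> a = z \<or> (\<exists>k\<in>A. a = p k u)"
    and "a \<in> A \<Longrightarrow> b \<in> A \<Longrightarrow> p a b \<in> A"
    and "a \<in> A \<Longrightarrow> b \<in> A \<Longrightarrow> t a b \<in> A"
    and "a \<in> A \<Longrightarrow> b \<in> A \<Longrightarrow> p a b = p b a"
    and "a \<in> A \<Longrightarrow> b \<in> A \<Longrightarrow> t a b = t b a"
    and "a \<in> A \<Longrightarrow> b \<in> A \<Longrightarrow> p a b = z \<longrightarrow> a = z"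
    and "a \<in> A \<Longrightarrow> b \<in> A \<Longrightarrow> (\<exists>k\<in>A. b = p a k) \<or> (\<exists>k\<in>A. a = p b k)"
    and "a \<in> A \<Longrightarrow> b \<in> A \<Longrightarrow> c \<in> A \<Longrightarrow> p (p a b) c = p a (p b c)"
    and "a \<in> A \<Longrightarrow> b \<in> A \<Longrightarrow> c \<in> A \<Longrightarrow> t (t a b) c = t a (t b c)"
    and "a \<in> A \<Longrightarrow> b \<in> A \<Longrightarrow> c \<in> A \<Longrightarrow> t (p a b) c = p (t a c) (t b c)"
    and "a \<in> A \<Longrightarrow> b \<in> A \<Longrightarrow> c \<in> A \<Longrightarrow> p a b = p a c \<longrightarrow> b = c"
proof -
  note * = assms[unfolded semidom_on_def]
  show "z \<in> A" by (rule *[THEN conjunct1])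
  show "u \<in> A" by (rule *[THEN conjunct2, THEN conjunct1])
  show "z \<noteq> u" by (rule *[THEN conjunct2, THEN conjunct2, THEN conjunct1])
  show "a \<in> A \<Longrightarrow> p z a = a"
    by (rule *[THEN conjunct2, THEN conjunct2, THEN conjunct2, THEN conjunct1, THEN bspec, THEN conjunct1])
  show "a \<in> A \<Longrightarrow> t z a = z"
    by (rule *[THEN conjunct2, THEN conjunct2, THEN conjunct2, THEN conjunct1, THEN bspec, THEN conjunct2, THEN conjunct1])
  show "a \<in> A \<Longrightarrow> t u a = a"
    by (rule *[THEN conjunct2, THEN conjunct2, THEN conjunct2, THEN conjunct1, THEN bspec, THEN conjunct2, THEN conjunct2, THEN conjunct1])
  show "a \<in> A \<Longrightarrow> a = z \<or> (\<exists>k\<in>A. a = p k u)"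
    by (rule *[THEN conjunct2, THEN conjunct2, THEN conjunct2, THEN conjunct1, THEN bspec, THEN conjunct2, THEN conjunct2, THEN conjunct2])
  show "a \<in> A \<Longrightarrow> b \<in> A \<Longrightarrow> p a b \<in> A"
    by (rule *[THEN conjunct2, THEN conjunct2, THEN conjunct2, THEN conjunct2, THEN conjunct1, THEN bspec, THEN bspec, THEN conjunct1])
  show "a \<in> A \<Longrightarrow> b \<in> A \<Longrightarrow> t a b \<in> A"
    by (rule *[THEN conjunct2, THEN conjunct2, THEN conjunct2, THEN conjunct2, THEN conjunct1, THEN bspec, THEN bspec, THEN conjunct2, THEN conjunct1])
  show "a \<in> A \<Longrightarrow> b \<in> A \<Longrightarrow> p a b = p b a"
    by (rule *[THEN conjunct2, THEN conjunct2, THEN conjunct2, THEN conjunct2, THEN conjunct1, THEN bspec, THEN bspec, THEN conjunct2, THEN conjunct2, THEN conjunct1])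
  show "a \<in> A \<Longrightarrow> b \<in> A \<Longrightarrow> t a b = t b a"
    by (rule *[THEN conjunct2, THEN conjunct2, THEN conjunct2, THEN conjunct2, THEN conjunct1, THEN bspec, THEN bspec, THEN conjunct2, THEN conjunct2, THEN conjunct2, THEN conjunct1])
  show "a \<in> A \<Longrightarrow> b \<in> A \<Longrightarrow> p a b = z \<longrightarrow> a = z"
    by (rule *[THEN conjunct2, THEN conjunct2, THEN conjunct2, THEN conjunct2, THEN conjunct1, THEN bspec, THEN bspec, THEN conjunct2, THEN conjunct2, THEN conjunct2, THEN conjunct2, THEN conjunct1])
  show "a \<in> A \<Longrightarrow> b \<in> A \<Longrightarrow> (\<exists>k\<in>A. b = p a k) \<or> (\<exists>k\<in>A. a = p b k)"
    by (rule *[THEN conjunct2, THEN conjunct2, THEN conjunct2, THEN conjunct2, THEN conjunct1, THEN bspec, THEN bspec, THEN conjunct2, THEN conjunct2, THEN conjunct2, THEN conjunct2, THEN conjunct2])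
  show "a \<in> A \<Longrightarrow> b \<in> A \<Longrightarrow> c \<in> A \<Longrightarrow> p (p a b) c = p a (p b c)"
    by (rule *[THEN conjunct2, THEN conjunct2, THEN conjunct2, THEN conjunct2, THEN conjunct2, THEN bspec, THEN bspec, THEN bspec, THEN conjunct1])
  show "a \<in> A \<Longrightarrow> b \<in> A \<Longrightarrow> c \<in> A \<Longrightarrow> t (t a b) c = t a (t b c)"
    by (rule *[THEN conjunct2, THEN conjunct2, THEN conjunct2, THEN conjunct2, THEN conjunct2, THEN bspec, THEN bspec, THEN bspec, THEN conjunct2, THEN conjunct1])
  show "a \<in> A \<Longrightarrow> b \<in> A \<Longrightarrow> c \<in> A \<Longrightarrow> t (p a b) c = p (t a c) (t b c)"
    by (rule *[THEN conjunct2, THEN conjunct2, THEN conjunct2, THEN conjunct2, THEN conjunct2, THEN bspec, THEN bspec, THEN bspec, THEN conjunct2, THEN conjunct2, THEN conjunct1])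
  show "a \<in> A \<Longrightarrow> b \<in> A \<Longrightarrow> c \<in> A \<Longrightarrow> p a b = p a c \<longrightarrow> b = c"
    by (rule *[THEN conjunct2, THEN conjunct2, THEN conjunct2, THEN conjunct2, THEN conjunct2, THEN bspec, THEN bspec, THEN bspec, THEN conjunct2, THEN conjunct2, THEN conjunct2])
qed

lemma (in aca_structure) semidom_on_D: "semidom_on (D N) ze on (\<lambda>a b. a \<oplus> b) (\<lambda>a b. a \<odot> b)"
proof -
  have "ze \<noteq> on" using plus_one_neq[of ze] on_eq by auto
  moreover have "(a \<oplus> b) \<odot> c = (a \<odot> c) \<oplus> (b \<odot> c)" if "a \<in> D N" "b \<in> D N" "c \<in> D N" for a b c
    using that distrib[of c a b] times_comm[of c] by simp
  ultimately show ?thesis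
    unfolding semidom_on_def
    by (intro conjI ballI impI zero_plus zero_times times_one zero_or_suc plus_comm times_comm
       linear plus_assoc times_assoc) (auto dest: plus_eq_zero plus_cancel)
qed


subsection \<open>The ordered semiring of a counter-model\<close>

text \<open>The numbers of one fixed counter-model are turned into a type, so that the type classes of
  ordered rings and fields apply to them. If there is no counter-model, then the type is a copy of
  the natural numbers, and nothing is claimed about it beyond its being an ordered semiring.\<close>

definition counter_model :: "tm set struct \<Rightarrow> bool" where
  "counter_model M \<longleftrightarrow> aca_structure M \<and>
    \<not> (truth M ((QF_AC_01 \<^bold>\<longrightarrow> closure_choice_nonempty) 0) \<and>
       truth M ((closure_choice_nonempty \<^bold>\<longrightarrow> closure_choice_positive_measure) 0) \<and>
       truth M ((closure_choice_positive_measure \<^bold>\<longrightarrow> cocode_1) 0))"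

definition CM :: "tm set struct" where "CM = (SOME M. counter_model M)"

text \<open>Some injection of the natural numbers into the carrier type of the model, for the case
  without a counter-model.\<close>

definition std :: "nat \<Rightarrow> tm set" where "std n = {Bv n}"

lemma inj_std: "inj std" by (auto simp: inj_def std_def)

definition "refuted \<longleftrightarrow> (\<exists>M. counter_model M)"
definition "mN = (if refuted then dom CM N else range std)"
definition "mzero = (if refuted then cst CM Zero else std 0)"
definition "mone = (if refuted then cst CM One else std 1)"
definition "mplus a b = (if refuted then app CM (app CM (cst CM Plus) a) b else std (inv std a + inv std b))"
definition "mtimes a b = (if refuted then app CM (app CM (cst CM Times) a) b else std (inv std a * inv std b))"

lemma aca_structure_CM: "refuted \<Longrightarrow> aca_structure CM"
proof -
  assume refuted
  then have "counter_model CM" unfolding refuted_def CM_def by (rule someI_ex)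
  then show ?thesis by (simp add: counter_model_def)
qed

lemma semidom_on_std:
  "semidom_on (range std) (std 0) (std 1) (\<lambda>a b. std (inv std a + inv std b)) (\<lambda>a b. std (inv std a * inv std b))"
proof -
  have "n = 0 \<or> (\<exists>k. n = Suc k)" for n by (cases n) auto
  moreover have "(\<exists>k. n = m + k) \<or> (\<exists>k. m = n + k)" for m n :: nat
    using nat_le_linear[of m n] by (auto simp: nat_le_iff_add)
  ultimately show ?thesis
    by (simp add: semidom_on_def inv_f_f[OF inj_std] inj_eq[OF inj_std] algebra_simps)
qed

lemma semidom_on_mN: "semidom_on mN mzero mone mplus mtimes"
proof (cases refuted)
  case True
  then interpret aca_structure CM by (rule aca_structure_CM)
  show ?thesis using semidom_on_D True
    by (simp add: mN_def mzero_def mone_def mplus_def[abs_def] mtimes_def[abs_def])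
next
  case False
  then show ?thesis using semidom_on_std
    by (simp add: mN_def mzero_def mone_def mplus_def[abs_def] mtimes_def[abs_def])
qed

lemmas mN = semidom_onD[OF semidom_on_mN]

typedef mnat = mN
  using mN(1) by blast

setup_lifting type_definition_mnat

instantiation mnat :: linordered_semidom
begin

lift_definition zero_mnat :: mnat is mzero by (rule mN)
lift_definition one_mnat :: mnat is mone by (rule mN)
lift_definition plus_mnat :: "mnat \<Rightarrow> mnat \<Rightarrow> mnat" is mplus
  by (rule mN)
lift_definition times_mnat :: "mnat \<Rightarrow> mnat \<Rightarrow> mnat" is mtimes
  by (rule mN)

definition less_eq_mnat_def: "(a::mnat) \<le> b \<longleftrightarrow> (\<exists>k. b = a + k)"
definition less_mnat_def: "(a::mnat) < b \<longleftrightarrow> a \<le> b \<and> a \<noteq> b"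
definition minus_mnat_def: "(a::mnat) - b = (if b \<le> a then THE k. a = b + k else 0)"

instance
proof -
  have assoc: "a + b + c = a + (b + c)" for a b c :: mnat by transfer (rule mN(14))
  have comm: "a + b = b + a" for a b c :: mnat by transfer (rule mN(10))
  have zero: "0 + a = a" for a b c :: mnat by transfer (rule mN(4))
  have tassoc: "a * b * c = a * (b * c)" for a b c :: mnat by transfer (rule mN(15))
  have tcomm: "a * b = b * a" for a b c :: mnat by transfer (rule mN(11))
  have tzero: "0 * a = 0" for a b c :: mnat by transfer (rule mN(5))
  have tone: "1 * a = a" for a b c :: mnat by transfer (rule mN(6))
  have distr: "(a + b) * c = a * c + b * c" for a b c :: mnat by transfer (rule mN(16))
  have z_o: "(0::mnat) \<noteq> 1" by transfer (rule mN(3))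
  have lin: "(\<exists>k. b = a + k) \<or> (\<exists>k. a = b + k)" for a b c :: mnat by transfer (use mN(13) in simp)
  have pos: "a = 0 \<or> (\<exists>k. a = k + 1)" for a b c :: mnat by transfer (use mN(7) in simp)
  have canc: "a + b = a + c \<Longrightarrow> b = c" for a b c :: mnat by transfer (use mN(17) in blast)
  have sum0: "a + b = 0 \<Longrightarrow> a = 0" for a b :: mnat by transfer (use mN(12) in blast)
  have diff: "a + k - a = k" for a k :: mnat
  proof -
    have "(THE j. a + k = a + j) = k" by (rule the_equality) (auto dest: canc)
    moreover have "a \<le> a + k" by (auto simp: less_eq_mnat_def)
    ultimately show ?thesis by (simp add: minus_mnat_def)
  qed
  have zero': "a + 0 = a" for a :: mnat using zero[of a] comm[of a 0] by simp
  have distr': "c * (a + b) = c * a + c * b" for a b c :: mnat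
    using distr[of a b c] by (simp only: tcomm[of _ c])
  have lcomm: "a + (b + c) = b + (a + c)" for a b c :: mnat
    using assoc[of a b c] assoc[of b a c] comm[of a b] by simp
  have strict: "a < b \<longleftrightarrow> (\<exists>k. b = a + (k + 1))" for a b :: mnat
  proof
    assume "a < b"
    then obtain k where "b = a + k" "a \<noteq> b" by (auto simp: less_mnat_def less_eq_mnat_def)
    then show "\<exists>k. b = a + (k + 1)" using pos[of k] zero' by auto
  next
    assume "\<exists>k. b = a + (k + 1)"
    then obtain k where k: "b = a + (k + 1)" by blast
    have "a \<noteq> b"
    proof
      assume "a = b"
      then have "a + (k + 1) = a + 0" using k zero' by simp
      then have "k + 1 = 0" by (rule canc)
      then have "1 + k = 0" by (simp add: comm)
      then have "(1::mnat) = 0" by (rule sum0)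
      then show False using z_o by simp
    qed
    then show "a < b" using k by (auto simp: less_mnat_def less_eq_mnat_def)
  qed
  have nonneg: "0 \<le> a" for a :: mnat by (auto simp: less_eq_mnat_def zero)
  have antisym: "a \<le> b \<Longrightarrow> b \<le> a \<Longrightarrow> a = b" for a b :: mnat
  proof -
    assume "a \<le> b" "b \<le> a"
    then obtain k j where kj: "b = a + k" "a = b + j" by (auto simp: less_eq_mnat_def)
    then have "a + (k + j) = a + 0" by (simp add: zero' assoc[symmetric])
    then have "k = 0" using canc sum0 by blast
    then show "a = b" using kj zero' by simp
  qed
  have strict_times: "a < b \<Longrightarrow> 0 < c \<Longrightarrow> c * a < c * b" for a b c :: mnat
  proof -
    assume "a < b" "0 < c"
    then obtain k j where "b = a + (k + 1)" "c = j + 1" by (auto simp: strict zero)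
    then have "c * b = c * a + ((j * (k + 1) + k) + 1)"
      using lcomm[of k j 1] tcomm[of j 1] by (simp add: distr distr' tone assoc)
    then show ?thesis using strict by blast
  qed
  have no_zero: "a \<noteq> 0 \<Longrightarrow> b \<noteq> 0 \<Longrightarrow> a * b \<noteq> 0" for a b :: mnat
    using strict_times[of 0 b a] nonneg tcomm[of a 0] tzero[of a] by (auto simp: less_mnat_def)
  show "OFCLASS(mnat, linordered_semidom_class)"
  proof
    fix a b c :: mnat
    show "a + b + c = a + (b + c)" "a + b = b + a" "0 + a = a" "a * b * c = a * (b * c)"
      "a * b = b * a" "0 * a = 0" "1 * a = a" "(a + b) * c = a * c + b * c" "(0::mnat) \<noteq> 1"
      by (fact assoc comm zero tassoc tcomm tzero tone distr z_o)+
    show "a * (b + c) = a * b + a * c" by (rule distr')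
    show "a * 0 = 0" using tzero tcomm by metis
    show "a + b - a = b" by (rule diff)
    \<comment> \<open>Subtraction is truncated, so one has to distinguish whether
      \<open>b + c\<close>, or at least \<open>b\<close>, can be subtracted from \<open>a\<close>;
      otherwise both sides are 0.\<close>
    show "a - b - c = a - (b + c)"
    proof (cases "b + c \<le> a")
      case True
      then obtain k where "a = b + (c + k)" by (auto simp: less_eq_mnat_def assoc)
      then show ?thesis using diff[of b "c + k"] diff[of c k] diff[of "b + c" k] by (simp add: assoc)
    next
      case False
      show ?thesis
      proof (cases "b \<le> a")
        case True
        then obtain k where k: "a = b + k" by (auto simp: less_eq_mnat_def)
        then have "\<not> c \<le> k" using False by (auto simp: less_eq_mnat_def assoc)
        then show ?thesis using False k diff[of b k] by (simp add: minus_mnat_def)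
      next
        case False2: False
        have "0 - c = (0::mnat)"
        proof (cases "c \<le> 0")
          case True
          then have "c = 0" using antisym nonneg by blast
          then show ?thesis using diff[of 0 0] zero by simp
        qed (simp add: minus_mnat_def)
        then show ?thesis using False False2 by (simp add: minus_mnat_def)
      qed
    qed
    show "a * (b - c) = a * b - a * c"
    proof (cases "c \<le> b")
      case True
      then obtain k where "b = c + k" by (auto simp: less_eq_mnat_def)
      then show ?thesis using diff[of c k] diff[of "a * c" "a * k"] by (simp add: distr')
    next
      case False
      then obtain k where k: "c = b + k" using lin[of b c] by (auto simp: less_eq_mnat_def)
      have "x - (x + y) = 0" for x y :: mnat
      proof (cases "x + y \<le> x")
        case True
        moreover have "x \<le> x + y" by (auto simp: less_eq_mnat_def)
        ultimately have "x + y = x" by (rule antisym)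
        then show ?thesis using diff[of x 0] by (simp add: zero')
      qed (simp add: minus_mnat_def)
      from this[of b k] this[of "a * b" "a * k"] k show ?thesis
        using tzero[of a] tcomm[of a 0] by (simp add: distr')
    qed
    show "a \<noteq> 0 \<Longrightarrow> b \<noteq> 0 \<Longrightarrow> a * b \<noteq> 0" by (rule no_zero)
    show "a \<le> a" unfolding less_eq_mnat_def by (rule exI[of _ "0 :: mnat"]) (simp add: zero')
    show "a < b \<longleftrightarrow> a \<le> b \<and> \<not> b \<le> a" using antisym by (auto simp: less_mnat_def)
    show "a \<le> b \<Longrightarrow> b \<le> c \<Longrightarrow> a \<le> c" by (auto simp: less_eq_mnat_def assoc)
    show "a \<le> b \<Longrightarrow> b \<le> a \<Longrightarrow> a = b" by (rule antisym)
    show "a \<le> b \<or> b \<le> a" using lin by (auto simp: less_eq_mnat_def)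
    show "a \<le> b \<Longrightarrow> c + a \<le> c + b" by (auto simp: less_eq_mnat_def assoc)
    show "a < b \<Longrightarrow> 0 < c \<Longrightarrow> c * a < c * b" by (rule strict_times)
    show "(0::mnat) < 1" using z_o nonneg by (simp add: less_mnat_def)
    show "b \<le> a \<Longrightarrow> a - b + b = a"
    proof -
      assume "b \<le> a"
      then obtain k where "a = b + k" by (auto simp: less_eq_mnat_def)
      then show ?thesis using diff[of b k] comm[of k b] by simp
    qed
  qed
qed

end

lemma mnat_cases: "(a::mnat) = 0 \<or> (\<exists>k. a = k + 1)"
  by transfer (use mN(7) in simp)

lemma mnat_nonneg [simp]: "0 \<le> (a::mnat)"
  by (simp add: less_eq_mnat_def)

lemma mnat_less_iff: "(a::mnat) < b \<longleftrightarrow> (\<exists>k. b = a + (k + 1))"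
proof
  assume "a < b"
  then have b: "b = a + (b - a)" by (simp add: less_imp_le)
  with \<open>a < b\<close> have "b - a \<noteq> 0" by (metis add.right_neutral less_irrefl)
  with b show "\<exists>k. b = a + (k + 1)" using mnat_cases[of "b - a"] by metis
next
  assume "\<exists>k. b = a + (k + 1)"
  then show "a < b" by (auto simp: add_nonneg_pos)
qed

lemma mnat_less_Suc: "(a::mnat) < b + 1 \<longleftrightarrow> a \<le> b"
  by (auto simp: mnat_less_iff less_eq_mnat_def add.assoc[symmetric])

lemma mnat_Suc_le: "(a::mnat) + 1 \<le> b \<longleftrightarrow> a < b"
  using mnat_less_Suc[of b a] by (simp add: not_less[symmetric])


section \<open>The integers of the counter-model, as differences of its numbers\<close>

definition mint_rel :: "mnat \<times> mnat \<Rightarrow> mnat \<times> mnat \<Rightarrow> bool" where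
  "mint_rel = (\<lambda>(x, y) (u, v). x + v = u + y)"

lemma mint_rel: "equivp mint_rel"
proof (rule equivpI)
  show "reflp mint_rel" by (auto simp: reflp_def mint_rel_def)
  show "symp mint_rel" by (auto simp: symp_def mint_rel_def)
  show "transp mint_rel"
  proof (rule transpI, clarsimp simp: mint_rel_def)
    fix x y u v s t :: mnat assume "x + v = u + y" "u + t = s + v"
    then have "(x + v) + (u + t) = (u + y) + (s + v)" by simp
    then have "(x + t) + (u + v) = (s + y) + (u + v)" by (simp only: ac_simps)
    then show "x + t = s + y" by simp
  qed
qed

quotient_type mint = "mnat \<times> mnat" / mint_rel
  by (rule mint_rel)

lemma mint_plus_cong:
  fixes x y u v p q r s :: mnat
  assumes "x + v = u + y" "p + s = r + q"
  shows "(x + p) + (v + s) = (u + r) + (y + q)"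
proof -
  have "(x + p) + (v + s) = (x + v) + (p + s)" by (simp only: ac_simps)
  also have "\<dots> = (u + r) + (y + q)" unfolding assms by (simp only: ac_simps)
  finally show ?thesis .
qed

text \<open>The hypotheses relate sums, so they are first multiplied by the four factors. Adding
  \<open>v * p + u * q + u * p + v * q\<close> to both sides completes the products to sums that can
  be exchanged; cancellation removes it again.\<close>

lemma mint_mult_cong:
  fixes x y u v p q r s :: mnat
  assumes "x + v = u + y" "p + s = r + q"
  shows "(x * p + y * q) + (u * s + v * r) = (u * r + v * s) + (x * q + y * p)"
proof -
  have 1: "x * p + v * p = u * p + y * p" "u * q + y * q = x * q + v * q"
    using assms(1) by (simp_all flip: distrib_right)
  have 2: "u * p + u * s = u * r + u * q" "v * r + v * q = v * p + v * s"
    using assms(2) by (simp_all flip: distrib_left)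
  have "(x * p + y * q + (u * s + v * r)) + (v * p + u * q + u * p + v * q)
      = (x * p + v * p) + (u * q + y * q) + (u * p + u * s) + (v * r + v * q)"
    by (simp only: ac_simps)
  also have "\<dots> = (u * p + y * p) + (x * q + v * q) + (u * r + u * q) + (v * p + v * s)"
    unfolding 1 2 ..
  also have "\<dots> = (u * r + v * s + (x * q + y * p)) + (v * p + u * q + u * p + v * q)"
    by (simp only: ac_simps)
  finally show ?thesis by (rule add_right_imp_eq)
qed

instantiation mint :: comm_ring_1
begin

lift_definition zero_mint :: mint is "(0, 0)" .
lift_definition one_mint :: mint is "(1, 0)" .
lift_definition plus_mint :: "mint \<Rightarrow> mint \<Rightarrow> mint" is "\<lambda>(x, y) (u, v). (x + u, y + v)"
  by (clarsimp simp: mint_rel_def) (rule mint_plus_cong)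
lift_definition uminus_mint :: "mint \<Rightarrow> mint" is "\<lambda>(x, y). (y, x)"
  by (clarsimp simp: mint_rel_def) (simp add: add.commute)
lift_definition minus_mint :: "mint \<Rightarrow> mint \<Rightarrow> mint" is "\<lambda>(x, y) (u, v). (x + v, y + u)"
  by (clarsimp simp: mint_rel_def) (rule mint_plus_cong, simp_all add: add.commute)
lift_definition times_mint :: "mint \<Rightarrow> mint \<Rightarrow> mint"
  is "\<lambda>(x, y) (u, v). (x * u + y * v, x * v + y * u)"
  by (clarsimp simp: mint_rel_def) (rule mint_mult_cong)

instance
  by standard (transfer; clarsimp simp: mint_rel_def algebra_simps)+

end

lemma mint_mult_less:
  fixes x y u v s t :: mnat
  assumes "x + v < u + y" "t < s"
  shows "s * x + t * y + (s * v + t * u) < s * u + t * v + (s * y + t * x)"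
proof -
  obtain k where "s = t + (k + 1)" using assms(2) by (auto simp: mnat_less_iff)
  moreover have "(k + 1) * (x + v) < (k + 1) * (u + y)"
    using assms(1) by (intro mult_strict_left_mono) (simp_all add: add_nonneg_pos)
  then have "(k + 1) * (x + v) + t * (x + v + u + y) < (k + 1) * (u + y) + t * (x + v + u + y)"
    by (rule add_strict_right_mono)
  ultimately show ?thesis by (simp add: algebra_simps)
qed

instantiation mint :: linordered_idom
begin

lift_definition less_eq_mint :: "mint \<Rightarrow> mint \<Rightarrow> bool" is "\<lambda>(x, y) (u, v). x + v \<le> u + y"
proof clarsimp
  fix x y x' y' u v u' v' :: mnat
  assume *: "mint_rel (x, y) (x', y')" "mint_rel (u, v) (u', v')"
  then have eq: "x + y' = x' + y" "u + v' = u' + v" by (auto simp: mint_rel_def)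
  have "x + v \<le> u + y \<longleftrightarrow> (x + y') + (v + v') \<le> (u + v') + (y + y')"
    using add_le_cancel_right[of "x + v" "y' + v'" "u + y"] by (simp only: ac_simps)
  also have "\<dots> \<longleftrightarrow> (x' + v') + (y + v) \<le> (u' + y') + (y + v)"
    unfolding eq by (simp only: ac_simps)
  finally show "x + v \<le> u + y \<longleftrightarrow> x' + v' \<le> u' + y'" by simp
qed

definition less_mint_def: "(a::mint) < b \<longleftrightarrow> a \<le> b \<and> \<not> b \<le> a"
definition mint_abs_def: "\<bar>a::mint\<bar> = (if a < 0 then - a else a)"
definition sgn_mint_def: "sgn (a::mint) = (if a = 0 then 0 else if 0 < a then 1 else - 1)"

instance
proof
  fix a b c :: mint
  show "a < b \<longleftrightarrow> a \<le> b \<and> \<not> b \<le> a" by (rule less_mint_def)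
  show "a \<le> a" by transfer auto
  show "a \<le> b \<Longrightarrow> b \<le> c \<Longrightarrow> a \<le> c"
  proof (transfer, clarsimp)
    fix x y u v s t :: mnat assume "x + v \<le> u + y" "u + t \<le> s + v"
    then have "(x + v) + (u + t) \<le> (u + y) + (s + v)" by (rule add_mono)
    then have "(x + t) + (u + v) \<le> (s + y) + (u + v)" by (simp only: ac_simps)
    then show "x + t \<le> s + y" by simp
  qed
  show "a \<le> b \<Longrightarrow> b \<le> a \<Longrightarrow> a = b" by transfer (auto simp: mint_rel_def)
  show "a \<le> b \<or> b \<le> a" by transfer auto
  show "a \<le> b \<Longrightarrow> c + a \<le> c + b"
  proof (transfer, clarsimp)
    fix x y u v s t :: mnat assume "x + v \<le> u + y"
    then have "(x + v) + (s + t) \<le> (u + y) + (s + t)" by simp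
    then show "s + x + (t + v) \<le> s + u + (t + y)" by (simp only: ac_simps)
  qed
  show "\<bar>a\<bar> = (if a < 0 then - a else a)" by (rule mint_abs_def)
  show "sgn a = (if a = 0 then 0 else if 0 < a then 1 else - 1)" by (rule sgn_mint_def)
  show "a < b \<Longrightarrow> 0 < c \<Longrightarrow> c * a < c * b"
    unfolding less_mint_def
    by (transfer, clarsimp simp: not_le, rule conjI, rule less_imp_le)
      (rule mint_mult_less; force simp: less_le)+
qed

end

section \<open>The rationals of the counter-model, as the fraction field of its integers\<close>

type_synonym mrat = "mint fract"

definition mint_of :: "mnat \<Rightarrow> mint" where "mint_of n = abs_mint (n, 0)"

lemma mint_of_transfer [transfer_rule]: "rel_fun (=) pcr_mint (\<lambda>n. (n, 0)) mint_of"
  by (auto simp: rel_fun_def mint_of_def mint.pcr_cr_eq cr_mint_def)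

definition q_of :: "mnat \<Rightarrow> mrat" where "q_of n = Fract (mint_of n) 1"

lemma mint_of_simps: "mint_of 0 = 0" "mint_of 1 = 1" "mint_of (a + b) = mint_of a + mint_of b"
    "mint_of (a * b) = mint_of a * mint_of b" "mint_of a = mint_of b \<longleftrightarrow> a = b"
    "mint_of a \<le> mint_of b \<longleftrightarrow> a \<le> b"
  by (transfer; simp add: mint_rel_def)+

lemma q_of_simps [simp]: "q_of 0 = 0" "q_of 1 = 1" "q_of (a + b) = q_of a + q_of b"
    "q_of (a * b) = q_of a * q_of b" "q_of a = q_of b \<longleftrightarrow> a = b" "q_of a \<le> q_of b \<longleftrightarrow> a \<le> b"
    "q_of a < q_of b \<longleftrightarrow> a < b"
proof -
  show eq: "q_of a = q_of b \<longleftrightarrow> a = b" and le: "q_of a \<le> q_of b \<longleftrightarrow> a \<le> b"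
    by (simp_all add: q_of_def mint_of_simps eq_fract)
  show "q_of a < q_of b \<longleftrightarrow> a < b" unfolding less_le eq le ..
qed (simp_all add: q_of_def mint_of_simps Zero_fract_def One_fract_def)

lemma q_of_nonneg [simp]: "0 \<le> q_of a"
  using q_of_simps(6)[of 0 a] by simp

text \<open>That one of the two parts vanishes is required by the coding of rationals, where the
  parity of a component stores the sign; see \<open>rat_of_surj\<close>.\<close>

lemma mint_cases: "\<exists>p n. (p = 0 \<or> n = 0) \<and> c = mint_of p - mint_of n"
proof (cases "0 \<le> c")
  case True
  then have "\<exists>p. c = mint_of p"
  proof (transfer, clarsimp simp: mint_rel_def)
    fix x y :: mnat assume "y \<le> x"
    then show "\<exists>p. x = p + y" by (metis less_eq_mnat_def add.commute)
  qed
  then show ?thesis by (metis diff_zero mint_of_simps(1))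
next
  case False
  then have "0 \<le> - c" by simp
  then have "\<exists>p. - c = mint_of p"
  proof (transfer, clarsimp simp: mint_rel_def)
    fix x y :: mnat assume "x \<le> y"
    then show "\<exists>p. y = p + x" by (metis less_eq_mnat_def add.commute)
  qed
  then show ?thesis by (metis diff_0 minus_minus mint_of_simps(1))
qed

lemma Fract_cases_pos: obtains a b where "q = Fract a b" "0 < (b :: 'a :: linordered_idom)"
proof (cases q)
  case (Fract a b)
  show ?thesis
  proof (cases "0 < b")
    case True
    with Fract show ?thesis using that by blast
  next
    case False
    then have "0 < - b" "q = Fract (- a) (- b)" using Fract by (simp_all add: eq_fract)
    then show ?thesis using that by blast
  qed
qed

lemma mrat_cases: "\<exists>p n d. 0 < d \<and> (p = 0 \<or> n = 0) \<and> q = (q_of p - q_of n) / q_of d"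
proof -
  obtain a b where q: "q = Fract a b" and "b > 0" by (cases q rule: Fract_cases_pos)
  obtain p n where pn: "p = 0 \<or> n = 0" "a = mint_of p - mint_of n" using mint_cases by blast
  obtain d d' where d: "d = 0 \<or> d' = 0" "b = mint_of d - mint_of d'" using mint_cases by blast
  have "d' = 0"
  proof (rule ccontr)
    assume "d' \<noteq> 0"
    then have "b = - mint_of d'" using d by (simp add: mint_of_simps)
    then have "mint_of d' < mint_of 0" using \<open>b > 0\<close> by (simp add: mint_of_simps)
    then show False by (metis leD mint_of_simps(6) mnat_nonneg)
  qed
  then have b: "b = mint_of d" using d by (simp add: mint_of_simps)
  then have "d \<noteq> 0" using \<open>b > 0\<close> by (auto simp: mint_of_simps)
  then have "0 < d" using mnat_nonneg[of d] by (simp add: less_le)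
  moreover have "q = (q_of p - q_of n) / q_of d"
    using q pn b by (simp add: q_of_def)
  ultimately show ?thesis using pn by blast
qed


section \<open>Arithmetical comprehension in the counter-model\<close>

locale refutation =
  assumes refuted: refuted

sublocale refutation \<subseteq> aca_structure CM
  using refuted by (rule aca_structure_CM)

context refutation
begin

abbreviation cm_ap (infixl "$$" 90) where "f $$ x \<equiv> app CM f x"
abbreviation cm_pl (infixl "\<oplus>" 65) where "a \<oplus> b \<equiv> cst CM Plus $$ a $$ b"
abbreviation cm_ti (infixl "\<odot>" 70) where "a \<odot> b \<equiv> cst CM Times $$ a $$ b"

abbreviation "nu \<equiv> Rep_mnat"
abbreviation "nm \<equiv> Abs_mnat"

lemma mN_eq: "mN = D N" using refuted by (simp add: mN_def)

lemma nu_D [simp]: "nu n \<in> D N" using Rep_mnat[of n] by (simp add: mN_eq)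

lemma nu_nm [simp]: "u \<in> D N \<Longrightarrow> nu (nm u) = u" using Abs_mnat_inverse[of u] by (simp add: mN_eq)

lemma nm_nu [simp]: "nm (nu n) = n" by (rule Rep_mnat_inverse)

lemma nu_eq [simp]: "nu a = nu b \<longleftrightarrow> a = b" by (rule Rep_mnat_inject)

lemma nu_zero: "nu 0 = ze" and nu_one: "nu 1 = on"
  and nu_plus: "nu (a + b) = nu a \<oplus> nu b" and nu_times: "nu (a * b) = nu a \<odot> nu b"
  using refuted zero_mnat.rep_eq one_mnat.rep_eq plus_mnat.rep_eq times_mnat.rep_eq
  by (simp_all add: mzero_def mone_def mplus_def mtimes_def)

lemma ball_D: "(\<forall>u\<in>D N. P u) \<longleftrightarrow> (\<forall>n. P (nu n))"
  by (metis nu_D nu_nm)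

lemma bex_D: "(\<exists>u\<in>D N. P u) \<longleftrightarrow> (\<exists>n. P (nu n))"
  by (metis nu_D nu_nm)

lemma lss_nu: "lss CM (nu a) (nu b) \<longleftrightarrow> a < b"
  by (simp add: lss_iff bex_D mnat_less_iff nu_plus[symmetric] nu_one[symmetric])

section \<open>The calculus of definability over the type of numbers\<close>

definition fapp :: "tm set \<Rightarrow> mnat \<Rightarrow> mnat" (infixl "@@" 90) where "f @@ n = nm (f $$ nu n)"

lemma nu_fapp: "f \<in> D ty1 \<Longrightarrow> nu (f @@ n) = f $$ nu n"
  unfolding fapp_def by (rule nu_nm) (rule app_dom[OF _ nu_D])

definition Fapp :: "tm set \<Rightarrow> tm set \<Rightarrow> mnat" (infixl "@@@" 90) where "F @@@ f = nm (F $$ f)"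

lemma nu_Fapp: "F \<in> D ty2 \<Longrightarrow> f \<in> D ty1 \<Longrightarrow> nu (F @@@ f) = F $$ f"
  unfolding Fapp_def by (rule nu_nm) (rule app_dom)

definition ndf :: "ty list \<Rightarrow> ((nat \<Rightarrow> tm set) \<Rightarrow> mnat) \<Rightarrow> bool" where
  "ndf \<Gamma> F \<longleftrightarrow> dfn \<Gamma> N (\<lambda>e. nu (F e))"

lemma ndf_cong: "ndf \<Gamma> F \<Longrightarrow> (\<And>e. env \<Gamma> e \<Longrightarrow> F e = G e) \<Longrightarrow> ndf \<Gamma> G"
  unfolding ndf_def by (erule dfn.agree) simp

lemma ndf_const: "ndf \<Gamma> (\<lambda>e. c)"
  unfolding ndf_def by (rule dfn.par) simp

lemma ndf_nm: "dfn \<Gamma> N F \<Longrightarrow> ndf \<Gamma> (\<lambda>e. nm (F e))"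
proof -
  assume F: "dfn \<Gamma> N F"
  show ?thesis unfolding ndf_def by (rule dfn.agree[OF F]) (simp add: dfn_D[OF F])
qed

lemma ndf_var: "i < length \<Gamma> \<Longrightarrow> \<Gamma> ! i = N \<Longrightarrow> ndf \<Gamma> (\<lambda>e. nm (e i))"
  by (rule ndf_nm[OF dfn.var])

lemma ndf_plus: "ndf \<Gamma> F \<Longrightarrow> ndf \<Gamma> G \<Longrightarrow> ndf \<Gamma> (\<lambda>e. F e + G e)"
  unfolding ndf_def nu_plus by (rule dfn_plus)

lemma ndf_times: "ndf \<Gamma> F \<Longrightarrow> ndf \<Gamma> G \<Longrightarrow> ndf \<Gamma> (\<lambda>e. F e * G e)"
  unfolding ndf_def nu_times by (rule dfn_times)

lemma ndf_fapp: "dfn \<Gamma> ty1 F \<Longrightarrow> ndf \<Gamma> G \<Longrightarrow> ndf \<Gamma> (\<lambda>e. F e @@ G e)"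
  unfolding fapp_def by (rule ndf_nm, rule dfn.app) (auto simp: ndf_def)

lemma ndf_Fapp: "dfn \<Gamma> ty2 F \<Longrightarrow> dfn \<Gamma> ty1 G \<Longrightarrow> ndf \<Gamma> (\<lambda>e. F e @@@ G e)"
  unfolding Fapp_def by (rule ndf_nm, rule dfn.app)

lemma dfn_nu: "ndf \<Gamma> F \<Longrightarrow> dfn \<Gamma> N (\<lambda>e. nu (F e))"
  by (simp add: ndf_def)

lemma ndec_eq: "ndf \<Gamma> F \<Longrightarrow> ndf \<Gamma> G \<Longrightarrow> dec \<Gamma> (\<lambda>e. F e = G e)"
  using dec_eq[of \<Gamma> "\<lambda>e. nu (F e)" "\<lambda>e. nu (G e)"] by (simp add: ndf_def)

lemma ndec_less: "ndf \<Gamma> F \<Longrightarrow> ndf \<Gamma> G \<Longrightarrow> dec \<Gamma> (\<lambda>e. F e < G e)"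
  using dec_lss[of \<Gamma> "\<lambda>e. nu (F e)" "\<lambda>e. nu (G e)"] by (simp add: ndf_def lss_nu)

lemma ndec_le: "ndf \<Gamma> F \<Longrightarrow> ndf \<Gamma> G \<Longrightarrow> dec \<Gamma> (\<lambda>e. F e \<le> G e)"
  using dec_not[OF ndec_less[of \<Gamma> G F]] by (simp add: not_less)

lemma ndec_all:
  assumes "dec (N # \<Gamma>) (\<lambda>e. P (nm (e 0)) (\<lambda>i. e (Suc i)))"
  shows "dec \<Gamma> (\<lambda>e. \<forall>n. P n e)"
proof -
  have "dec \<Gamma> (\<lambda>e. \<forall>u\<in>D N. P (nm u) e)" by (rule dec_all) (rule assms)
  then show ?thesis by (simp add: ball_D)
qed

lemma ndec_ex:
  assumes "dec (N # \<Gamma>) (\<lambda>e. P (nm (e 0)) (\<lambda>i. e (Suc i)))"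
  shows "dec \<Gamma> (\<lambda>e. \<exists>n. P n e)"
proof -
  have "dec \<Gamma> (\<lambda>e. \<exists>u\<in>D N. P (nm u) e)" by (rule dec_ex) (rule assms)
  then show ?thesis by (simp add: bex_D)
qed

definition nmu :: "(mnat \<Rightarrow> bool) \<Rightarrow> mnat" where "nmu P = nm (mu (\<lambda>u. P (nm u)))"

lemma ndf_mu:
  "dec (N # \<Gamma>) (\<lambda>e. P (nm (e 0)) (\<lambda>i. e (Suc i))) \<Longrightarrow> ndf \<Gamma> (\<lambda>e. nmu (\<lambda>n. P n e))"
  unfolding nmu_def by (rule ndf_nm, rule dfn_mu)

lemma nmu: "dec [N] (\<lambda>e. P (nm (e 0))) \<Longrightarrow> P n \<Longrightarrow> P (nmu P)"
  unfolding nmu_def using mu_env[of "[]" "\<lambda>u e. P (nm u)" "\<lambda>_. ze" "nu n"] by simp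

lemma nmu_env:
  "dec (N # \<Gamma>) (\<lambda>e. P (nm (e 0)) (\<lambda>i. e (Suc i))) \<Longrightarrow> env \<Gamma> e \<Longrightarrow> P n e \<Longrightarrow> P (nmu (\<lambda>n. P n e)) e"
  unfolding nmu_def using mu_env[of \<Gamma> "\<lambda>u e. P (nm u) e" e "nu n"] by simp

text \<open>The type may contain non-standard numbers; each use therefore carries the obligation
  that the predicate is decidable in the model.\<close>

lemma minduct:
  assumes "dec [N] (\<lambda>e. P (nm (e 0)))" "P 0" "\<And>n. P n \<Longrightarrow> P (n + 1)"
  shows "P n"
proof -
  have "(\<lambda>u. P (nm u)) (nu n)"
  proof (rule induction[where P = "\<lambda>u. P (nm u)"])
    fix u assume u: "u \<in> D N" "P (nm u)"
    then have "nu (nm u + 1) = u \<oplus> on" by (simp add: nu_plus nu_one)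
    then have "nm (u \<oplus> on) = nm u + 1" using nm_nu[of "nm u + 1"] by simp
    then show "P (nm (u \<oplus> on))" using assms(3) u by simp
  qed (use assms nm_nu[of 0] in \<open>simp_all add: nu_zero\<close>)
  then show ?thesis by simp
qed

definition fun1 :: "(mnat \<Rightarrow> mnat) \<Rightarrow> tm set" where "fun1 F = lam N N (\<lambda>u. nu (F (nm u)))"

lemma dfn_fun1:
  "ndf (N # \<Gamma>) (\<lambda>e. F (nm (e 0)) (\<lambda>i. e (Suc i))) \<Longrightarrow> dfn \<Gamma> ty1 (\<lambda>e. fun1 (\<lambda>n. F n e))"
  unfolding fun1_def ndf_def by (rule dfn_lam)

lemma fun1_env:
  "ndf (N # \<Gamma>) (\<lambda>e. F (nm (e 0)) (\<lambda>i. e (Suc i))) \<Longrightarrow> env \<Gamma> e \<Longrightarrow> fun1 (\<lambda>n. F n e) @@ n = F n e"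
  unfolding fun1_def ndf_def fapp_def
  by (drule lam_app_env[of N \<Gamma> N "\<lambda>u e. nu (F (nm u) e)", OF _ _ nu_D, of e n]) simp_all

lemma fun1: "ndf [N] (\<lambda>e. F (nm (e 0))) \<Longrightarrow> fun1 F @@ n = F n"
  using fun1_env[of "[]" "\<lambda>n e. F n"] by simp

lemma fun1_D: "ndf [N] (\<lambda>e. F (nm (e 0))) \<Longrightarrow> fun1 F \<in> D ty1"
  using dfn_D[OF dfn_fun1[of "[]" "\<lambda>n e. F n"]] by simp

definition nrec :: "(mnat \<Rightarrow> mnat \<Rightarrow> mnat) \<Rightarrow> mnat \<Rightarrow> mnat \<Rightarrow> mnat" where
  "nrec G m n = nm (cst CM Rec $$ lam N ty1 (\<lambda>u. fun1 (G (nm u))) $$ nu m $$ nu n)"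

lemma dfn_rec_step:
  "ndf (N # N # \<Gamma>) (\<lambda>e. G (nm (e 1)) (nm (e 0)) (\<lambda>i. e (Suc (Suc i)))) \<Longrightarrow>
    dfn \<Gamma> (N \<rightarrow> ty1) (\<lambda>e. lam N ty1 (\<lambda>u. fun1 (\<lambda>c. G (nm u) c e)))"
  by (rule dfn_lam, rule dfn_fun1) simp

lemma ndf_rec:
  assumes "ndf (N # N # \<Gamma>) (\<lambda>e. G (nm (e 1)) (nm (e 0)) (\<lambda>i. e (Suc (Suc i))))" "ndf \<Gamma> F" "ndf \<Gamma> H"
  shows "ndf \<Gamma> (\<lambda>e. nrec (\<lambda>i c. G i c e) (F e) (H e))"
  unfolding nrec_def
  by (rule ndf_nm, rule dfn.app[OF dfn.app[OF dfn.app[OF dfn.par[OF Rec_D] dfn_rec_step] dfn_nu] dfn_nu])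
    (rule assms)+

lemma nrec_env:
  assumes G: "ndf (N # N # \<Gamma>) (\<lambda>e. G (nm (e 1)) (nm (e 0)) (\<lambda>i. e (Suc (Suc i))))" and e: "env \<Gamma> e"
  shows "nrec (\<lambda>i c. G i c e) m 0 = m"
    and "nrec (\<lambda>i c. G i c e) m (n + 1) = G n (nrec (\<lambda>i c. G i c e) m n) e"
proof -
  let ?g = "lam N ty1 (\<lambda>u. fun1 (\<lambda>c. G (nm u) c e))"
  have g: "?g \<in> D (N \<rightarrow> ty1)" by (rule dfn_D[OF dfn_rec_step[OF G] e])
  have "cst CM Rec $$ ?g $$ nu m \<in> D ty1" using Rec_D g app_dom nu_D by blast
  then have r: "cst CM Rec $$ ?g $$ nu m $$ nu n \<in> D N" by (rule app_dom) simp
  show "nrec (\<lambda>i c. G i c e) m 0 = m" unfolding nrec_def nu_zero using g by (simp add: Rec_zero)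
  have gn: "?g $$ nu n = fun1 (\<lambda>c. G n c e)"
  proof -
    have "dfn (N # \<Gamma>) ty1 (\<lambda>e. fun1 (\<lambda>c. G (nm (e 0)) c (\<lambda>i. e (Suc i))))"
      by (rule dfn_fun1) (use G in simp)
    from lam_app_env[OF this e nu_D] show ?thesis by simp
  qed
  have "fun1 (\<lambda>c. G n c e) @@ c = G n c e" for c
    using fun1_env[of "N # \<Gamma>" "\<lambda>c e. G (nm (e 0)) c (\<lambda>i. e (Suc i))" "case_nat (nu n) e" c] G e
    by (simp add: env_Cons)
  moreover have "nrec (\<lambda>i c. G i c e) m (n + 1) = fun1 (\<lambda>c. G n c e) @@ nrec (\<lambda>i c. G i c e) m n"
    unfolding nrec_def nu_plus nu_one fapp_def using Rec_suc[OF g nu_D nu_D] gn r by simp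
  ultimately show "nrec (\<lambda>i c. G i c e) m (n + 1) = G n (nrec (\<lambda>i c. G i c e) m n) e" by simp
qed

lemma nrec:
  assumes "ndf [N, N] (\<lambda>e. G (nm (e 1)) (nm (e 0)))"
  shows "nrec G m 0 = m" "nrec G m (n + 1) = G n (nrec G m n)"
  using nrec_env[of "[]" "\<lambda>i c e. G i c"] assms by simp_all

lemma dfn_weaken: "dfn \<Gamma> \<tau> F \<Longrightarrow> dfn (\<sigma> # \<Gamma>) \<tau> (\<lambda>e. F (\<lambda>i. e (Suc i)))"
proof (induction rule: dfn.induct)
  case (var i \<tau>)
  then show ?case using dfn.var[of "Suc i" "\<sigma> # \<Gamma>" \<tau>] by simp
next
  case (par c \<tau>)
  then show ?case by (rule dfn.par)
next
  case (app \<rho> \<tau> F G)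
  show ?case by (rule dfn.app[OF app.IH])
next
  case (agree \<tau> F G)
  show ?case by (rule dfn.agree[OF agree.IH]) (use agree env_ConsD in blast)
qed

lemma ndf_weaken: "ndf \<Gamma> F \<Longrightarrow> ndf (\<sigma> # \<Gamma>) (\<lambda>e. F (\<lambda>i. e (Suc i)))"
  unfolding ndf_def by (rule dfn_weaken)

lemma dec_weaken: "dec \<Gamma> P \<Longrightarrow> dec (\<sigma> # \<Gamma>) (\<lambda>e. P (\<lambda>i. e (Suc i)))"
  unfolding dec_def using dfn_weaken env_ConsD by fastforce

text \<open>A definition by cases is the search for the only number in its graph.\<close>

lemma ndf_if:
  assumes "dec \<Gamma> P" "ndf \<Gamma> F" "ndf \<Gamma> G"
  shows "ndf \<Gamma> (\<lambda>e. if P e then F e else G e)"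
proof -
  let ?R = "\<lambda>n e. (P e \<and> n = F e) \<or> (\<not> P e \<and> n = G e)"
  have R: "dec (N # \<Gamma>) (\<lambda>e. ?R (nm (e 0)) (\<lambda>i. e (Suc i)))"
    by (intro dec_disj dec_conj dec_not ndec_eq ndf_var dec_weaken[OF assms(1)]
      ndf_weaken[OF assms(2)] ndf_weaken[OF assms(3)]) simp_all
  have "(if P e then F e else G e) = nmu (\<lambda>n. ?R n e)" if "env \<Gamma> e" for e
    using nmu_env[OF R that, of "if P e then F e else G e"] by (cases "P e") simp_all
  then show ?thesis by (intro ndf_cong[OF ndf_mu[OF R]]) simp
qed

lemmas ndf_intros = ndf_plus ndf_times ndf_fapp ndf_Fapp ndf_var ndf_const dfn.var dfn.par
  ndec_eq ndec_less ndec_le dec_const dec_not dec_conj dec_disj dec_imp ndec_ex ndec_all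


subsection \<open>Pairing\<close>

text \<open>Cantor's pairing function with the equation doubled, which avoids division by 2.\<close>

definition codes_pair :: "mnat \<Rightarrow> mnat \<Rightarrow> mnat \<Rightarrow> bool" where
  "codes_pair c u v \<longleftrightarrow> c + c = (u + v) * (u + v + 1) + (u + u)"

lemma double_less: "(a::mnat) < b \<Longrightarrow> a + a + 1 < b + b"
proof -
  assume "a < b"
  then obtain k where "b = a + (k + 1)" by (auto simp: mnat_less_iff)
  then have "b + b = (a + a + 1) + (k + k + 1)" by (simp add: algebra_simps)
  then show ?thesis by (auto simp: mnat_less_iff)
qed

lemma double_eq: "(a::mnat) + a = b + b \<Longrightarrow> a = b"
  by (metis double_less less_add_one less_trans less_irrefl linorder_less_linear)

lemma double_neq: "(a::mnat) + a \<noteq> b + b + 1"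
proof
  assume eq: "a + a = b + b + 1"
  show False
  proof (cases "b < a")
    case True
    from double_less[OF this] eq show False by simp
  next
    case False
    then have "a + a \<le> b + b" by (intro add_mono) auto
    with eq show False by (simp add: add.assoc)
  qed
qed

lemma parity: "\<exists>p. (u::mnat) = p + p \<or> u + 1 = p + p"
proof (rule minduct[where P = "\<lambda>u. \<exists>p. u = p + p \<or> u + 1 = p + p"])
  show "dec [N] (\<lambda>e. \<exists>p. nm (e 0) = p + p \<or> nm (e 0) + 1 = p + p)"
    by (intro ndf_intros) simp_all
  show "\<exists>p. (0::mnat) = p + p \<or> 0 + 1 = p + p" by (rule exI[of _ 0]) simp
  fix n :: mnat assume "\<exists>p. n = p + p \<or> n + 1 = p + p"
  then obtain p where "n = p + p \<or> n + 1 = p + p" by blast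
  then show "\<exists>p. n + 1 = p + p \<or> n + 1 + 1 = p + p"
  proof
    assume "n = p + p"
    then have "n + 1 + 1 = (p + 1) + (p + 1)" by (simp only: ac_simps)
    then show ?thesis by blast
  qed blast
qed

lemma codes_pair_exists: "\<exists>c. codes_pair c u v"
proof -
  have "\<exists>p. s * (s + 1) = p + p" for s :: mnat
  proof -
    obtain q where "s = q + q \<or> s + 1 = q + q" using parity by blast
    then show ?thesis
    proof
      assume "s = q + q"
      then have "s * (s + 1) = q * (s + 1) + q * (s + 1)" by (simp add: algebra_simps)
      then show ?thesis by blast
    next
      assume "s + 1 = q + q"
      then have "s * (s + 1) = s * q + s * q" by (metis distrib_left)
      then show ?thesis by blast
    qed
  qed
  then obtain p where "(u + v) * (u + v + 1) = p + p" by blast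
  then have "codes_pair (p + u) u v" by (simp add: codes_pair_def ac_simps)
  then show ?thesis by blast
qed

text \<open>Induction along Cantor's diagonals: after \<open>(u, k + 1)\<close> comes
  \<open>(u + 1, k)\<close>, and after \<open>(u, 0)\<close> the next diagonal starts with
  \<open>(0, u + 1)\<close>.\<close>

lemma codes_pair_surj: "\<exists>u v. codes_pair c u v"
proof (rule minduct[where P = "\<lambda>c. \<exists>u v. codes_pair c u v"])
  show "dec [N] (\<lambda>e. \<exists>u v. codes_pair (nm (e 0)) u v)"
    unfolding codes_pair_def by (intro ndf_intros) simp_all
  have "codes_pair 0 0 0" by (simp add: codes_pair_def)
  then show "\<exists>u v. codes_pair 0 u v" by blast
  fix c assume "\<exists>u v. codes_pair c u v"
  then obtain u v where uv: "c + c = (u + v) * (u + v + 1) + (u + u)" by (auto simp: codes_pair_def)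
  have c: "(c + 1) + (c + 1) = (c + c) + (1 + 1)" by (simp only: ac_simps)
  from mnat_cases[of v] show "\<exists>u v. codes_pair (c + 1) u v"
  proof
    assume "v = 0"
    then have "codes_pair (c + 1) 0 (u + 1)" unfolding codes_pair_def c uv by (simp add: algebra_simps flip: one_add_one)
    then show ?thesis by blast
  next
    assume "\<exists>k. v = k + 1"
    then obtain k where "v = k + 1" by blast
    then have "codes_pair (c + 1) (u + 1) k" unfolding codes_pair_def c uv by (simp add: algebra_simps flip: one_add_one)
    then show ?thesis by blast
  qed
qed

text \<open>Codes on a lower diagonal are smaller than all codes on a higher one, because
  \<open>u \<le> u + v\<close>. Equal codes therefore agree in \<open>u + v\<close>, and then in
  \<open>u + u\<close>.\<close>

lemma codes_pair_unique: "codes_pair c u v \<Longrightarrow> codes_pair c u' v' \<Longrightarrow> u = u' \<and> v = v'"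
proof -
  have less: False if "codes_pair c u v" "codes_pair c u' v'" "u + v < u' + v'" for u v u' v'
  proof -
    let ?s = "u + v" and ?s' = "u' + v'"
    have "?s + 1 \<le> ?s'" using that(3) by (simp add: mnat_Suc_le)
    then have "(?s + 1) * (?s + 1 + 1) \<le> ?s' * (?s' + 1)" by (intro mult_mono) simp_all
    moreover have "?s * (?s + 1) + (u + u) < (?s + 1) * (?s + 1 + 1)"
    proof -
      have "?s * (?s + 1) + (u + u) \<le> ?s * (?s + 1) + (?s + ?s)"
        by (intro add_left_mono add_mono) simp_all
      also have "\<dots> < ?s * (?s + 1) + (?s + ?s) + (1 + 1)" by (simp add: add_pos_pos)
      also have "\<dots> = (?s + 1) * (?s + 1 + 1)" by (simp add: algebra_simps flip: one_add_one)
      finally show ?thesis .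
    qed
    ultimately have "?s * (?s + 1) + (u + u) < ?s' * (?s' + 1)" by simp
    also have "\<dots> \<le> ?s' * (?s' + 1) + (u' + u')" by (simp add: add_nonneg_nonneg)
    finally show False using that(1,2) by (simp add: codes_pair_def)
  qed
  assume *: "codes_pair c u v" "codes_pair c u' v'"
  then have s: "u + v = u' + v'" using less linorder_less_linear by metis
  then have "u + u = u' + u'" using * by (simp add: codes_pair_def)
  then have "u = u'" by (rule double_eq)
  then show ?thesis using s by simp
qed

definition fst_of :: "mnat \<Rightarrow> mnat" where "fst_of c = nmu (\<lambda>u. \<exists>v. codes_pair c u v)"
definition snd_of :: "mnat \<Rightarrow> mnat" where "snd_of c = nmu (\<lambda>v. \<exists>u. codes_pair c u v)"
definition pair_of :: "mnat \<Rightarrow> mnat \<Rightarrow> mnat" where "pair_of u v = nmu (\<lambda>c. codes_pair c u v)"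

lemma dec_codes_pair: "ndf \<Gamma> C \<Longrightarrow> ndf \<Gamma> U \<Longrightarrow> ndf \<Gamma> V \<Longrightarrow> dec \<Gamma> (\<lambda>e. codes_pair (C e) (U e) (V e))"
  unfolding codes_pair_def by (intro ndf_intros)

lemma ndf_fst_of: "ndf \<Gamma> C \<Longrightarrow> ndf \<Gamma> (\<lambda>e. fst_of (C e))"
  unfolding fst_of_def by (intro ndf_mu ndec_ex dec_codes_pair ndf_var ndf_weaken[OF ndf_weaken]) simp_all

lemma ndf_snd_of: "ndf \<Gamma> C \<Longrightarrow> ndf \<Gamma> (\<lambda>e. snd_of (C e))"
  unfolding snd_of_def by (intro ndf_mu ndec_ex dec_codes_pair ndf_var ndf_weaken[OF ndf_weaken]) simp_all

lemma ndf_pair_of: "ndf \<Gamma> U \<Longrightarrow> ndf \<Gamma> V \<Longrightarrow> ndf \<Gamma> (\<lambda>e. pair_of (U e) (V e))"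
  unfolding pair_of_def by (intro ndf_mu dec_codes_pair ndf_var ndf_weaken) simp_all

lemma codes_pair_pair_of: "codes_pair (pair_of u v) u v"
proof -
  have "dec [N] (\<lambda>e. codes_pair (nm (e 0)) u v)" by (intro dec_codes_pair ndf_var ndf_const) simp_all
  from nmu[of "\<lambda>c. codes_pair c u v", OF this] show ?thesis
    unfolding pair_of_def using codes_pair_exists by blast
qed

lemma codes_pair_fst: "codes_pair c u v \<Longrightarrow> fst_of c = u" and codes_pair_snd: "codes_pair c u v \<Longrightarrow> snd_of c = v"
proof -
  assume c: "codes_pair c u v"
  have "dec [N] (\<lambda>e. \<exists>v. codes_pair c (nm (e 0)) v)" "dec [N] (\<lambda>e. \<exists>u. codes_pair c u (nm (e 0)))"
    by (intro ndec_ex dec_codes_pair ndf_var ndf_const; simp)+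
  from nmu[of "\<lambda>u. \<exists>v. codes_pair c u v" u, OF this(1)] nmu[of "\<lambda>v. \<exists>u. codes_pair c u v" v, OF this(2)]
  show "fst_of c = u" "snd_of c = v"
    unfolding fst_of_def snd_of_def using c codes_pair_unique by blast+
qed

lemma fst_pair_of [simp]: "fst_of (pair_of u v) = u" and snd_pair_of [simp]: "snd_of (pair_of u v) = v"
  using codes_pair_pair_of codes_pair_fst codes_pair_snd by blast+


subsection \<open>Powers of two\<close>

text \<open>Obtained from the macro \<open>pow2\<close> by cutting off its argument, so that
  \<open>pw\<close> is by construction the exponential occurring in the formulas.\<close>

definition pow_fun :: "tm set" where "pow_fun = evl CM (\<lambda>_. ze) (case pow2 \<^bold>0 0 of App f x \<Rightarrow> f)"

definition pw :: "mnat \<Rightarrow> mnat" where "pw k = pow_fun @@ k"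

lemma pow_fun: "pow_fun = cst CM Rec $$ (cst CM (PiC ty1 N) $$
    (cst CM (SigmaC N N N) $$ cst CM Plus $$ (cst CM (SigmaC N ty1 N) $$ cst CM (PiC N ty1) $$ cst CM (PiC N N)))) $$ on"
  by (simp add: pow_fun_def pow2_def Let_def happ_def hcst_def hone_def)

lemma pow_fun_D: "pow_fun \<in> D ty1"
  and pw_zero: "pw 0 = 1" and pw_suc: "pw (k + 1) = pw k + pw k"
proof -
  let ?I = "cst CM (SigmaC N ty1 N) $$ cst CM (PiC N ty1) $$ cst CM (PiC N N)"
  let ?d = "cst CM (SigmaC N N N) $$ cst CM Plus $$ ?I"
  have I: "?I \<in> D ty1" by (meson app_dom PiC_D SigmaC_D)
  then have d: "?d \<in> D ty1" by (meson app_dom pl_D SigmaC_D)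
  then have K: "cst CM (PiC ty1 N) $$ ?d \<in> D (N \<rightarrow> ty1)" by (meson app_dom PiC_D)
  show D: "pow_fun \<in> D ty1" unfolding pow_fun using K Rec_D app_dom on_D by blast
  have Iu: "?I $$ u = u" if "u \<in> D N" for u
    using that Sigma_app[OF PiC_D PiC_D that] Pi_app[OF that] app_dom[OF PiC_D that] by simp
  have du: "?d $$ u = u \<oplus> u" if "u \<in> D N" for u
    using that Sigma_app[OF pl_D I that] Iu by simp
  show "pw 0 = 1" unfolding pw_def fapp_def nu_zero pow_fun
    using Rec_zero[OF K on_D] nu_one nm_nu by metis
  have "nu (pw (k + 1)) = nu (pw k + pw k)"
    unfolding pw_def nu_plus nu_fapp[OF D] nu_one
    unfolding pow_fun Rec_suc[OF K on_D nu_D]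
    unfolding pow_fun[symmetric] using D by (simp add: Pi_app[OF d nu_D] du app_dom[OF D nu_D])
  then show "pw (k + 1) = pw k + pw k" by simp
qed

lemma ndf_pw: "ndf \<Gamma> F \<Longrightarrow> ndf \<Gamma> (\<lambda>e. pw (F e))"
  unfolding pw_def by (intro ndf_fapp dfn.par pow_fun_D)

lemma less_pw: "k < pw k"
proof (rule minduct[where P = "\<lambda>k. k < pw k"])
  show "dec [N] (\<lambda>e. nm (e 0) < pw (nm (e 0)))" by (intro ndf_intros ndf_pw) simp_all
  show "0 < pw 0" by (simp add: pw_zero)
  fix n assume n: "n < pw n"
  then have "n + 1 \<le> pw n" by (simp add: mnat_Suc_le)
  moreover have "0 < pw n" using n mnat_nonneg[of n] by (rule order.strict_trans1[rotated])
  ultimately show "n + 1 < pw (n + 1)" unfolding pw_suc using add_le_less_mono by fastforce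
qed

lemma pw_pos: "0 < pw k"
  using less_pw[of k] mnat_nonneg[of k] by (rule order.strict_trans1[rotated])

end


subsection \<open>Rational numbers\<close>

definition mfrac :: "mnat \<Rightarrow> mnat \<Rightarrow> mnat \<Rightarrow> mrat" where "mfrac p n d = (q_of p - q_of n) / q_of d"

lemma q_of_pos: "0 < q_of d \<longleftrightarrow> 0 < d"
  using q_of_simps(7)[of 0 d] by simp

lemma mfrac_plus:
  "0 < d \<Longrightarrow> 0 < d' \<Longrightarrow> mfrac p n d + mfrac p' n' d' = mfrac (p * d' + p' * d) (n * d' + n' * d) (d * d')"
  using q_of_pos[of d] q_of_pos[of d'] by (simp add: mfrac_def field_simps)

lemma mfrac_times:
  "mfrac p n d * mfrac p' n' d' = mfrac (p * p' + n * n') (p * n' + n * p') (d * d')"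
  by (simp add: mfrac_def algebra_simps)

lemma mfrac_uminus: "- mfrac p n d = mfrac n p d"
  by (simp add: mfrac_def minus_divide_left)

lemma mfrac_less:
  assumes "0 < d" "0 < d'"
  shows "mfrac p n d < mfrac p' n' d' \<longleftrightarrow> p * d' + n' * d < p' * d + n * d'"
proof -
  have "mfrac p n d < mfrac p' n' d' \<longleftrightarrow> q_of (p * d' + n' * d) < q_of (p' * d + n * d')"
    using q_of_pos[of d] q_of_pos[of d'] assms by (simp add: mfrac_def field_simps)
  then show ?thesis by (rule trans[OF _ q_of_simps(7)])
qed

lemma mfrac_eq:
  assumes "0 < d" "0 < d'"
  shows "mfrac p n d = mfrac p' n' d' \<longleftrightarrow> p * d' + n' * d = p' * d + n * d'"
proof -
  have "mfrac p n d = mfrac p' n' d' \<longleftrightarrow> q_of (p * d' + n' * d) = q_of (p' * d + n * d')"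
    using q_of_pos[of d] q_of_pos[of d'] assms by (auto simp: mfrac_def field_simps)
  then show ?thesis by (rule trans[OF _ q_of_simps(5)])
qed

context refutation
begin

text \<open>Rationals are not objects of the model; a rational-valued function counts as definable
  if the three components of a representing triple are.\<close>

definition qdf :: "ty list \<Rightarrow> ((nat \<Rightarrow> tm set) \<Rightarrow> mrat) \<Rightarrow> bool" where
  "qdf \<Gamma> F \<longleftrightarrow> (\<exists>p n d. ndf \<Gamma> p \<and> ndf \<Gamma> n \<and> ndf \<Gamma> d \<and>
    (\<forall>e. env \<Gamma> e \<longrightarrow> 0 < d e \<and> F e = mfrac (p e) (n e) (d e)))"

lemma qdfI:
  "ndf \<Gamma> p \<Longrightarrow> ndf \<Gamma> n \<Longrightarrow> ndf \<Gamma> d \<Longrightarrow> (\<And>e. env \<Gamma> e \<Longrightarrow> 0 < d e) \<Longrightarrow>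
    (\<And>e. env \<Gamma> e \<Longrightarrow> F e = mfrac (p e) (n e) (d e)) \<Longrightarrow> qdf \<Gamma> F"
  unfolding qdf_def by blast

lemma qdf_of: "ndf \<Gamma> F \<Longrightarrow> qdf \<Gamma> (\<lambda>e. q_of (F e))"
  by (rule qdfI[of _ F "\<lambda>e. 0" "\<lambda>e. 1"]) (auto simp: mfrac_def intro: ndf_const)

lemma qdf_const: "qdf \<Gamma> (\<lambda>e. q)"
proof -
  obtain p n d where "0 < d" "q = mfrac p n d" using mrat_cases[of q] by (auto simp: mfrac_def)
  then show ?thesis by (intro qdfI[of _ "\<lambda>e. p" "\<lambda>e. n" "\<lambda>e. d"]) (auto intro: ndf_const)
qed

lemma qdf_plus: "qdf \<Gamma> F \<Longrightarrow> qdf \<Gamma> G \<Longrightarrow> qdf \<Gamma> (\<lambda>e. F e + G e)"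
proof -
  assume "qdf \<Gamma> F" "qdf \<Gamma> G"
  then obtain p n d p' n' d' where *: "ndf \<Gamma> p" "ndf \<Gamma> n" "ndf \<Gamma> d" "ndf \<Gamma> p'" "ndf \<Gamma> n'" "ndf \<Gamma> d'"
    and F: "\<And>e. env \<Gamma> e \<Longrightarrow> 0 < d e \<and> F e = mfrac (p e) (n e) (d e)"
    and G: "\<And>e. env \<Gamma> e \<Longrightarrow> 0 < d' e \<and> G e = mfrac (p' e) (n' e) (d' e)" unfolding qdf_def by metis
  show ?thesis
    by (rule qdfI[of _ "\<lambda>e. p e * d' e + p' e * d e" "\<lambda>e. n e * d' e + n' e * d e" "\<lambda>e. d e * d' e"])
      (use F G * in \<open>auto intro: ndf_plus ndf_times simp: mfrac_plus\<close>)
qed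

lemma qdf_times: "qdf \<Gamma> F \<Longrightarrow> qdf \<Gamma> G \<Longrightarrow> qdf \<Gamma> (\<lambda>e. F e * G e)"
proof -
  assume "qdf \<Gamma> F" "qdf \<Gamma> G"
  then obtain p n d p' n' d' where *: "ndf \<Gamma> p" "ndf \<Gamma> n" "ndf \<Gamma> d" "ndf \<Gamma> p'" "ndf \<Gamma> n'" "ndf \<Gamma> d'"
    and F: "\<And>e. env \<Gamma> e \<Longrightarrow> 0 < d e \<and> F e = mfrac (p e) (n e) (d e)"
    and G: "\<And>e. env \<Gamma> e \<Longrightarrow> 0 < d' e \<and> G e = mfrac (p' e) (n' e) (d' e)" unfolding qdf_def by metis
  show ?thesis
    by (rule qdfI[of _ "\<lambda>e. p e * p' e + n e * n' e" "\<lambda>e. p e * n' e + n e * p' e" "\<lambda>e. d e * d' e"])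
      (use F G * in \<open>auto intro: ndf_plus ndf_times simp: mfrac_times\<close>)
qed

lemma qdf_uminus: "qdf \<Gamma> F \<Longrightarrow> qdf \<Gamma> (\<lambda>e. - F e)"
  using qdf_times[OF qdf_const[of _ "- 1"]] by simp

lemma qdf_minus: "qdf \<Gamma> F \<Longrightarrow> qdf \<Gamma> G \<Longrightarrow> qdf \<Gamma> (\<lambda>e. F e - G e)"
  using qdf_plus[OF _ qdf_uminus] by simp

lemma dec_qless: "qdf \<Gamma> F \<Longrightarrow> qdf \<Gamma> G \<Longrightarrow> dec \<Gamma> (\<lambda>e. F e < G e)"
proof -
  assume "qdf \<Gamma> F" "qdf \<Gamma> G"
  then obtain p n d p' n' d' where *: "ndf \<Gamma> p" "ndf \<Gamma> n" "ndf \<Gamma> d" "ndf \<Gamma> p'" "ndf \<Gamma> n'" "ndf \<Gamma> d'"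
    and F: "\<And>e. env \<Gamma> e \<Longrightarrow> 0 < d e \<and> F e = mfrac (p e) (n e) (d e)"
    and G: "\<And>e. env \<Gamma> e \<Longrightarrow> 0 < d' e \<and> G e = mfrac (p' e) (n' e) (d' e)" unfolding qdf_def by metis
  have "dec \<Gamma> (\<lambda>e. p e * d' e + n' e * d e < p' e * d e + n e * d' e)"
    by (intro ndec_less ndf_plus ndf_times *)
  then show ?thesis by (rule dec_cong) (simp add: F G mfrac_less)
qed

lemma dec_qle: "qdf \<Gamma> F \<Longrightarrow> qdf \<Gamma> G \<Longrightarrow> dec \<Gamma> (\<lambda>e. F e \<le> G e)"
  using dec_not[OF dec_qless[of \<Gamma> G F]] by (simp add: not_less)

lemma dec_qeq: "qdf \<Gamma> F \<Longrightarrow> qdf \<Gamma> G \<Longrightarrow> dec \<Gamma> (\<lambda>e. F e = G e)"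
  using dec_conj[OF dec_qle[of \<Gamma> F G] dec_qle[of \<Gamma> G F]] by (simp add: order_eq_iff)

lemma qdf_if: "dec \<Gamma> P \<Longrightarrow> qdf \<Gamma> F \<Longrightarrow> qdf \<Gamma> G \<Longrightarrow> qdf \<Gamma> (\<lambda>e. if P e then F e else G e)"
proof -
  assume P: "dec \<Gamma> P" and "qdf \<Gamma> F" "qdf \<Gamma> G"
  then obtain p n d p' n' d' where *: "ndf \<Gamma> p" "ndf \<Gamma> n" "ndf \<Gamma> d" "ndf \<Gamma> p'" "ndf \<Gamma> n'" "ndf \<Gamma> d'"
    and F: "\<And>e. env \<Gamma> e \<Longrightarrow> 0 < d e \<and> F e = mfrac (p e) (n e) (d e)"
    and G: "\<And>e. env \<Gamma> e \<Longrightarrow> 0 < d' e \<and> G e = mfrac (p' e) (n' e) (d' e)" unfolding qdf_def by metis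
  show ?thesis
    by (rule qdfI[OF ndf_if[OF P *(1,4)] ndf_if[OF P *(2,5)] ndf_if[OF P *(3,6)]]) (simp_all add: F G)
qed

lemma qdf_min: "qdf \<Gamma> F \<Longrightarrow> qdf \<Gamma> G \<Longrightarrow> qdf \<Gamma> (\<lambda>e. min (F e) (G e))"
  unfolding min_def by (intro qdf_if dec_qle)

lemma qdf_max: "qdf \<Gamma> F \<Longrightarrow> qdf \<Gamma> G \<Longrightarrow> qdf \<Gamma> (\<lambda>e. max (F e) (G e))"
  unfolding max_def by (intro qdf_if dec_qle)

definition hp :: "mnat \<Rightarrow> mrat" where "hp k = 1 / q_of (pw k)"

lemma hp_pos [simp]: "0 < hp k"
  using pw_pos[of k] by (simp add: hp_def q_of_pos)

lemma hp_zero [simp]: "hp 0 = 1"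
  by (simp add: hp_def pw_zero)

lemma hp_suc: "hp (k + 1) = hp k / 2"
proof -
  have "q_of (pw (k + 1)) = 2 * q_of (pw k)" by (simp only: pw_suc q_of_simps mult_2)
  then show ?thesis unfolding hp_def by simp
qed

lemma hp_frac: "hp k = mfrac 1 0 (pw k)"
  by (simp add: hp_def mfrac_def)

lemma qdf_hp: "ndf \<Gamma> F \<Longrightarrow> qdf \<Gamma> (\<lambda>e. hp (F e))"
  by (rule qdfI[of _ "\<lambda>e. 1" "\<lambda>e. 0" "\<lambda>e. pw (F e)"]) (auto simp: hp_frac pw_pos intro: ndf_const ndf_pw)

text \<open>A positive fraction with denominator \<open>d\<close> is at least \<open>1 / d\<close>,
  and \<open>d < pw d\<close>. The exponent ranges over numbers of the model, so nothing is claimed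
  about standard exponents.\<close>

lemma hp_archimedean: "0 < q \<Longrightarrow> \<exists>k. hp k < q"
proof -
  assume q: "0 < q"
  obtain p n d where d: "0 < d" and pn: "p = 0 \<or> n = 0" and eq: "q = mfrac p n d"
    using mrat_cases[of q] by (auto simp: mfrac_def)
  have "q_of n < q_of p" using q d q_of_pos[of d] by (simp add: eq mfrac_def zero_less_divide_iff)
  then have "n < p" by simp
  then obtain j where "p = n + (j + 1)" by (auto simp: mnat_less_iff)
  then have "1 \<le> q_of p - q_of n" by simp
  then have "1 / q_of d \<le> q" using d q_of_pos[of d] by (simp add: eq mfrac_def divide_right_mono)
  moreover have "hp d < 1 / q_of d"
    unfolding hp_def using less_pw[of d] d q_of_pos[of d] by (intro divide_strict_left_mono) (simp_all add: q_of_pos pw_pos)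
  ultimately show ?thesis by (meson less_le_trans)
qed

lemma hp_add: "hp (j + k) \<le> hp j"
proof (rule minduct[where P = "\<lambda>k. hp (j + k) \<le> hp j"])
  show "dec [N] (\<lambda>e. hp (j + nm (e 0)) \<le> hp j)"
    by (intro dec_qle qdf_hp ndf_intros) simp_all
  show "hp (j + (n + 1)) \<le> hp j" if "hp (j + n) \<le> hp j" for n
    using that hp_suc[of "j + n"] hp_pos[of "j + n"] unfolding add.assoc by linarith
qed simp

section \<open>Codes of rational numbers\<close>

definition codes :: "mnat \<Rightarrow> mnat \<Rightarrow> mnat \<Rightarrow> mnat \<Rightarrow> bool" where
  "codes c p n d \<longleftrightarrow> (\<exists>u v. codes_pair c u v \<and> d = v + 1 \<and>
    ((u = p + p \<and> n = 0) \<or> (u + 1 = n + n \<and> p = 0)))"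

lemma dec_codes:
  "ndf \<Gamma> C \<Longrightarrow> ndf \<Gamma> P \<Longrightarrow> ndf \<Gamma> F \<Longrightarrow> ndf \<Gamma> G \<Longrightarrow> dec \<Gamma> (\<lambda>e. codes (C e) (P e) (F e) (G e))"
  unfolding codes_def
  by (intro ndec_ex dec_conj dec_disj dec_codes_pair ndec_eq ndf_plus ndf_const ndf_var
    ndf_weaken[OF ndf_weaken]) simp_all

lemma codes_exists: "\<exists>p n d. codes c p n d"
proof -
  obtain u v where uv: "codes_pair c u v" using codes_pair_surj by blast
  obtain p where "u = p + p \<or> u + 1 = p + p" using parity by blast
  then show ?thesis using uv unfolding codes_def by blast
qed

lemma codes_unique: "codes c p n d \<Longrightarrow> codes c p' n' d' \<Longrightarrow> p = p' \<and> n = n' \<and> d = d'"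
proof -
  assume "codes c p n d" "codes c p' n' d'"
  then obtain u v u' v' where *: "codes_pair c u v" "codes_pair c u' v'" "d = v + 1" "d' = v' + 1"
    "(u = p + p \<and> n = 0) \<or> (u + 1 = n + n \<and> p = 0)" "(u' = p' + p' \<and> n' = 0) \<or> (u' + 1 = n' + n' \<and> p' = 0)"
    unfolding codes_def by blast
  then have eq: "u = u'" "v = v'" using codes_pair_unique by blast+
  have "n + n \<noteq> p' + p' + 1" "n' + n' \<noteq> p + p + 1" using double_neq by blast+
  with * eq show ?thesis using double_eq[of p p'] double_eq[of n n'] by auto
qed

lemma codes_pos: "codes c p n d \<Longrightarrow> 0 < d"
  by (auto simp: codes_def mnat_less_Suc)

definition code_p :: "mnat \<Rightarrow> mnat" where "code_p c = nmu (\<lambda>p. \<exists>n d. codes c p n d)"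
definition code_n :: "mnat \<Rightarrow> mnat" where "code_n c = nmu (\<lambda>n. \<exists>p d. codes c p n d)"
definition code_d :: "mnat \<Rightarrow> mnat" where "code_d c = nmu (\<lambda>d. \<exists>p n. codes c p n d)"

definition rat_of :: "mnat \<Rightarrow> mrat" where "rat_of c = mfrac (code_p c) (code_n c) (code_d c)"

lemma codes_parts: "codes c p n d \<Longrightarrow> code_p c = p \<and> code_n c = n \<and> code_d c = d"
proof -
  assume c: "codes c p n d"
  have 1: "dec [N] (\<lambda>e. \<exists>n d. codes c (nm (e 0)) n d)" and 2: "dec [N] (\<lambda>e. \<exists>p d. codes c p (nm (e 0)) d)"
    and 3: "dec [N] (\<lambda>e. \<exists>p n. codes c p n (nm (e 0)))"
    by (intro ndec_ex dec_codes ndf_var ndf_const; simp)+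
  from nmu[of "\<lambda>p. \<exists>n d. codes c p n d" p, OF 1] nmu[of "\<lambda>n. \<exists>p d. codes c p n d" n, OF 2]
    nmu[of "\<lambda>d. \<exists>p n. codes c p n d" d, OF 3]
  show ?thesis unfolding code_p_def code_n_def code_d_def using c codes_unique by blast
qed

lemma codes_code: "codes c (code_p c) (code_n c) (code_d c)"
  using codes_exists[of c] codes_parts by metis

lemma codes_rat_of: "codes c p n d \<Longrightarrow> rat_of c = mfrac p n d"
  unfolding rat_of_def using codes_parts by metis

lemma ndf_code:
  assumes "ndf \<Gamma> C"
  shows "ndf \<Gamma> (\<lambda>e. code_p (C e))" "ndf \<Gamma> (\<lambda>e. code_n (C e))" "ndf \<Gamma> (\<lambda>e. code_d (C e))"
  unfolding code_p_def code_n_def code_d_def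
  by (intro ndf_mu ndec_ex dec_codes ndf_var ndf_weaken[OF ndf_weaken[OF ndf_weaken[OF assms]]]; simp)+

lemma qdf_rat_of: "ndf \<Gamma> C \<Longrightarrow> qdf \<Gamma> (\<lambda>e. rat_of (C e))"
  by (rule qdfI[OF ndf_code]) (auto simp: rat_of_def intro: codes_pos[OF codes_code])

lemma rat_of_surj: "\<exists>c. rat_of c = q"
proof -
  obtain p n d where d: "0 < d" and pn: "p = 0 \<or> n = 0" and eq: "q = mfrac p n d"
    using mrat_cases[of q] by (auto simp: mfrac_def)
  obtain v where v: "d = v + 1" using mnat_cases[of d] d by auto
  \<comment> \<open>The numerator is stored as \<open>u = 2p\<close> if it is not negative, and as
    \<open>u = 2n - 1\<close> otherwise; for \<open>n = k + 1\<close> the latter is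
    \<open>k + k + 1\<close>.\<close>
  have "\<exists>u. (u = p + p \<and> n = 0) \<or> (u + 1 = n + n \<and> p = 0)"
  proof (cases "n = 0")
    case False
    then obtain k where "n = k + 1" using mnat_cases[of n] by auto
    then have "(k + k + 1) + 1 = n + n" by (simp only: ac_simps)
    then show ?thesis using pn False by blast
  qed blast
  then obtain u where u: "(u = p + p \<and> n = 0) \<or> (u + 1 = n + n \<and> p = 0)" by blast
  obtain c where "codes_pair c u v" using codes_pair_exists by blast
  then have "codes c p n d" using u v by (auto simp: codes_def)
  then show ?thesis using codes_rat_of eq by blast
qed

text \<open>A rational has many codes, since fractions are not reduced; the search operator selects
  one of them definably.\<close>

definition code_of :: "mrat \<Rightarrow> mnat" where "code_of q = nmu (\<lambda>c. rat_of c = q)"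

lemma rat_code [simp]: "rat_of (code_of q) = q"
proof -
  obtain c where c: "rat_of c = q" using rat_of_surj by blast
  have "dec [N] (\<lambda>e. rat_of (nm (e 0)) = q)" by (intro dec_qeq qdf_rat_of qdf_const ndf_var) simp_all
  from nmu[of "\<lambda>c. rat_of c = q", OF this c] show ?thesis unfolding code_of_def .
qed

lemma qdf_weaken: "qdf \<Gamma> F \<Longrightarrow> qdf (\<sigma> # \<Gamma>) (\<lambda>e. F (\<lambda>i. e (Suc i)))"
proof -
  assume "qdf \<Gamma> F"
  then obtain p n d where *: "ndf \<Gamma> p" "ndf \<Gamma> n" "ndf \<Gamma> d"
    and F: "\<And>e. env \<Gamma> e \<Longrightarrow> 0 < d e \<and> F e = mfrac (p e) (n e) (d e)" unfolding qdf_def by metis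
  show ?thesis
    by (rule qdfI[OF *(1-3)[THEN ndf_weaken[where \<sigma> = \<sigma>]]]) (use F env_ConsD in blast)+
qed

lemma ndf_code_of: "qdf \<Gamma> F \<Longrightarrow> ndf \<Gamma> (\<lambda>e. code_of (F e))"
  unfolding code_of_def
  by (intro ndf_mu dec_qeq qdf_rat_of ndf_var qdf_weaken) simp_all

lemmas qdf_intros = qdf_plus qdf_minus qdf_times qdf_uminus qdf_min qdf_max qdf_if qdf_hp qdf_of
  qdf_rat_of ndf_code_of dec_qless dec_qle dec_qeq qdf_const ndf_fst_of ndf_snd_of ndf_pair_of ndf_pw ndf_intros


section \<open>The meaning of the formulas\<close>

abbreviation econs :: "tm set \<Rightarrow> (nat \<Rightarrow> tm set) \<Rightarrow> nat \<Rightarrow> tm set" (infixr "##" 65) where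
  "a ## e \<equiv> case_nat a e"

text \<open>The variable that \<open>hall\<close> at depth \<open>d\<close> passes to its
  body.\<close>

definition hv :: "nat \<Rightarrow> hterm" where "hv d = (\<lambda>d'. Bv (d' - Suc d))"

definition hold :: "(nat \<Rightarrow> tm set) \<Rightarrow> nat \<Rightarrow> hform \<Rightarrow> bool" where
  "hold e d \<phi> \<longleftrightarrow> sat CM e (\<phi> d)"

text \<open>\<open>den e d x a\<close> says that \<open>x\<close> denotes \<open>a\<close> at depth \<open>d\<close> and that its indices are shifted correctly under
  further quantifiers. The rules below then determine the meaning of a formula by resolution.\<close>

definition den :: "(nat \<Rightarrow> tm set) \<Rightarrow> nat \<Rightarrow> hterm \<Rightarrow> tm set \<Rightarrow> bool" where
  "den e d x a \<longleftrightarrow> coherent d x \<and> evl CM e (x d) = a"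

lemma den_var: "den (a ## e) (Suc d) (hv d) a"
  unfolding den_def hv_def using coherent_var by simp

lemma den_lift: "den e d x a \<Longrightarrow> den (b ## e) (Suc d) x a"
  unfolding den_def using coherent_Suc evl_shift by (auto simp: coherent_def)

lemma den_app: "den e d x a \<Longrightarrow> den e d y b \<Longrightarrow> den e d (x \<cdot> y) (a $$ b)"
  unfolding den_def using coherent_happ by (auto simp: happ_def)

lemma den_cst: "den e d (hcst c) (cst CM c)"
  unfolding den_def using coherent_hcst by (simp add: hcst_def)

lemma den_fapp: "den e d x f \<Longrightarrow> f \<in> D ty1 \<Longrightarrow> den e d y (nu n) \<Longrightarrow> den e d (x \<cdot> y) (nu (f @@ n))"
  using den_app nu_fapp by metis

lemma den_Fapp: "den e d x f \<Longrightarrow> f \<in> D ty2 \<Longrightarrow> den e d y g \<Longrightarrow> g \<in> D ty1 \<Longrightarrow> den e d (x \<cdot> y) (nu (f @@@ g))"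
  using den_app nu_Fapp by metis

lemma den_zero: "den e d \<^bold>0 (nu 0)" and den_one: "den e d \<^bold>1 (nu 1)"
  unfolding hzero_def hone_def nu_zero nu_one by (rule den_cst)+

lemma den_plus: "den e d x (nu a) \<Longrightarrow> den e d y (nu b) \<Longrightarrow> den e d (x \<^bold>+ y) (nu (a + b))"
  unfolding hplus_def nu_plus by (intro den_app den_cst)

lemma den_times: "den e d x (nu a) \<Longrightarrow> den e d y (nu b) \<Longrightarrow> den e d (x \<^bold>* y) (nu (a * b))"
  unfolding htimes_def nu_times by (intro den_app den_cst)

lemma den_pow2: "den e d x (nu k) \<Longrightarrow> den e d (pow2 x) (nu (pw k))"
proof -
  assume x: "den e d x (nu k)"
  have "den e d (pow2 x) (pow_fun $$ nu k)"
    unfolding pow2_def Let_def pow_fun nu_one[symmetric] by (intro den_app den_cst den_one x)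
  then show ?thesis unfolding pw_def using nu_fapp[OF pow_fun_D] by simp
qed

lemma hold_eq: "den e d x (nu a) \<Longrightarrow> den e d y (nu b) \<Longrightarrow> hold e d (x \<^bold>= y) = (a = b)"
  by (simp add: hold_def heq_def den_def)

lemma hold_less: "den e d x (nu a) \<Longrightarrow> den e d y (nu b) \<Longrightarrow> hold e d (x \<^bold>< y) = (a < b)"
  by (simp add: hold_def hless_def den_def lss_nu)

lemma hold_imp: "hold e d \<phi> = P \<Longrightarrow> hold e d \<psi> = Q \<Longrightarrow> hold e d (\<phi> \<^bold>\<longrightarrow> \<psi>) = (P \<longrightarrow> Q)"
  by (simp add: hold_def himp_def)

lemma hold_not: "hold e d \<phi> = P \<Longrightarrow> hold e d (\<^bold>\<not> \<phi>) = (\<not> P)"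
  by (simp add: hold_def himp_def hnot_def hfalse_def)

lemma hold_and: "hold e d \<phi> = P \<Longrightarrow> hold e d \<psi> = Q \<Longrightarrow> hold e d (\<phi> \<^bold>\<and> \<psi>) = (P \<and> Q)"
  by (simp add: hold_def himp_def hnot_def hfalse_def hand_def)

lemma hold_or: "hold e d \<phi> = P \<Longrightarrow> hold e d \<psi> = Q \<Longrightarrow> hold e d (\<phi> \<^bold>\<or> \<psi>) = (P \<or> Q)"
  by (auto simp: hold_def himp_def hnot_def hfalse_def hor_def)

lemma hold_all:
  "(\<And>a. a \<in> D \<rho> \<Longrightarrow> hold (a ## e) (Suc d) (F (hv d)) = P a) \<Longrightarrow> hold e d (hall \<rho> F) = (\<forall>a\<in>D \<rho>. P a)"
  by (simp add: hold_def hall_def hv_def)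

lemma hold_ex:
  "(\<And>a. a \<in> D \<rho> \<Longrightarrow> hold (a ## e) (Suc d) (F (hv d)) = P a) \<Longrightarrow> hold e d (hex \<rho> F) = (\<exists>a\<in>D \<rho>. P a)"
  by (simp add: hold_def hall_def hex_def hnot_def himp_def hfalse_def hv_def)

lemma hold_allN:
  "(\<And>n. hold (nu n ## e) (Suc d) (F (hv d)) = P n) \<Longrightarrow> hold e d (hall N F) = (\<forall>n. P n)"
  by (simp add: hold_def hall_def hv_def ball_D)

lemma hold_exN:
  "(\<And>n. hold (nu n ## e) (Suc d) (F (hv d)) = P n) \<Longrightarrow> hold e d (hex N F) = (\<exists>n. P n)"
  by (simp add: hold_def hall_def hex_def hnot_def himp_def hfalse_def hv_def bex_D)

definition qden :: "(nat \<Rightarrow> tm set) \<Rightarrow> nat \<Rightarrow> hrat \<Rightarrow> mrat \<Rightarrow> bool" where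
  "qden e d q r \<longleftrightarrow> (\<exists>p n k. den e d (fst q) (nu p) \<and> den e d (fst (snd q)) (nu n) \<and>
    den e d (snd (snd q)) (nu k) \<and> 0 < k \<and> r = mfrac p n k)"

lemma qdenI:
  "den e d x (nu p) \<Longrightarrow> den e d y (nu n) \<Longrightarrow> den e d z (nu k) \<Longrightarrow> 0 < k \<Longrightarrow> qden e d (x, y, z) (mfrac p n k)"
  unfolding qden_def by auto

lemma qdenE:
  assumes "qden e d q r"
  obtains x y z p n k where "q = (x, y, z)" "den e d x (nu p)" "den e d y (nu n)" "den e d z (nu k)"
    "0 < k" "r = mfrac p n k"
  using assms unfolding qden_def by (metis prod.collapse)

lemma qden_plus: "qden e d q r \<Longrightarrow> qden e d q' r' \<Longrightarrow> qden e d (q +\<^sub>Q q') (r + r')"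
  by (elim qdenE) (simp add: mfrac_plus qdenI den_plus den_times)

lemma qden_uminus: "qden e d q r \<Longrightarrow> qden e d (-\<^sub>Q q) (- r)"
  by (elim qdenE) (simp add: mfrac_uminus qdenI)

lemma qden_zero: "qden e d 0\<^sub>Q 0"
  unfolding qden_def rat_zero_def
  by (rule exI[of _ 0], rule exI[of _ 0], rule exI[of _ 1]) (auto simp: den_zero den_one mfrac_def)

lemma qden_one: "qden e d 1\<^sub>Q 1"
  unfolding qden_def rat_one_def
  by (rule exI[of _ 1], rule exI[of _ 0], rule exI[of _ 1]) (auto simp: den_zero den_one mfrac_def)

lemma qden_half_pow: "den e d x (nu k) \<Longrightarrow> qden e d (half_pow x) (hp k)"
  unfolding qden_def half_pow_def
  by (rule exI[of _ 1], rule exI[of _ 0], rule exI[of _ "pw k"])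
    (auto simp: den_zero den_one mfrac_def hp_def pw_pos intro: den_pow2)

lemma qden_twice_half_pow: "den e d x (nu k) \<Longrightarrow> qden e d (twice_half_pow x) (2 * hp k)"
  unfolding qden_def twice_half_pow_def
  by (rule exI[of _ "1 + 1"], rule exI[of _ 0], rule exI[of _ "pw k"])
    (auto simp: den_zero mfrac_def hp_def pw_pos simp del: one_add_one intro: den_pow2 den_plus den_one)

lemma qden_lift: "qden e d q r \<Longrightarrow> qden (b ## e) (Suc d) q r"
  by (elim qdenE) (simp add: qdenI den_lift)

lemma hold_rat_less: "qden e d q r \<Longrightarrow> qden e d q' r' \<Longrightarrow> hold e d (q <\<^sub>Q q') = (r < r')"
proof (elim qdenE)
  fix x y z p n k x' y' z' p' n' k'
  assume *: "q = (x, y, z)" "den e d x (nu p)" "den e d y (nu n)" "den e d z (nu k)" "0 < k" "r = mfrac p n k"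
    "q' = (x', y', z')" "den e d x' (nu p')" "den e d y' (nu n')" "den e d z' (nu k')" "0 < k'" "r' = mfrac p' n' k'"
  have "hold e d (x \<^bold>* z' \<^bold>+ y' \<^bold>* z \<^bold>< x' \<^bold>* z \<^bold>+ y \<^bold>* z') = (p * k' + n' * k < p' * k + n * k')"
    by (intro hold_less den_plus den_times *)
  then show ?thesis using * by (simp add: mfrac_less)
qed

lemma hold_rat_eq: "qden e d q r \<Longrightarrow> qden e d q' r' \<Longrightarrow> hold e d (q =\<^sub>Q q') = (r = r')"
proof (elim qdenE)
  fix x y z p n k x' y' z' p' n' k'
  assume *: "q = (x, y, z)" "den e d x (nu p)" "den e d y (nu n)" "den e d z (nu k)" "0 < k" "r = mfrac p n k"
    "q' = (x', y', z')" "den e d x' (nu p')" "den e d y' (nu n')" "den e d z' (nu k')" "0 < k'" "r' = mfrac p' n' k'"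
  have "hold e d (x \<^bold>* z' \<^bold>+ y' \<^bold>* z \<^bold>= x' \<^bold>* z \<^bold>+ y \<^bold>* z') = (p * k' + n' * k = p' * k + n * k')"
    by (intro hold_eq den_plus den_times *)
  then show ?thesis using * by (simp add: mfrac_eq)
qed

lemma hold_rat_le: "qden e d q r \<Longrightarrow> qden e d q' r' \<Longrightarrow> hold e d (q \<le>\<^sub>Q q') = (r \<le> r')"
  unfolding rat_le_def le_less by (intro hold_or hold_rat_less hold_rat_eq)

text \<open>\<open>den_lift\<close> comes last because its conclusion fits every denotation goal
  below a quantifier.\<close>

lemmas den_rules = den_var den_fapp den_Fapp den_zero den_one den_plus den_times den_lift

lemma hold_codes_rat:
  "den e d x (nu c) \<Longrightarrow> den e d y (nu p) \<Longrightarrow> den e d z (nu n) \<Longrightarrow> den e d w (nu k) \<Longrightarrow>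
    hold e d (codes_rat x y z w) = codes c p n k"
  unfolding codes_rat_def codes_def codes_pair_def conj_assoc
  by (rule hold_exN hold_and hold_or hold_eq den_rules | assumption)+

text \<open>A code has a triple, and any triple of it has the value \<open>rat_of c\<close>. Hence
  the three quantifiers of \<open>decode\<close> disappear from the meaning, provided that the
  meaning of the body depends on the value only.\<close>

lemma hold_decode:
  assumes x: "den e d x (nu c)"
    and F: "\<And>p n k. qden (nu k ## nu n ## nu p ## e) (Suc (Suc (Suc d))) (hv d, hv (Suc d), hv (Suc (Suc d))) (rat_of c) \<Longrightarrow>
      hold (nu k ## nu n ## nu p ## e) (Suc (Suc (Suc d))) (F (hv d, hv (Suc d), hv (Suc (Suc d)))) = P"
  shows "hold e d (decode x F) = P"
proof -
  let ?E = "\<lambda>p n k. nu k ## nu n ## nu p ## e" and ?d = "Suc (Suc (Suc d))"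
  let ?q = "(hv d, hv (Suc d), hv (Suc (Suc d)))"
  have "hold e d (decode x F) = (\<exists>p n k. codes c p n k \<and> hold (?E p n k) ?d (F ?q))"
    unfolding decode_def
    by (intro hold_exN hold_and hold_codes_rat refl) (rule den_rules x)+
  also have "\<dots> = (\<exists>p n k. codes c p n k \<and> P)"
  proof -
    have "hold (?E p n k) ?d (F ?q) = P" if "codes c p n k" for p n k
    proof (rule F)
      show "qden (?E p n k) ?d ?q (rat_of c)"
        unfolding qden_def using codes_rat_of[OF that] codes_pos[OF that]
        by (intro exI[of _ p] exI[of _ n] exI[of _ k]) (auto intro: den_var den_lift)
    qed
    then show ?thesis by blast
  qed
  also have "\<dots> = P" using codes_exists by blast
  finally show ?thesis .
qed

lemmas q_rules = hold_decode hold_rat_less hold_rat_le hold_rat_eq hold_and hold_or hold_not hold_imp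
  hold_allN hold_exN qden_plus qden_uminus qden_zero qden_one qden_half_pow qden_twice_half_pow
  den_rules qden_lift

section \<open>Counterparts in HOL of the formal notions of reals and sets\<close>

definition rat :: "tm set \<Rightarrow> mnat \<Rightarrow> mrat" where "rat f n = rat_of (f @@ n)"

definition isreal :: "tm set \<Rightarrow> bool" where
  "isreal f \<longleftrightarrow> (\<forall>n i. rat f n < rat f (n + i) + hp n \<and> rat f (n + i) < rat f n + hp n)"

lemma hold_is_real: "den e d x f \<Longrightarrow> f \<in> D ty1 \<Longrightarrow> hold e d (is_real x) = isreal f"
  unfolding is_real_def isreal_def rat_def dist_less_def
  by (assumption | rule q_rules)+

definition req :: "tm set \<Rightarrow> tm set \<Rightarrow> bool" where
  "req f g \<longleftrightarrow> (\<forall>n. rat f n \<le> rat g n + 2 * hp n \<and> rat g n \<le> rat f n + 2 * hp n)"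

definition gtr :: "tm set \<Rightarrow> mrat \<Rightarrow> bool" where "gtr f r \<longleftrightarrow> (\<exists>k. r + hp k < rat f k)"
definition ltr :: "tm set \<Rightarrow> mrat \<Rightarrow> bool" where "ltr f r \<longleftrightarrow> (\<exists>k. rat f k + hp k < r)"

definition unit :: "tm set \<Rightarrow> bool" where "unit f \<longleftrightarrow> isreal f \<and> \<not> ltr f 0 \<and> \<not> gtr f 1"

text \<open>Differences are spelt \<open>+ -\<close> here, as in \<open>plen\<close>, to match the
  operations of the formula when its meaning is found by resolution.\<close>

definition rdl :: "tm set \<Rightarrow> tm set \<Rightarrow> mnat \<Rightarrow> bool" where
  "rdl f g k \<longleftrightarrow> (\<exists>j. rat f j + - rat g j + 2 * hp j < hp k \<and> rat g j + - rat f j + 2 * hp j < hp k)"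

definition isset :: "tm set \<Rightarrow> bool" where
  "isset S \<longleftrightarrow> (\<forall>x\<in>D ty1. isreal x \<longrightarrow> (S @@@ x = 0 \<or> S @@@ x = 1) \<and>
     (\<forall>y\<in>D ty1. isreal y \<and> req x y \<longrightarrow> S @@@ x = S @@@ y))"

definition elm :: "tm set \<Rightarrow> tm set \<Rightarrow> bool" where "elm x S \<longleftrightarrow> isreal x \<and> S @@@ x = 1"

definition subunit :: "tm set \<Rightarrow> bool" where
  "subunit S \<longleftrightarrow> isset S \<and> (\<forall>x\<in>D ty1. elm x S \<longrightarrow> unit x)"

definition nonemp :: "tm set \<Rightarrow> bool" where "nonemp S \<longleftrightarrow> (\<exists>x\<in>D ty1. elm x S)"

definition enums :: "tm set \<Rightarrow> tm set \<Rightarrow> bool" where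
  "enums y S \<longleftrightarrow> (\<forall>m. isreal (y $$ nu m)) \<and> (\<forall>x\<in>D ty1. elm x S \<longrightarrow> (\<exists>m. req x (y $$ nu m)))"

definition enumb :: "tm set \<Rightarrow> bool" where "enumb S \<longleftrightarrow> (\<exists>y\<in>D (N \<rightarrow> ty1). enums y S)"

definition inclo :: "tm set \<Rightarrow> tm set \<Rightarrow> bool" where
  "inclo x S \<longleftrightarrow> isreal x \<and> (\<exists>y\<in>D (N \<rightarrow> ty1). enums y S \<and>
     (\<forall>k. \<exists>m. rdl x (y $$ nu m) k \<and> elm (y $$ nu m) S))"

definition covers :: "tm set \<Rightarrow> tm set \<Rightarrow> tm set \<Rightarrow> bool" where
  "covers a b S \<longleftrightarrow> (\<forall>i. rat a i \<le> rat b i) \<and>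
     (\<forall>x\<in>D ty1. inclo x S \<longrightarrow> (\<exists>i. gtr x (rat a i) \<and> ltr x (rat b i)))"

definition plen :: "tm set \<Rightarrow> tm set \<Rightarrow> tm set \<Rightarrow> bool" where
  "plen a b s \<longleftrightarrow> rat s 0 = 0 \<and> (\<forall>i. rat s (i + 1) = rat s i + (rat b i + - rat a i))"

definition posm :: "tm set \<Rightarrow> bool" where
  "posm S \<longleftrightarrow> (\<exists>k. \<forall>a\<in>D ty1. \<forall>b\<in>D ty1. \<forall>s\<in>D ty1. covers a b S \<and> plen a b s \<longrightarrow> (\<exists>m. hp k < rat s m))"

definition strc :: "tm set \<Rightarrow> bool" where
  "strc A \<longleftrightarrow> (\<exists>Y\<in>D ty2.
     (\<forall>x\<in>D ty1. \<forall>y\<in>D ty1. unit x \<and> unit y \<and> req x y \<longrightarrow> Y @@@ x = Y @@@ y) \<and>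
     (\<forall>x\<in>D ty1. \<forall>y\<in>D ty1. elm x A \<and> elm y A \<and> Y @@@ x = Y @@@ y \<longrightarrow> req x y) \<and>
     (\<forall>n. \<exists>x\<in>D ty1. elm x A \<and> Y @@@ x = n))"

lemma hold_real_eq:
  "den e d x f \<Longrightarrow> f \<in> D ty1 \<Longrightarrow> den e d y g \<Longrightarrow> g \<in> D ty1 \<Longrightarrow> hold e d (x =\<^sub>R y) = req f g"
  unfolding real_eq_def req_def rat_def dist_le_def
  by (assumption | rule q_rules)+

lemma hold_gtr: "den e d x f \<Longrightarrow> f \<in> D ty1 \<Longrightarrow> qden e d q r \<Longrightarrow> hold e d (rat_less_real q x) = gtr f r"
  unfolding rat_less_real_def gtr_def rat_def by (assumption | rule q_rules)+

lemma hold_ltr: "den e d x f \<Longrightarrow> f \<in> D ty1 \<Longrightarrow> qden e d q r \<Longrightarrow> hold e d (real_less_rat x q) = ltr f r"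
  unfolding real_less_rat_def ltr_def rat_def by (assumption | rule q_rules)+

lemma hold_unit: "den e d x f \<Longrightarrow> f \<in> D ty1 \<Longrightarrow> hold e d (in_unit_interval x) = unit f"
  unfolding in_unit_interval_def unit_def
  by (assumption | rule hold_is_real hold_ltr hold_gtr q_rules)+

lemma hold_rdl:
  "den e d x f \<Longrightarrow> f \<in> D ty1 \<Longrightarrow> den e d y g \<Longrightarrow> g \<in> D ty1 \<Longrightarrow> den e d z (nu k) \<Longrightarrow>
    hold e d (real_dist_less x y z) = rdl f g k"
  unfolding real_dist_less_def rdl_def rat_def by (assumption | rule q_rules)+

lemmas r_rules = hold_is_real hold_real_eq hold_gtr hold_ltr hold_unit hold_rdl hold_eq q_rules hold_all hold_ex

lemma hold_is_set: "den e d x S \<Longrightarrow> S \<in> D ty2 \<Longrightarrow> hold e d (is_set x) = isset S"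
  unfolding is_set_def isset_def by (assumption | rule r_rules)+

lemma hold_elem:
  "den e d x f \<Longrightarrow> f \<in> D ty1 \<Longrightarrow> den e d y S \<Longrightarrow> S \<in> D ty2 \<Longrightarrow> hold e d (elem x y) = elm f S"
  unfolding elem_def elm_def by (assumption | rule r_rules)+

lemma hold_subunit: "den e d x S \<Longrightarrow> S \<in> D ty2 \<Longrightarrow> hold e d (is_subset_of_unit_interval x) = subunit S"
  unfolding is_subset_of_unit_interval_def subunit_def
  by (assumption | rule hold_is_set hold_elem r_rules)+

lemma hold_nonempty: "den e d x S \<Longrightarrow> S \<in> D ty2 \<Longrightarrow> hold e d (nonempty x) = nonemp S"
  unfolding nonempty_def nonemp_def by (assumption | rule hold_elem r_rules)+

lemma seq_D: "y \<in> D (N \<rightarrow> \<tau>) \<Longrightarrow> y $$ nu m \<in> D \<tau>"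
  by (erule app_dom) (rule nu_D)

lemma hold_enumerates:
  "den e d x y \<Longrightarrow> y \<in> D (N \<rightarrow> ty1) \<Longrightarrow> den e d z S \<Longrightarrow> S \<in> D ty2 \<Longrightarrow> hold e d (enumerates x z) = enums y S"
  unfolding enumerates_def enums_def
  by (assumption | rule seq_D hold_elem r_rules den_app)+

lemma hold_enumerable: "den e d z S \<Longrightarrow> S \<in> D ty2 \<Longrightarrow> hold e d (enumerable z) = enumb S"
  unfolding enumerable_def enumb_def by (assumption | rule hold_enumerates r_rules)+

lemma hold_in_closure:
  "den e d x f \<Longrightarrow> f \<in> D ty1 \<Longrightarrow> den e d z S \<Longrightarrow> S \<in> D ty2 \<Longrightarrow> hold e d (in_closure x z) = inclo f S"
  unfolding in_closure_def inclo_def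
  by (assumption | rule seq_D hold_elem hold_enumerates r_rules den_app)+

lemma hold_covers:
  "den e d x a \<Longrightarrow> a \<in> D ty1 \<Longrightarrow> den e d y b \<Longrightarrow> b \<in> D ty1 \<Longrightarrow> den e d z S \<Longrightarrow> S \<in> D ty2 \<Longrightarrow>
    hold e d (covers_closure x y z) = covers a b S"
  unfolding covers_closure_def covers_def rat_def
  by (assumption | rule hold_in_closure r_rules)+

lemma hold_plen:
  "den e d x a \<Longrightarrow> a \<in> D ty1 \<Longrightarrow> den e d y b \<Longrightarrow> b \<in> D ty1 \<Longrightarrow> den e d z s \<Longrightarrow> s \<in> D ty1 \<Longrightarrow>
    hold e d (partial_lengths x y z) = plen a b s"
  unfolding partial_lengths_def plen_def rat_def by (assumption | rule r_rules)+

lemma hold_posm: "den e d z S \<Longrightarrow> S \<in> D ty2 \<Longrightarrow> hold e d (closure_has_positive_measure z) = posm S"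
  unfolding closure_has_positive_measure_def posm_def rat_def
  by (assumption | rule hold_covers hold_plen q_rules hold_all)+

lemma hold_strc: "den e d z S \<Longrightarrow> S \<in> D ty2 \<Longrightarrow> hold e d (strongly_countable z) = strc S"
  unfolding strongly_countable_def strc_def by (assumption | rule hold_elem r_rules)+

section \<open>The four principles read in the counter-model\<close>

definition "QF = (\<forall>Y\<in>D (ty1 \<rightarrow> ty1). (\<forall>n. \<exists>f\<in>D ty1. (Y $$ f) @@ n = 0) \<longrightarrow>
  (\<exists>f\<in>D (N \<rightarrow> ty1). \<forall>n. (Y $$ (f $$ nu n)) @@ n = 0))"

definition "CN = (\<forall>S\<in>D (N \<rightarrow> ty2). (\<forall>n. subunit (S $$ nu n) \<and> enumb (S $$ nu n) \<and> nonemp (S $$ nu n)) \<longrightarrow>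
  (\<exists>x\<in>D (N \<rightarrow> ty1). \<forall>n. inclo (x $$ nu n) (S $$ nu n)))"

definition "CP = (\<forall>S\<in>D (N \<rightarrow> ty2). (\<forall>n. subunit (S $$ nu n) \<and> enumb (S $$ nu n) \<and> posm (S $$ nu n)) \<longrightarrow>
  (\<exists>x\<in>D (N \<rightarrow> ty1). \<forall>n. inclo (x $$ nu n) (S $$ nu n)))"

definition "CO = (\<forall>A\<in>D ty2. subunit A \<and> strc A \<longrightarrow> enumb A)"

lemma hold_QF: "hold e d QF_AC_01 = QF"
  unfolding QF_AC_01_def QF_def
  by (assumption | rule r_rules den_app seq_D | (rule app_dom, assumption))+

lemma hold_CN: "hold e d closure_choice_nonempty = CN"
  unfolding closure_choice_nonempty_def CN_def
  by (assumption | rule seq_D hold_subunit hold_enumerable hold_nonempty hold_in_closure r_rules den_app)+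

lemma hold_CP: "hold e d closure_choice_positive_measure = CP"
  unfolding closure_choice_positive_measure_def CP_def
  by (assumption | rule seq_D hold_subunit hold_enumerable hold_posm hold_in_closure r_rules den_app)+

lemma hold_CO: "hold e d cocode_1 = CO"
  unfolding cocode_1_def CO_def
  by (assumption | rule hold_subunit hold_enumerable hold_strc r_rules)+

lemma truth_implications:
  "truth CM ((QF_AC_01 \<^bold>\<longrightarrow> closure_choice_nonempty) 0) = (QF \<longrightarrow> CN)"
  "truth CM ((closure_choice_nonempty \<^bold>\<longrightarrow> closure_choice_positive_measure) 0) = (CN \<longrightarrow> CP)"
  "truth CM ((closure_choice_positive_measure \<^bold>\<longrightarrow> cocode_1) 0) = (CP \<longrightarrow> CO)"
  using hold_QF hold_CN hold_CP hold_CO by (simp_all add: truth_def hold_def himp_def)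


section \<open>Choice from enumerable sets\<close>

lemma qdf_rat: "dfn \<Gamma> ty1 F \<Longrightarrow> ndf \<Gamma> G \<Longrightarrow> qdf \<Gamma> (\<lambda>e. rat (F e) (G e))"
  unfolding rat_def by (intro qdf_rat_of ndf_fapp)

lemma dec_isreal: "dfn \<Gamma> ty1 F \<Longrightarrow> dec \<Gamma> (\<lambda>e. isreal (F e))"
proof -
  assume "dfn \<Gamma> ty1 F"
  from dfn_weaken[OF dfn_weaken[OF this, where \<sigma> = N], where \<sigma> = N]
  have F: "dfn (N # N # \<Gamma>) ty1 (\<lambda>e. F (\<lambda>i. e (Suc (Suc i))))" .
  show ?thesis unfolding isreal_def
    by (intro ndec_all dec_conj dec_qless qdf_plus qdf_hp qdf_rat F ndf_plus ndf_var) simp_all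
qed

lemma dec_elm: "dfn \<Gamma> ty1 F \<Longrightarrow> dfn \<Gamma> ty2 G \<Longrightarrow> dec \<Gamma> (\<lambda>e. elm (F e) (G e))"
  unfolding elm_def by (intro dec_conj dec_isreal ndec_eq ndf_Fapp ndf_const)

lemma dec_gtr: "dfn \<Gamma> ty1 F \<Longrightarrow> qdf \<Gamma> G \<Longrightarrow> dec \<Gamma> (\<lambda>e. gtr (F e) (G e))"
  unfolding gtr_def
  by (intro ndec_ex dec_qless qdf_plus qdf_hp qdf_rat dfn_weaken qdf_weaken ndf_var) simp_all

lemma dec_ltr: "dfn \<Gamma> ty1 F \<Longrightarrow> qdf \<Gamma> G \<Longrightarrow> dec \<Gamma> (\<lambda>e. ltr (F e) (G e))"
  unfolding ltr_def
  by (intro ndec_ex dec_qless qdf_plus qdf_hp qdf_rat dfn_weaken qdf_weaken ndf_var) simp_all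

lemma dec_unit: "dfn \<Gamma> ty1 F \<Longrightarrow> dec \<Gamma> (\<lambda>e. unit (F e))"
  unfolding unit_def by (intro dec_conj dec_not dec_isreal dec_gtr dec_ltr qdf_const)

lemma dfn_seq_app: "S \<in> D (N \<rightarrow> \<tau>) \<Longrightarrow> ndf \<Gamma> F \<Longrightarrow> dfn \<Gamma> \<tau> (\<lambda>e. S $$ nu (F e))"
  by (rule dfn.app[OF dfn.par dfn_nu])

lemma hp_suc2: "hp (k + 2) = hp k / 4" and hp_suc3: "hp (k + 3) = hp k / 8"
  and hp_suc4: "hp (k + 4) = hp k / 16" and hp_suc5: "hp (k + 5) = hp k / 32"
proof -
  have "k + 2 = k + 1 + 1" "k + 3 = k + 2 + 1" "k + 4 = k + 3 + 1" "k + 5 = k + 4 + 1"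
    by (simp_all add: add.assoc)
  then have "hp (k + 2) = hp k / 2 / 2" "hp (k + 3) = hp (k + 2) / 2" "hp (k + 4) = hp (k + 3) / 2"
    "hp (k + 5) = hp (k + 4) / 2" by (simp_all only: hp_suc)
  then show "hp (k + 2) = hp k / 4" "hp (k + 3) = hp k / 8" "hp (k + 4) = hp k / 16" "hp (k + 5) = hp k / 32"
    by linarith+
qed

lemma req_rdl: "req f g \<Longrightarrow> rdl f g k"
  unfolding rdl_def
\<comment> \<open>At this precision the deviation is at most two and the error term exactly two
  times \<open>hp k / 8\<close>, together half of \<open>hp k\<close>.\<close>
proof (rule exI[of _ "k + 3"])
  assume "req f g"
  then have "rat f (k + 3) \<le> rat g (k + 3) + 2 * hp (k + 3)" "rat g (k + 3) \<le> rat f (k + 3) + 2 * hp (k + 3)"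
    by (auto simp: req_def)
  then show "rat f (k + 3) + - rat g (k + 3) + 2 * hp (k + 3) < hp k \<and>
      rat g (k + 3) + - rat f (k + 3) + 2 * hp (k + 3) < hp k"
    using hp_pos[of k] unfolding hp_suc3 by linarith
qed

lemma isset_req: "isset S \<Longrightarrow> elm x S \<Longrightarrow> isreal y \<Longrightarrow> req x y \<Longrightarrow> x \<in> D ty1 \<Longrightarrow> y \<in> D ty1 \<Longrightarrow> elm y S"
  unfolding isset_def elm_def by metis

text \<open>An element equals some member of the enumeration, and that member belongs to
  \<open>S\<close> because sets respect equality of reals; it serves for all \<open>k\<close> at
  once.\<close>

lemma elm_inclo:
  assumes "S \<in> D ty2" "subunit S" "enumb S" "x \<in> D ty1" "elm x S"
  shows "inclo x S"
proof -
  obtain y where y: "y \<in> D (N \<rightarrow> ty1)" "enums y S" using assms(3) by (auto simp: enumb_def)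
  obtain m where m: "req x (y $$ nu m)" using y(2) assms(4,5) by (auto simp: enums_def)
  have "elm (y $$ nu m) S"
    using isset_req[of S x "y $$ nu m"] assms y m seq_D[OF y(1)] by (auto simp: subunit_def enums_def)
  then have "\<forall>k. \<exists>m. rdl x (y $$ nu m) k \<and> elm (y $$ nu m) S" using req_rdl[OF m] by blast
  then show ?thesis unfolding inclo_def using y assms(5) by (auto simp: elm_def)
qed

lemma QF_CN: "QF \<longrightarrow> CN"
  unfolding CN_def
proof (intro HOL.impI ballI)
  fix S assume QF and S: "S \<in> D (N \<rightarrow> ty2)"
    and H: "\<forall>n. subunit (S $$ nu n) \<and> enumb (S $$ nu n) \<and> nonemp (S $$ nu n)"
  \<comment> \<open>Zero exactly for the elements of the \<open>n\<close>-th set, so that the choice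
    principle yields elements.\<close>
  let ?G = "\<lambda>n f. if elm f (S $$ nu n) then 0 else 1 :: mnat"
  let ?Y = "lam ty1 ty1 (\<lambda>f. fun1 (\<lambda>n. ?G n f))"
  have G: "ndf (N # ty1 # \<Gamma>) (\<lambda>e. ?G (nm (e 0)) (e (Suc 0)))" for \<Gamma>
    by (intro ndf_if dec_elm dfn_seq_app[OF S] ndf_var ndf_const dfn.var) simp_all
  have Yd: "dfn [ty1] ty1 (\<lambda>e. fun1 (\<lambda>n. ?G n (e 0)))"
    by (rule dfn_fun1) (rule G)
  have Y: "?Y \<in> D (ty1 \<rightarrow> ty1)" using Yd by (rule lam_D)
  have Y_app: "(?Y $$ f) @@ n = ?G n f" if "f \<in> D ty1" for f n
  proof -
    have "?Y $$ f = fun1 (\<lambda>n. ?G n f)" using Yd that by (rule lam_app)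
    moreover have "ndf [N] (\<lambda>e. ?G (nm (e 0)) f)"
      using that by (intro ndf_if dec_elm dfn_seq_app[OF S] ndf_var ndf_const dfn.par) simp_all
    ultimately show ?thesis by (simp add: fun1)
  qed
  have "\<forall>n. \<exists>f\<in>D ty1. (?Y $$ f) @@ n = 0" using H Y_app by (auto simp: nonemp_def)
  then obtain f where f: "f \<in> D (N \<rightarrow> ty1)" "\<forall>n. (?Y $$ (f $$ nu n)) @@ n = 0"
    using \<open>QF\<close> Y unfolding QF_def by blast
  have "elm (f $$ nu n) (S $$ nu n)" for n
    using f(2) Y_app[OF seq_D[OF f(1)], of n n] by (auto split: if_splits)
  then have "inclo (f $$ nu n) (S $$ nu n)" for n
    using elm_inclo[OF seq_D[OF S] _ _ seq_D[OF f(1)]] H by blast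
  then show "\<exists>x\<in>D (N \<rightarrow> ty1). \<forall>n. inclo (x $$ nu n) (S $$ nu n)" using f(1) by blast
qed

lemma rat_fun1: "qdf [N] (\<lambda>e. F (nm (e 0))) \<Longrightarrow> rat (fun1 (\<lambda>n. code_of (F n))) n = F n"
  unfolding rat_def by (subst fun1) (simp_all add: ndf_code_of)

lemma rat_fun1_D: "qdf [N] (\<lambda>e. F (nm (e 0))) \<Longrightarrow> fun1 (\<lambda>n. code_of (F n)) \<in> D ty1"
  by (rule fun1_D) (rule ndf_code_of)

lemma posm_nonemp:
  assumes "posm S"
  shows "nonemp S"
proof (rule ccontr)
  assume "\<not> nonemp S"
  then have "\<not> inclo x S" for x unfolding nonemp_def inclo_def using seq_D by blast
  \<comment> \<open>The zero sequence acts as left end-points, right end-points and partial lengths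
    simultaneously.\<close>
  moreover let ?z = "fun1 (\<lambda>n. code_of 0)"
  have q: "qdf [N] (\<lambda>e. 0)" by (rule qdf_const)
  have z: "rat ?z n = 0" for n using rat_fun1[of "\<lambda>n. 0", OF q] .
  ultimately have "covers ?z ?z S \<and> plen ?z ?z ?z" by (simp add: covers_def plen_def)
  then obtain k m where "hp k < rat ?z m"
    using assms rat_fun1_D[of "\<lambda>n. 0", OF q] unfolding posm_def by blast
  then show False using hp_pos[of k] z by simp
qed

lemma CN_CP: "CN \<longrightarrow> CP"
  unfolding CN_def CP_def using posm_nonemp by blast


section \<open>A point outside a small cover\<close>

lemma real_close: "isreal f \<Longrightarrow> hp n \<le> B \<Longrightarrow> hp m \<le> B \<Longrightarrow> rat f n < rat f m + B"
proof -
  assume f: "isreal f" and B: "hp n \<le> B" "hp m \<le> B"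
  have "(\<exists>k. m = n + k) \<or> (\<exists>k. n = m + k)" using linorder_le_cases[of n m] by (auto simp: less_eq_mnat_def)
  then show ?thesis
  proof (elim disjE exE)
    fix k assume "m = n + k"
    then have "rat f n < rat f m + hp n" using f by (simp add: isreal_def)
    then show ?thesis using B by linarith
  next
    fix k assume "n = m + k"
    then have "rat f n < rat f m + hp m" using f by (simp add: isreal_def)
    then show ?thesis using B by linarith
  qed
qed

text \<open>Length of the part of \<open>(a, b)\<close> inside \<open>[lo, hi]\<close>; the maximum
  with 0 takes care of disjoint intervals.\<close>

definition ilen :: "mrat \<Rightarrow> mrat \<Rightarrow> mrat \<Rightarrow> mrat \<Rightarrow> mrat" where
  "ilen lo hi a b = max 0 (min hi b - max lo a)"

lemma ilen_split: "lo \<le> mid \<Longrightarrow> mid \<le> hi \<Longrightarrow> a \<le> b \<Longrightarrow> ilen lo hi a b = ilen lo mid a b + ilen mid hi a b"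
  unfolding ilen_def max_def min_def by (auto split: if_splits)

lemma ilen_le: "a \<le> b \<Longrightarrow> ilen lo hi a b \<le> b - a"
  unfolding ilen_def max_def min_def by (auto split: if_splits)

lemma ilen_nonneg: "0 \<le> ilen lo hi a b"
  by (simp add: ilen_def)

text \<open>Bisection: an interval of length \<open>h\<close> is kept as long as the cover fills at most half of it. If
  this failed for both halves of an interval, then it would fail for the whole interval.\<close>

lemma small_cover:
  assumes a: "a \<in> D ty1" and b: "b \<in> D ty1" and sD: "s \<in> D ty1" and ab: "\<And>i. rat a i \<le> rat b i"
    and s: "plen a b s" "\<And>m. rat s m \<le> hp (K + 1)"
  shows "\<exists>x\<in>D ty1. isreal x \<and> (\<forall>i. l \<le> rat x i \<and> rat x i \<le> l + hp K) \<and>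
    (\<forall>i. \<not> (gtr x (rat a i) \<and> ltr x (rat b i)))"
proof -
  \<comment> \<open>Left end of the \<open>z\<close>-th dyadic subinterval of depth
    \<open>j\<close>, whose length is \<open>hp (K + j)\<close>. Below, \<open>sm j z m\<close> adds
    up how much of it the first \<open>m\<close> intervals of the cover fill.\<close>
  define lo where "lo j z = l + q_of z * hp (K + j)" for j z
  define il where "il j z i = ilen (lo j z) (lo j z + hp (K + j)) (rat a i) (rat b i)" for j z i
  define sm where "sm j z m = rat_of (nrec (\<lambda>i c. code_of (rat_of c + il j z i)) (code_of 0) m)" for j z m
  \<comment> \<open>The bound is half the length of the subinterval. The quantifier over all stages
    \<open>m\<close> is decidable in the model, so the bisection may branch on it.\<close>
  define good where "good j z \<longleftrightarrow> (\<forall>m. sm j z m \<le> hp (K + j + 1))" for j z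
  \<comment> \<open>The children of interval \<open>z\<close> have numbers \<open>2z\<close> and
    \<open>2z + 1\<close>. Only the left one is tested; if it fails, \<open>good_step\<close>
    guarantees the right one.\<close>
  define zf where "zf j = nrec (\<lambda>j z. if good (j + 1) (z + z) then z + z else z + z + 1) 0 j" for j
  have qdf_lo: "qdf \<Gamma> (\<lambda>e. lo (J e) (Z e))" if "ndf \<Gamma> J" "ndf \<Gamma> Z" for \<Gamma> J Z
    unfolding lo_def by (intro qdf_intros that)
  have qdf_il: "qdf \<Gamma> (\<lambda>e. il (J e) (Z e) (I e))" if "ndf \<Gamma> J" "ndf \<Gamma> Z" "ndf \<Gamma> I" for \<Gamma> J Z I
    unfolding il_def ilen_def
    by (intro qdf_max qdf_min qdf_minus qdf_plus qdf_hp qdf_const qdf_lo qdf_rat ndf_plus ndf_const dfn.par a b that)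
  have qdf_sm: "qdf \<Gamma> (\<lambda>e. sm (J e) (Z e) (L e))" if *: "ndf \<Gamma> J" "ndf \<Gamma> Z" "ndf \<Gamma> L" for \<Gamma> J Z L
    unfolding sm_def
    by (intro qdf_rat_of ndf_rec ndf_code_of qdf_plus qdf_il ndf_var ndf_const qdf_const *
      ndf_weaken[OF ndf_weaken[OF *(1)]] ndf_weaken[OF ndf_weaken[OF *(2)]]) simp_all
  have sm_zero: "sm j z 0 = 0" and sm_suc: "sm j z (m + 1) = sm j z m + il j z m" for j z m
  proof -
    have "ndf [N, N] (\<lambda>e. code_of (rat_of (nm (e 0)) + il j z (nm (e 1))))"
      by (intro ndf_code_of qdf_plus qdf_rat_of qdf_il ndf_var ndf_const) simp_all
    from nrec[of "\<lambda>i c. code_of (rat_of c + il j z i)", OF this]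
    show "sm j z 0 = 0" "sm j z (m + 1) = sm j z m + il j z m" by (simp_all add: sm_def)
  qed
  have dec_good: "dec \<Gamma> (\<lambda>e. good (J e) (Z e))" if "ndf \<Gamma> J" "ndf \<Gamma> Z" for \<Gamma> J Z
    unfolding good_def
    by (intro ndec_all dec_qle qdf_sm qdf_hp ndf_plus ndf_const ndf_var ndf_weaken that) simp_all
  have step: "ndf (N # N # \<Gamma>) (\<lambda>e. if good (nm (e 1) + 1) (nm (e 0) + nm (e 0))
      then nm (e 0) + nm (e 0) else nm (e 0) + nm (e 0) + 1)" for \<Gamma>
    by (intro ndf_if dec_good ndf_plus ndf_var ndf_const) simp_all
  have ndf_zf: "ndf \<Gamma> (\<lambda>e. zf (J e))" if "ndf \<Gamma> J" for \<Gamma> J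
    unfolding zf_def by (intro ndf_rec step ndf_const that)
  have zf_zero: "zf 0 = 0"
    and zf_suc: "zf (j + 1) = (if good (j + 1) (zf j + zf j) then zf j + zf j else zf j + zf j + 1)" for j
    using nrec[of "\<lambda>j z. if good (j + 1) (z + z) then z + z else z + z + 1", OF step]
    by (simp_all add: zf_def)
  have h: "hp (K + (j + 1)) = hp (K + j) / 2" for j
    using hp_suc[of "K + j"] by (simp only: add.assoc)
  have sm_nonneg: "0 \<le> sm j z m" for j z m
  proof (rule minduct[where P = "\<lambda>m. 0 \<le> sm j z m"])
    show "dec [N] (\<lambda>e. 0 \<le> sm j z (nm (e 0)))"
      by (intro dec_qle qdf_const qdf_sm ndf_const ndf_var) simp_all
  qed (simp_all add: sm_zero sm_suc il_def ilen_nonneg)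
  have sm_mono: "sm j z m \<le> sm j z (m + i)" for j z m i
  proof (rule minduct[where P = "\<lambda>i. sm j z m \<le> sm j z (m + i)"])
    show "dec [N] (\<lambda>e. sm j z m \<le> sm j z (m + nm (e 0)))"
      by (intro dec_qle qdf_sm ndf_plus ndf_const ndf_var) simp_all
    show "sm j z m \<le> sm j z (m + (n + 1))" if "sm j z m \<le> sm j z (m + n)" for n
      using that sm_suc[of j z "m + n"] ilen_nonneg unfolding il_def add.assoc[symmetric]
      by (metis add_increasing2)
  qed simp
  have lo_left: "lo (j + 1) (z + z) = lo j z"
    and lo_right: "lo (j + 1) (z + z + 1) = lo j z + hp (K + (j + 1))" for j z
    by (simp_all only: lo_def h q_of_simps) (simp_all add: field_simps)
  have il_split: "il j z i = il (j + 1) (z + z) i + il (j + 1) (z + z + 1) i" for j z i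
  proof -
    have eq: "lo j z + hp (K + j) = lo j z + hp (K + (j + 1)) + hp (K + (j + 1))" by (simp add: h)
    show ?thesis
      unfolding il_def lo_left lo_right eq
      by (rule ilen_split) (use ab[of i] hp_pos[of "K + (j + 1)"] in \<open>simp_all add: less_imp_le\<close>)
  qed
  have sm_split: "sm j z m = sm (j + 1) (z + z) m + sm (j + 1) (z + z + 1) m" for j z m
  proof (rule minduct[where P = "\<lambda>m. sm j z m = sm (j + 1) (z + z) m + sm (j + 1) (z + z + 1) m"])
    show "dec [N] (\<lambda>e. sm j z (nm (e 0)) = sm (j + 1) (z + z) (nm (e 0)) + sm (j + 1) (z + z + 1) (nm (e 0)))"
      by (intro dec_qeq qdf_plus qdf_sm ndf_const ndf_var) simp_all
    show "sm j z (n + 1) = sm (j + 1) (z + z) (n + 1) + sm (j + 1) (z + z + 1) (n + 1)"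
      if "sm j z n = sm (j + 1) (z + z) n + sm (j + 1) (z + z + 1) n" for n
      unfolding sm_suc that using il_split[of j z n] by simp
  qed (simp add: sm_zero)
  have good_step: "good (j + 1) (z + z) \<or> good (j + 1) (z + z + 1)" if "good j z" for j z
  proof (rule ccontr)
    assume "\<not> ?thesis"
    then obtain m1 m2 where "hp (K + (j + 1) + 1) < sm (j + 1) (z + z) m1"
      "hp (K + (j + 1) + 1) < sm (j + 1) (z + z + 1) m2"
      by (auto simp: good_def not_le)
    \<comment> \<open>The two halves may exceed their bounds at different stages; monotonicity
      brings both to the common stage \<open>m1 + m2\<close>, where the sums can be added.\<close>
    moreover have "sm (j + 1) (z + z) m1 \<le> sm (j + 1) (z + z) (m1 + m2)"
      "sm (j + 1) (z + z + 1) m2 \<le> sm (j + 1) (z + z + 1) (m1 + m2)"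
      using sm_mono[of _ _ m2 m1] sm_mono by (simp_all add: add.commute)
    moreover have "sm j z (m1 + m2) \<le> hp (K + j + 1)" using that by (simp add: good_def)
    ultimately show False
      using sm_split[of j z "m1 + m2"] hp_suc[of "K + (j + 1)"] h[of j] hp_suc[of "K + j"] by linarith
  qed
  have good_zf: "good j (zf j)" for j
  proof (rule minduct[where P = "\<lambda>j. good j (zf j)"])
    show "dec [N] (\<lambda>e. good (nm (e 0)) (zf (nm (e 0))))"
      by (intro dec_good ndf_zf ndf_var) simp_all
    \<comment> \<open>At the root, an interval of the cover contributes at most its whole length, so
      the sums stay below the given partial lengths.\<close>
    have "sm 0 0 m \<le> rat s m" for m
    proof (rule minduct[where P = "\<lambda>m. sm 0 0 m \<le> rat s m"])
      show "dec [N] (\<lambda>e. sm 0 0 (nm (e 0)) \<le> rat s (nm (e 0)))"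
        by (intro dec_qle qdf_sm qdf_rat dfn.par sD ndf_const ndf_var) simp_all
      show "sm 0 0 0 \<le> rat s 0" using s(1) by (simp add: sm_zero plen_def)
      show "sm 0 0 (n + 1) \<le> rat s (n + 1)" if "sm 0 0 n \<le> rat s n" for n
        using that s(1) ilen_le[OF ab[of n], of "lo 0 0" "lo 0 0 + hp (K + 0)"]
        unfolding sm_suc plen_def il_def by force
    qed
    then have "sm 0 0 m \<le> hp (K + 1)" for m by (rule order_trans) (rule s(2))
    then show "good 0 (zf 0)" by (simp add: good_def zf_zero)
    show "good (n + 1) (zf (n + 1))" if "good n (zf n)" for n
      using good_step[OF that] by (auto simp: zf_suc)
  qed
  define X where "X j = lo j (zf j)" for j
  have nested: "X j \<le> X (j + i) \<and> X (j + i) + hp (K + (j + i)) \<le> X j + hp (K + j)" for j i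
  proof (rule minduct[where P = "\<lambda>i. X j \<le> X (j + i) \<and> X (j + i) + hp (K + (j + i)) \<le> X j + hp (K + j)"])
    show "dec [N] (\<lambda>e. X j \<le> X (j + nm (e 0)) \<and> X (j + nm (e 0)) + hp (K + (j + nm (e 0))) \<le> X j + hp (K + j))"
      unfolding X_def
      by (intro dec_conj dec_qle qdf_plus qdf_hp qdf_lo ndf_zf ndf_plus ndf_const ndf_var) simp_all
    fix i assume IH: "X j \<le> X (j + i) \<and> X (j + i) + hp (K + (j + i)) \<le> X j + hp (K + j)"
    have "X (j + i + 1) = X (j + i) \<or> X (j + i + 1) = X (j + i) + hp (K + (j + i + 1))"
      unfolding X_def zf_suc using lo_left lo_right by auto
    then show "X j \<le> X (j + (i + 1)) \<and> X (j + (i + 1)) + hp (K + (j + (i + 1))) \<le> X j + hp (K + j)"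
      using IH h[of "j + i"] hp_pos[of "K + (j + i)"] unfolding add.assoc by linarith
  qed simp
  let ?x = "fun1 (\<lambda>j. code_of (X j))"
  have q: "qdf [N] (\<lambda>e. X (nm (e 0)))" unfolding X_def by (intro qdf_lo ndf_zf ndf_var) simp_all
  have x: "rat ?x j = X j" for j by (rule rat_fun1[OF q])
  have "isreal ?x"
    unfolding isreal_def x
  proof (intro HOL.allI)
    fix n i
    have "hp (K + n) \<le> hp n" using hp_add[of n K] by (simp add: add.commute)
    then show "X n < X (n + i) + hp n \<and> X (n + i) < X n + hp n"
      using nested[of n i] hp_pos[of n] hp_pos[of "K + (n + i)"] by linarith
  qed
  moreover have "X 0 = l" by (simp add: X_def zf_zero lo_def)
  then have "l \<le> X i \<and> X i \<le> l + hp K" for i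
    using nested[of 0 i] hp_pos[of "K + i"] unfolding add_0 add_0_right by linarith
  moreover have "\<not> (gtr ?x (rat a i) \<and> ltr ?x (rat b i))" for i
  proof
    assume "gtr ?x (rat a i) \<and> ltr ?x (rat b i)"
    then obtain k1 k2 where k: "rat a i + hp k1 < X k1" "X k2 + hp k2 < rat b i"
      by (auto simp: gtr_def ltr_def x)
    \<comment> \<open>If the limit lay in \<open>(a i, b i)\<close>, then at depth
      \<open>k1 + k2\<close> the kept interval would lie in it entirely. Interval \<open>i\<close>
      alone would fill it, although the cover fills at most half.\<close>
    let ?j = "k1 + k2"
    have "rat a i < X ?j" using k(1) nested[of k1 k2] hp_pos[of k1] by linarith
    moreover have "X ?j + hp (K + ?j) < rat b i"
      using k(2) nested[of k2 k1] hp_add[of k2 K] by (simp add: add.commute)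
    ultimately have "il ?j (zf ?j) i = hp (K + ?j)"
      using less_imp_le[OF hp_pos[of "K + ?j"]] by (simp add: il_def ilen_def X_def max_def min_def)
    moreover have "sm ?j (zf ?j) (i + 1) \<le> hp (K + ?j + 1)" using good_zf by (simp add: good_def)
    ultimately show False
      using sm_nonneg[of ?j "zf ?j" i] hp_suc[of "K + ?j"] hp_pos[of "K + ?j"] unfolding sm_suc by linarith
  qed
  ultimately show ?thesis using rat_fun1_D[OF q] x by (intro bexI[of _ ?x]) auto
qed


section \<open>Strongly countable sets\<close>

text \<open>Adding the same rational to every approximation preserves the rate of convergence, so no
  re-indexing takes place.\<close>

definition addr :: "tm set \<Rightarrow> mrat \<Rightarrow> tm set" where
  "addr f q = fun1 (\<lambda>n. code_of (rat f n + q))"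

lemma rat_addr: "f \<in> D ty1 \<Longrightarrow> rat (addr f q) n = rat f n + q"
  and addr_D: "f \<in> D ty1 \<Longrightarrow> addr f q \<in> D ty1"
proof -
  assume f: "f \<in> D ty1"
  have "qdf [N] (\<lambda>e. rat f (nm (e 0)) + q)"
    using f by (intro qdf_plus qdf_rat qdf_const dfn.par ndf_var) simp_all
  then show "rat (addr f q) n = rat f n + q" "addr f q \<in> D ty1"
    unfolding addr_def by (rule rat_fun1, rule rat_fun1_D)
qed

lemma dfn_addr: "dfn \<Gamma> ty1 F \<Longrightarrow> qdf \<Gamma> Q \<Longrightarrow> dfn \<Gamma> ty1 (\<lambda>e. addr (F e) (Q e))"
  unfolding addr_def
  by (intro dfn_fun1 ndf_code_of qdf_plus qdf_rat dfn_weaken qdf_weaken ndf_var) simp_all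

lemma isreal_addr: "f \<in> D ty1 \<Longrightarrow> isreal (addr f q) \<longleftrightarrow> isreal f"
  by (auto simp: isreal_def rat_addr add.commute add.left_commute)

lemma req_sym: "req x y \<Longrightarrow> req y x"
  by (auto simp: req_def)

lemma req_addr: "x \<in> D ty1 \<Longrightarrow> y \<in> D ty1 \<Longrightarrow> req x y \<Longrightarrow> req (addr x q) (addr y q)"
  unfolding req_def rat_addr
proof (rule HOL.allI)
  fix n assume "\<forall>n. rat x n \<le> rat y n + 2 * hp n \<and> rat y n \<le> rat x n + 2 * hp n"
  then show "rat x n + q \<le> rat y n + q + 2 * hp n \<and> rat y n + q \<le> rat x n + q + 2 * hp n"
    by (simp add: add.commute add.left_commute)
qed

lemma req_addr_swap: "x \<in> D ty1 \<Longrightarrow> w \<in> D ty1 \<Longrightarrow> req (addr x q) w \<Longrightarrow> req x (addr w (- q))"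
  unfolding req_def
proof (rule HOL.allI)
  fix n assume D: "x \<in> D ty1" "w \<in> D ty1"
    and "\<forall>n. rat (addr x q) n \<le> rat w n + 2 * hp n \<and> rat w n \<le> rat (addr x q) n + 2 * hp n"
  then have "rat x n + q \<le> rat w n + 2 * hp n \<and> rat w n \<le> rat x n + q + 2 * hp n"
    by (simp add: rat_addr)
  then show "rat x n \<le> rat (addr w (- q)) n + 2 * hp n \<and> rat (addr w (- q)) n \<le> rat x n + 2 * hp n"
    unfolding rat_addr[OF D(2)] by linarith
qed

lemma unit_iff: "isreal x \<Longrightarrow> unit x \<longleftrightarrow> (\<forall>k. - hp k \<le> rat x k \<and> rat x k \<le> 1 + hp k)"
proof -
  assume "isreal x"
  have "rat x k + hp k < 0 \<longleftrightarrow> \<not> - hp k \<le> rat x k" "1 + hp k < rat x k \<longleftrightarrow> \<not> rat x k \<le> 1 + hp k" for k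
    by linarith+
  then show ?thesis using \<open>isreal x\<close> by (auto simp: unit_def ltr_def gtr_def)
qed

text \<open>At index \<open>k\<close> itself equality of reals only gives a tolerance of
  \<open>2 * hp k\<close>, too coarse for \<open>unit_iff\<close>. The comparison is therefore made
  at a late index \<open>?t\<close>, and the loss there is arbitrarily small.\<close>

lemma unit_req:
  assumes "unit x" "isreal y" "req x y"
  shows "unit y"
proof -
  have x: "isreal x" using assms(1) by (simp add: unit_def)
  have "- hp k \<le> rat y k \<and> rat y k \<le> 1 + hp k" for k
  proof -
    have "rat y k < r" if r: "1 + hp k < r" for r
    proof -
      \<comment> \<open>The detour costs \<open>hp ?t\<close> for the bound on \<open>x\<close> and
        \<open>2 * hp ?t\<close> for the equality; the factor 4 leaves room for all three.\<close>
      obtain t0 where "hp t0 < (r - (1 + hp k)) / 4" using hp_archimedean[of "(r - (1 + hp k)) / 4"] r by auto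
      then have t0: "4 * hp t0 < r - (1 + hp k)" by simp
      let ?t = "t0 + k"
      have t: "hp ?t \<le> hp t0" "hp ?t \<le> hp k" using hp_add[of t0 k] hp_add[of k t0] by (simp_all add: add.commute)
      have "rat x ?t \<le> 1 + hp ?t" using assms(1) unit_iff[OF x] by blast
      moreover have "rat y ?t \<le> rat x ?t + 2 * hp ?t" using assms(3) by (simp add: req_def)
      moreover have "rat y k < rat y ?t + hp k" using real_close[OF assms(2), of k "hp k" ?t] t by simp
      ultimately show ?thesis using t t0 hp_pos[of t0] by linarith
    qed
    moreover have "r < rat y k" if r: "r < - hp k" for r
    proof -
      obtain t0 where "hp t0 < (- hp k - r) / 4" using hp_archimedean[of "(- hp k - r) / 4"] r by auto
      then have t0: "4 * hp t0 < - hp k - r" by simp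
      let ?t = "t0 + k"
      have t: "hp ?t \<le> hp t0" "hp ?t \<le> hp k" using hp_add[of t0 k] hp_add[of k t0] by (simp_all add: add.commute)
      have "- hp ?t \<le> rat x ?t" using assms(1) unit_iff[OF x] by blast
      moreover have "rat x ?t \<le> rat y ?t + 2 * hp ?t" using assms(3) by (simp add: req_def)
      moreover have "rat y ?t < rat y k + hp k" using real_close[OF assms(2), of ?t "hp k" k] t by simp
      ultimately show ?thesis using t t0 hp_pos[of t0] by linarith
    qed
    ultimately show ?thesis by (meson dense_ge dense_le less_imp_le)
  qed
  then show ?thesis using unit_iff[OF assms(2)] by blast
qed

end

section \<open>Sets of rational translates and the enumeration of a strongly countable set\<close>

locale bijection = refutation +
  fixes A Y
  assumes A: "A \<in> D ty2" and A_sub: "subunit A" and Y: "Y \<in> D ty2"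
    and Y_ext: "\<And>x y. x \<in> D ty1 \<Longrightarrow> y \<in> D ty1 \<Longrightarrow> unit x \<Longrightarrow> unit y \<Longrightarrow> req x y \<Longrightarrow> Y @@@ x = Y @@@ y"
    and Y_inj: "\<And>x y. x \<in> D ty1 \<Longrightarrow> y \<in> D ty1 \<Longrightarrow> elm x A \<Longrightarrow> elm y A \<Longrightarrow> Y @@@ x = Y @@@ y \<Longrightarrow> req x y"
    and Y_surj: "\<And>n. \<exists>x\<in>D ty1. elm x A \<and> Y @@@ x = n"
begin

text \<open>\<open>near n k\<close> is the set \<open>S\<^sub>n\<^sub>,\<^sub>k\<close> of the introduction.\<close>

definition near :: "mnat \<Rightarrow> mnat \<Rightarrow> tm set \<Rightarrow> bool" where
  "near n k x \<longleftrightarrow> unit x \<and> (\<exists>c. - hp k < rat_of c \<and> rat_of c < hp k \<and> elm (addr x (rat_of c)) A \<and>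
     Y @@@ addr x (rat_of c) = n)"

text \<open>The principle speaks of a single sequence of sets, so the two indices \<open>n\<close>
  and \<open>k\<close> are merged by the pairing function.\<close>

definition near_sets :: "tm set" where
  "near_sets = lam N ty2 (\<lambda>u. lam ty1 N (\<lambda>x. nu (if near (fst_of (nm u)) (snd_of (nm u)) x then 1 else 0)))"

text \<open>The shift is quantified through its code, a number, so the predicate is arithmetical in
  \<open>A\<close> and \<open>Y\<close>.\<close>

lemma dec_near: "ndf \<Gamma> F \<Longrightarrow> ndf \<Gamma> G \<Longrightarrow> dfn \<Gamma> ty1 X \<Longrightarrow> dec \<Gamma> (\<lambda>e. near (F e) (G e) (X e))"
  unfolding near_def
  by (intro dec_conj dec_unit ndec_ex dec_qless qdf_uminus qdf_hp qdf_rat_of dec_elm dfn_addr ndec_eq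
    ndf_Fapp dfn.par A Y ndf_weaken dfn_weaken ndf_var) simp_all

lemma near_sets_D: "near_sets \<in> D (N \<rightarrow> ty2)"
  and near_sets_app: "f \<in> D ty1 \<Longrightarrow> near_sets $$ nu j @@@ f = (if near (fst_of j) (snd_of j) f then 1 else 0)"
proof -
  have *: "dfn [ty1, N] N (\<lambda>e. nu (if near (fst_of (nm (e 1))) (snd_of (nm (e 1))) (e 0) then 1 else 0))"
    by (intro dfn_nu ndf_if dec_near ndf_fst_of ndf_snd_of ndf_const ndf_var dfn.var) simp_all
  then have **: "dfn [N] ty2 (\<lambda>e. lam ty1 N (\<lambda>x. nu (if near (fst_of (nm (e 0))) (snd_of (nm (e 0))) x then 1 else 0)))"
    by (intro dfn_lam) simp
  show "near_sets \<in> D (N \<rightarrow> ty2)" unfolding near_sets_def using ** by (rule lam_D)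
  have j: "near_sets $$ nu j = lam ty1 N (\<lambda>x. nu (if near (fst_of j) (snd_of j) x then 1 else 0))"
    unfolding near_sets_def using lam_app[OF ** nu_D[of j]] by simp
  have "dfn [ty1] N (\<lambda>e. nu (if near (fst_of j) (snd_of j) (e 0) then 1 else 0))"
    by (intro dfn_nu ndf_if dec_near ndf_const dfn.var) simp_all
  from lam_app[OF this] show "f \<in> D ty1 \<Longrightarrow> near_sets $$ nu j @@@ f = (if near (fst_of j) (snd_of j) f then 1 else 0)"
    unfolding j Fapp_def by simp
qed

lemma elm_near_sets: "f \<in> D ty1 \<Longrightarrow> elm f (near_sets $$ nu j) \<longleftrightarrow> near (fst_of j) (snd_of j) f"
  unfolding elm_def near_sets_app by (auto simp: near_def unit_def)

lemma isset_A: "isset A" using A_sub by (simp add: subunit_def)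

lemma unit_A: "x \<in> D ty1 \<Longrightarrow> elm x A \<Longrightarrow> unit x" using A_sub by (simp add: subunit_def)

lemma A_label: "elm x A \<Longrightarrow> x \<in> D ty1 \<Longrightarrow> y \<in> D ty1 \<Longrightarrow> isreal y \<Longrightarrow> req x y \<Longrightarrow> elm y A \<and> Y @@@ x = Y @@@ y"
  using isset_req[OF isset_A] unit_A Y_ext by metis

lemma near_req: "near n k x \<Longrightarrow> x \<in> D ty1 \<Longrightarrow> y \<in> D ty1 \<Longrightarrow> isreal y \<Longrightarrow> req x y \<Longrightarrow> near n k y"
proof -
  assume x: "near n k x" "x \<in> D ty1" and y: "y \<in> D ty1" "isreal y" "req x y"
  then obtain c where c: "- hp k < rat_of c" "rat_of c < hp k" "elm (addr x (rat_of c)) A"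
     "Y @@@ addr x (rat_of c) = n" by (auto simp: near_def)
  have "elm (addr y (rat_of c)) A \<and> Y @@@ addr x (rat_of c) = Y @@@ addr y (rat_of c)"
    using c(3) x y by (intro A_label addr_D req_addr) (simp_all add: isreal_addr)
  moreover have "unit y" using x y unit_req by (auto simp: near_def)
  ultimately show ?thesis unfolding near_def using c by metis
qed

lemma subunit_near_sets: "subunit (near_sets $$ nu j)"
  unfolding subunit_def isset_def
proof (intro conjI ballI HOL.impI)
  fix x assume x: "x \<in> D ty1" "isreal x"
  show "near_sets $$ nu j @@@ x = 0 \<or> near_sets $$ nu j @@@ x = 1" using x by (simp add: near_sets_app)
  fix y assume y: "y \<in> D ty1" "isreal y \<and> req x y"
  have "near (fst_of j) (snd_of j) x \<longleftrightarrow> near (fst_of j) (snd_of j) y"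
    using near_req[OF _ x(1) y(1)] near_req[OF _ y(1) x(1)] x y req_sym by blast
  then show "near_sets $$ nu j @@@ x = near_sets $$ nu j @@@ y" using x y by (simp add: near_sets_app)
qed (simp add: elm_near_sets, simp add: near_def)

text \<open>All rational translates of \<open>w\<close>, including large ones and those outside the
  unit interval: an enumeration may contain reals that do not belong to the set.\<close>

definition translates :: "tm set \<Rightarrow> tm set" where
  "translates w = lam N ty1 (\<lambda>u. addr w (rat_of (nm u)))"

lemma translates: "w \<in> D ty1 \<Longrightarrow> translates w \<in> D (N \<rightarrow> ty1)" "w \<in> D ty1 \<Longrightarrow> translates w $$ nu m = addr w (rat_of m)"
proof -
  assume "w \<in> D ty1"
  then have *: "dfn [N] ty1 (\<lambda>e. addr w (rat_of (nm (e 0))))"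
    by (intro dfn_addr qdf_rat_of ndf_var dfn.par) simp_all
  show "translates w \<in> D (N \<rightarrow> ty1)" unfolding translates_def using * by (rule lam_D)
  show "translates w $$ nu m = addr w (rat_of m)" unfolding translates_def using lam_app[OF *, of "nu m"] by simp
qed

text \<open>If \<open>x\<close> shifted by \<open>c\<close> lies in \<open>A\<close> with the label
  of \<open>w\<close>, injectivity makes it equal to \<open>w\<close>, so \<open>x\<close> is
  \<open>w\<close> shifted by \<open>-c\<close>.\<close>

lemma enums_near_sets:
  assumes w: "w \<in> D ty1" "elm w A" "Y @@@ w = fst_of j"
  shows "enums (translates w) (near_sets $$ nu j)"
  unfolding enums_def translates(2)[OF w(1)]
proof (intro conjI HOL.allI ballI HOL.impI)
  show "isreal (addr w (rat_of m))" for m using w by (simp add: isreal_addr elm_def)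
  fix x assume x: "x \<in> D ty1" "elm x (near_sets $$ nu j)"
  then obtain c where c: "elm (addr x (rat_of c)) A" "Y @@@ addr x (rat_of c) = fst_of j"
    by (auto simp: elm_near_sets near_def)
  then have "req (addr x (rat_of c)) w" using w x by (intro Y_inj addr_D) simp_all
  then have "req x (addr w (- rat_of c))" using x w by (intro req_addr_swap)
  then have "req x (addr w (rat_of (code_of (- rat_of c))))" by simp
  then show "\<exists>m. req x (addr w (rat_of m))" by blast
qed

lemma enumb_near_sets: "enumb (near_sets $$ nu j)"
  unfolding enumb_def using Y_surj[of "fst_of j"] enums_near_sets translates(1) by blast

text \<open>A point \<open>x\<close> close to \<open>w\<close> is the limit of the translates of
  \<open>w\<close> by \<open>rat x i - rat w i\<close>. The margin \<open>hp (k + 4)\<close> keeps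
  these translates in the unit interval, and \<open>hp (k + 2) + hp (k + 4) < hp k\<close> keeps the
  shifts small enough.\<close>

lemma inclo_near_sets:
  assumes w: "w \<in> D ty1" "elm w A" "Y @@@ w = n"
    and x: "x \<in> D ty1" "isreal x" "\<And>i. hp (k + 4) \<le> rat x i" "\<And>i. rat x i \<le> 1 - hp (k + 4)"
    and xw: "\<And>i. rat x i \<le> rat w (k + 4) + hp (k + 2)" "\<And>i. rat w (k + 4) \<le> rat x i + hp (k + 2)"
  shows "inclo x (near_sets $$ nu (pair_of n k))"
  unfolding inclo_def
proof (intro conjI bexI HOL.allI)
  let ?S = "near_sets $$ nu (pair_of n k)"
  have wr: "isreal w" using w by (simp add: elm_def)
  show "isreal x" by (rule x)
  show "translates w \<in> D (N \<rightarrow> ty1)" by (rule translates[OF w(1)])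
  show "enums (translates w) ?S" using w by (intro enums_near_sets) simp_all
  fix k'
  \<comment> \<open>An index beyond \<open>k + 4\<close> and \<open>k' + 2\<close>. There
    \<open>?y\<close> has the same approximation as \<open>x\<close>, so that in \<open>rdl\<close>
    only \<open>2 * hp ?i\<close> remains, at most half of \<open>hp k'\<close>.\<close>
  let ?i = "k + 4 + (k' + 2)"
  let ?q = "rat x ?i - rat w ?i"
  let ?m = "code_of ?q"
  let ?y = "translates w $$ nu ?m"
  have i: "hp ?i \<le> hp (k + 4)" "hp ?i \<le> hp (k' + 2)"
    using hp_add[of "k + 4" "k' + 2"] hp_add[of "k' + 2" "k + 4"] by (simp_all add: add.commute)
  have y: "?y = addr w ?q" using translates(2)[OF w(1), of ?m] by simp
  have yD: "?y \<in> D ty1" unfolding y by (rule addr_D[OF w(1)])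
  have ry: "rat ?y t = rat w t + ?q" for t unfolding y by (rule rat_addr[OF w(1)])
  have yr: "isreal ?y" unfolding y using wr w(1) by (simp add: isreal_addr)
  have "rdl x ?y k'"
    unfolding rdl_def ry
    by (rule exI[of _ ?i]) (use i hp_suc2[of k'] hp_pos[of k'] in \<open>simp; linarith\<close>)
  moreover have "unit ?y"
    unfolding unit_iff[OF yr] ry
  proof
    fix t
    show "- hp t \<le> rat w t + ?q \<and> rat w t + ?q \<le> 1 + hp t"
    \<comment> \<open>The error of \<open>w\<close> between \<open>t\<close> and \<open>?i\<close>
      is at most the larger of the two tolerances: either it is \<open>hp t\<close>, which the goal
      allows, or it is at most \<open>hp (k + 4)\<close>, the margin of \<open>x\<close>.\<close>
    proof (cases "hp ?i \<le> hp t")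
      case True
      then have "rat w ?i < rat w t + hp t" "rat w t < rat w ?i + hp t"
        by (auto intro: real_close[OF wr])
      then show ?thesis using x(3)[of ?i] x(4)[of ?i] hp_pos[of "k + 4"] by linarith
    next
      case False
      then have "rat w ?i < rat w t + hp ?i" "rat w t < rat w ?i + hp ?i"
        by (auto intro: real_close[OF wr])
      then show ?thesis using x(3)[of ?i] x(4)[of ?i] i(1) hp_pos[of t] by linarith
    qed
  qed
  moreover have "- hp k < - ?q" "- ?q < hp k"
  proof -
    have "rat w ?i < rat w (k + 4) + hp (k + 4)" "rat w (k + 4) < rat w ?i + hp (k + 4)"
      using i by (intro real_close[OF wr]; simp)+
    then show "- hp k < - ?q" "- ?q < hp k"
      using xw[of ?i] hp_suc2[of k] hp_suc4[of k] hp_pos[of k] by linarith+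
  qed
  \<comment> \<open>Shifting \<open>?y\<close> back restores the approximations of \<open>w\<close>,
    and with them membership and label.\<close>
  moreover have "elm (addr ?y (- ?q)) A \<and> Y @@@ w = Y @@@ addr ?y (- ?q)"
  proof (rule A_label)
    have "rat (addr ?y (- ?q)) t = rat w t" for t using rat_addr[OF yD] ry by simp
    then show "req w (addr ?y (- ?q))" by (simp add: req_def less_imp_le)
    show "isreal (addr ?y (- ?q))" using yr yD isreal_addr by simp
  qed (use w yD addr_D in auto)
  ultimately have "rdl x ?y k' \<and> near n k ?y"
    unfolding near_def using w(3) by (metis rat_code)
  then show "\<exists>m. rdl x (translates w $$ nu m) k' \<and> elm (translates w $$ nu m) ?S"
    using elm_near_sets[OF yD, of "pair_of n k"] by auto
qed

lemma posm_near_sets: "posm (near_sets $$ nu j)"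
proof -
  define n k where "n = fst_of j" and "k = snd_of j"
  obtain u v where "codes_pair j u v" using codes_pair_surj by blast
  then have "codes_pair j n k" unfolding n_def k_def using codes_pair_fst codes_pair_snd by metis
  then have j: "elm f (near_sets $$ nu j) \<longleftrightarrow> elm f (near_sets $$ nu (pair_of n k))" if "f \<in> D ty1" for f
    using that by (simp add: elm_near_sets n_def k_def)
  \<comment> \<open>The closure depends on the elements only, so it may be computed for the explicit
    pair \<open>pair_of n k\<close>.\<close>
  have incl: "inclo x (near_sets $$ nu j)" if x: "inclo x (near_sets $$ nu (pair_of n k))" for x
  proof -
    obtain y where y: "y \<in> D (N \<rightarrow> ty1)" "enums y (near_sets $$ nu (pair_of n k))"
      "\<forall>k'. \<exists>m. rdl x (y $$ nu m) k' \<and> elm (y $$ nu m) (near_sets $$ nu (pair_of n k))" "isreal x"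
      using x unfolding inclo_def by blast
    have "enums y (near_sets $$ nu j)" using y(2) j by (auto simp: enums_def)
    moreover have "\<forall>k'. \<exists>m. rdl x (y $$ nu m) k' \<and> elm (y $$ nu m) (near_sets $$ nu j)"
      using y(3) j[OF seq_D[OF y(1)]] by simp
    ultimately show ?thesis using y(1,4) by (auto simp: inclo_def)
  qed
  obtain w where w: "w \<in> D ty1" "elm w A" "Y @@@ w = n" using Y_surj by blast
  have wr: "isreal w" using w by (simp add: elm_def)
  let ?q = "rat w (k + 4)"
  have q: "- hp (k + 4) \<le> ?q" "?q \<le> 1 + hp (k + 4)"
    using unit_A[OF w(1,2)] unit_iff[OF wr] by blast+
  have k1: "hp k \<le> 1" using hp_add[of 0 k] by simp
  \<comment> \<open>Left end of an interval of length \<open>hp (k + 3)\<close> beside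
    \<open>?q\<close>, on the side that has room in the unit interval. Its distance
    \<open>hp (k + 3)\<close> from \<open>?q\<close> outweighs the error \<open>hp (k + 4)\<close>
    of this approximation and leaves the margin \<open>hp (k + 4)\<close>.\<close>
  define l where "l = (if ?q \<le> 1 / 2 then ?q + hp (k + 3) else ?q - hp (k + 2))"
  note h = q k1 hp_suc2[of k] hp_suc3[of k] hp_suc4[of k] hp_pos[of k]
  have l: "hp (k + 4) \<le> l \<and> l + hp (k + 3) \<le> 1 - hp (k + 4) \<and>
    l + hp (k + 3) \<le> ?q + hp (k + 2) \<and> ?q \<le> l + hp (k + 2)"
  proof (cases "?q \<le> 1 / 2")
    case True
    then have "l = ?q + hp (k + 3)" by (simp add: l_def)
    then show ?thesis using True h by linarith
  next
    case False
    then have "l = ?q - hp (k + 2)" by (simp add: l_def)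
    then show ?thesis using False h by linarith
  qed
  show ?thesis
    unfolding posm_def
  \<comment> \<open>Half the length of the interval just chosen: by \<open>small_cover\<close> no
    cover of at most this total length contains the whole interval.\<close>
  proof (rule exI[of _ "k + 3 + 1"], intro ballI HOL.impI)
    fix a b s assume D: "a \<in> D ty1" "b \<in> D ty1" "s \<in> D ty1"
      and cov: "covers a b (near_sets $$ nu j) \<and> plen a b s"
    show "\<exists>m. hp (k + 3 + 1) < rat s m"
    proof (rule ccontr)
      assume "\<not> ?thesis"
      then have s: "rat s m \<le> hp (k + 3 + 1)" for m by (simp add: not_less)
      obtain x where x: "x \<in> D ty1" "isreal x" "\<forall>i. l \<le> rat x i \<and> rat x i \<le> l + hp (k + 3)"
        "\<forall>i. \<not> (gtr x (rat a i) \<and> ltr x (rat b i))"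
        using small_cover[OF D _ _ s, of l] cov by (auto simp: covers_def)
      have "inclo x (near_sets $$ nu (pair_of n k))"
      proof (rule inclo_near_sets[OF w x(1,2)])
        fix i
        have i: "l \<le> rat x i" "rat x i \<le> l + hp (k + 3)" using x(3) by simp_all
        show "hp (k + 4) \<le> rat x i" using i l by linarith
        show "rat x i \<le> 1 - hp (k + 4)" using i l by linarith
        show "rat x i \<le> ?q + hp (k + 2)" using i l by linarith
        show "?q \<le> rat x i + hp (k + 2)" using i l by linarith
      qed
      then show False using incl cov x(1,4) by (auto simp: covers_def)
    qed
  qed
qed

text \<open>The path from \<open>rat v k\<close> to \<open>rat w t\<close> costs \<open>hp k\<close>
  inside \<open>v\<close>, \<open>hp k - 2 * hp j\<close> from \<open>v\<close> to a nearby element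
  \<open>z\<close>, \<open>hp k\<close> for the shift of \<open>z\<close>, \<open>2 * hp j\<close>
  for the equality of the shifted \<open>z\<close> with \<open>w\<close>, and
  \<open>hp k / 2 + hp t\<close> inside \<open>w\<close>. The terms in \<open>j\<close>
  cancel.\<close>

lemma near_sets_close:
  assumes v: "v \<in> D ty1" "inclo v (near_sets $$ nu (pair_of n k))"
    and w: "w \<in> D ty1" "elm w A" "Y @@@ w = n"
  shows "rat v k < rat w t + (7 / 2 * hp k + hp t)" "rat w t < rat v k + (7 / 2 * hp k + hp t)"
proof -
  have vr: "isreal v" and wr: "isreal w" using v w by (auto simp: inclo_def elm_def)
  obtain y where "y \<in> D (N \<rightarrow> ty1)"
      "\<forall>k'. \<exists>m. rdl v (y $$ nu m) k' \<and> elm (y $$ nu m) (near_sets $$ nu (pair_of n k))"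
    using v by (auto simp: inclo_def)
  then obtain z where z: "z \<in> D ty1" "rdl v z k" "elm z (near_sets $$ nu (pair_of n k))"
    using seq_D by blast
  obtain c where c: "- hp k < rat_of c" "rat_of c < hp k" "elm (addr z (rat_of c)) A"
     "Y @@@ addr z (rat_of c) = n" using z by (auto simp: elm_near_sets near_def)
  obtain j where j: "rat v j + - rat z j + 2 * hp j < hp k" "rat z j + - rat v j + 2 * hp j < hp k"
    using z(2) by (auto simp: rdl_def)
  have "req (addr z (rat_of c)) w" using c w z by (intro Y_inj addr_D) simp_all
  then have zw: "rat z j + rat_of c \<le> rat w j + 2 * hp j" "rat w j \<le> rat z j + rat_of c + 2 * hp j"
    by (auto simp: req_def rat_addr[OF z(1)])
  \<comment> \<open>The two inequalities for \<open>j\<close> add up to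
    \<open>4 * hp j < 2 * hp k\<close>.\<close>
  have hj: "hp j \<le> hp k / 2" using j by linarith
  then have le: "hp j \<le> hp k" "hp j \<le> hp k / 2 + hp t" "hp t \<le> hp k / 2 + hp t"
    using hp_pos[of k] hp_pos[of t] by linarith+
  have "rat v k < rat v j + hp k" "rat v j < rat v k + hp k"
    by (rule real_close[OF vr order_refl le(1)] real_close[OF vr le(1) order_refl])+
  moreover have "rat w t < rat w j + (hp k / 2 + hp t)" "rat w j < rat w t + (hp k / 2 + hp t)"
    by (rule real_close[OF wr le(3,2)] real_close[OF wr le(2,3)])+
  ultimately show "rat v k < rat w t + (7 / 2 * hp k + hp t)" "rat w t < rat v k + (7 / 2 * hp k + hp t)"
    using j zw c by linarith+
qed

lemma enumb_A: "CP \<Longrightarrow> enumb A"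
proof -
  assume CP
  then obtain v where v: "v \<in> D (N \<rightarrow> ty1)" "\<forall>j. inclo (v $$ nu j) (near_sets $$ nu j)"
    using near_sets_D subunit_near_sets enumb_near_sets posm_near_sets unfolding CP_def by blast
  \<comment> \<open>Taken from the chosen points \<open>v\<close> alone, without reference to any
    \<open>w\<close>. The shift of the index by 3 turns \<open>7 / 2 * hp k\<close> into
    \<open>7 / 16 * hp i\<close>, less than half of \<open>hp i\<close>.\<close>
  define z where "z n i = rat (v $$ nu (pair_of n (i + 3))) (i + 3)" for n i
  define Z where "Z = lam N ty1 (\<lambda>u. fun1 (\<lambda>i. code_of (z (nm u) i)))"
  have q: "qdf \<Gamma> (\<lambda>e. z (F e) (G e))" if "ndf \<Gamma> F" "ndf \<Gamma> G" for \<Gamma> F G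
    unfolding z_def by (intro qdf_rat dfn_seq_app v ndf_pair_of ndf_plus ndf_const that)
  have Zd: "dfn [N] ty1 (\<lambda>e. fun1 (\<lambda>i. code_of (z (nm (e 0)) i)))"
    by (intro dfn_fun1 ndf_code_of q ndf_var) simp_all
  have Z: "Z \<in> D (N \<rightarrow> ty1)" unfolding Z_def using Zd by (rule lam_D)
  have Zn: "rat (Z $$ nu n) i = z n i" for n i
  proof -
    have "Z $$ nu n = fun1 (\<lambda>i. code_of (z n i))" unfolding Z_def using lam_app[OF Zd nu_D[of n]] by simp
    moreover have "qdf [N] (\<lambda>e. z n (nm (e 0)))" by (intro q ndf_const ndf_var) simp_all
    ultimately show ?thesis using rat_fun1 by simp
  qed
  have close: "z n i < rat w t + (7 / 16 * hp i + hp t)" "rat w t < z n i + (7 / 16 * hp i + hp t)"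
    if w: "w \<in> D ty1" "elm w A" "Y @@@ w = n" for w n i t
    using near_sets_close[OF seq_D[OF v(1)] _ w, of "pair_of n (i + 3)" "i + 3" t] v(2)
    unfolding z_def hp_suc3 by auto
  have "isreal (Z $$ nu n)" for n
  proof -
    obtain w where w: "w \<in> D ty1" "elm w A" "Y @@@ w = n" using Y_surj by blast
    show ?thesis unfolding isreal_def Zn
    proof (intro HOL.allI)
      fix i s
      \<comment> \<open>Both values are compared with \<open>w\<close> at index
        \<open>i + 5\<close>: twice \<open>7 / 16\<close> and twice \<open>1 / 32\<close> of
        \<open>hp i\<close> make \<open>15 / 16\<close>.\<close>
      show "z n i < z n (i + s) + hp i \<and> z n (i + s) < z n i + hp i"
        using close[OF w, where i = i and t = "i + 5"] close[OF w, where i = "i + s" and t = "i + 5"] hp_suc5[of i] hp_add[of i s] hp_pos[of i]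
        by linarith
    qed
  qed
  moreover have "\<exists>n. req x (Z $$ nu n)" if x: "x \<in> D ty1" "elm x A" for x
  proof (rule exI[of _ "Y @@@ x"])
    show "req x (Z $$ nu (Y @@@ x))"
      unfolding req_def Zn
    proof
      fix i
      show "rat x i \<le> z (Y @@@ x) i + 2 * hp i \<and> z (Y @@@ x) i \<le> rat x i + 2 * hp i"
        using close[OF x refl, where i = i and t = i] hp_pos[of i] by linarith
    qed
  qed
  ultimately show ?thesis unfolding enumb_def enums_def using Z by blast
qed

end

lemma (in refutation) CP_CO: "CP \<longrightarrow> CO"
  unfolding CO_def
proof (intro HOL.impI ballI)
  fix A assume CP and A: "A \<in> D ty2" "subunit A \<and> strc A"
  then have "strc A" by simp
  then obtain Y where Y: "Y \<in> D ty2"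
     "\<forall>x\<in>D ty1. \<forall>y\<in>D ty1. unit x \<and> unit y \<and> req x y \<longrightarrow> Y @@@ x = Y @@@ y"
     "\<forall>x\<in>D ty1. \<forall>y\<in>D ty1. elm x A \<and> elm y A \<and> Y @@@ x = Y @@@ y \<longrightarrow> req x y"
     "\<forall>n. \<exists>x\<in>D ty1. elm x A \<and> Y @@@ x = n"
    unfolding strc_def by (elim bexE conjE)
  interpret bijection A Y
    by unfold_locales (use A Y(1) in simp, use A in simp, rule Y(1), use Y(2) in simp, use Y(3) in simp, rule Y(4)[rule_format])
  show "enumb A" using \<open>CP\<close> by (rule enumb_A)
qed

lemma not_refuted: "\<not> refuted"
proof
  assume refuted
  then interpret refutation by unfold_locales
  have "counter_model CM" using \<open>refuted\<close> unfolding refuted_def CM_def by (rule someI_ex)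
  then show False using truth_implications QF_CN CN_CP CP_CO by (simp add: counter_model_def)
qed

text \<open>\<open>completeness\<close> yields its counter-model on the carrier
  \<open>tm set\<close>, so structures over this one type suffice, and the counter-model fixed above
  has the right type.\<close>

lemma provable_if_true:
  assumes "wff [] (\<phi> 0)" "\<And>M :: tm set struct. aca_structure M \<Longrightarrow> truth M (\<phi> 0)"
  shows "ACA0w \<turnstile> \<phi>"
  unfolding provable_def
proof (rule ccontr)
  assume "\<not> prv ACA0w [] [] (\<phi> 0)"
  moreover have "extensionality_axiom \<rho> \<tau> 0 \<in> ACA0w" for \<rho> \<tau>
    unfolding ACA0w_def using RCA0w.intros(5) by blast
  ultimately obtain M :: "tm set struct" where "ext_structure M"
    "\<forall>\<psi>\<in>ACA0w. wff [] \<psi> \<longrightarrow> truth M \<psi>" "\<not> truth M (\<phi> 0)"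
    using completeness[OF assms(1)] by blast
  then show False
    using assms(2)[of M] by (auto simp: aca_structure_def aca_structure_axioms_def)
qed

theorem theorem4p5:
  shows "(ACA0w \<turnstile> (QF_AC_01 \<^bold>\<longrightarrow> closure_choice_nonempty)) \<and>
         (ACA0w \<turnstile> (closure_choice_nonempty \<^bold>\<longrightarrow> closure_choice_positive_measure)) \<and>
         (ACA0w \<turnstile> (closure_choice_positive_measure \<^bold>\<longrightarrow> cocode_1))"
proof (intro conjI provable_if_true)
  show "wff [] ((QF_AC_01 \<^bold>\<longrightarrow> closure_choice_nonempty) 0)"
    "wff [] ((closure_choice_nonempty \<^bold>\<longrightarrow> closure_choice_positive_measure) 0)"
    "wff [] ((closure_choice_positive_measure \<^bold>\<longrightarrow> cocode_1) 0)"
    by code_simp+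
qed (use not_refuted in \<open>auto simp: refuted_def counter_model_def\<close>)

end
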